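(* Let $n,q$ be coprime integers with $1<q<n$, let $\frac{n}{n-q}=[a_2,\dots,a_{e-1}]$ with $e\ge4$, and let $A=\mathbb C[x,y,z]/(F)$ with $$F=y^N+x^{a_2-1}y^{2\alpha}z^H-xz^L,\qquad N=2\alpha+2s_3,\ H=2\widehat s_3,\ L=2\beta+2\widehat s_3.$$ For a parameter $\theta\in\Theta_{\min}$ (see context) let $E_\theta=\operatorname{coker}(\Phi_\theta)$. Then $E_\theta$ is a rank-two maximal Cohen-Macaulay $A$-module minimally generated by four elements.
   Context: $[c_1,\dots,c_m]=c_1-\cfrac{1}{c_2-\cfrac{1}{\ddots-\cfrac1{c_m}}}$ with integers $c_i\ge2$. Exponents. For $e\ge5$: $s_e=0$, $s_{e-1}=1$, $s_{e-2}=a_{e-1}$, and $s_j=(a_{j+1}-1)s_{j+1}+(a_{j+2}-1)s_{j+2}-s_{j+3}$ for $3\le j\le e-3$; $\widehat s_{e-1}=0$, $\widehat s_{e-2}=1$, $\widehat s_{e-3}=a_{e-2}$, and $\widehat s_j=(a_{j+1}-1)\widehat s_{j+1}+(a_{j+2}-1)\widehat s_{j+2}-\widehat s_{j+3}$ for $3\le j\le e-4$; $\alpha=1+\sum_{j=3}^{e-1}(a_j-2)s_j$, $\beta=1+\sum_{j=3}^{e-2}(a_j-2)\widehat s_j$. For $e=4$: $s_3=1$, $\widehat s_3=0$, $\alpha=a_3-1$, $\beta=1$. The polynomial $F$ is irreducible, so $A$ is a domain. Parameters and matrices: $\theta=(r,u,v,w,\delta,\ell)$ with integers $1\le r\le N-1$,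 $0\le u\le a_2-1$, $0\le v\le2\alpha$, $0\le w\le H$, $\delta\in\{0,1\}$, $1\le\ell\le L-1$; $$p_1=y^r,\ q_1=y^{N-r},\ p_2=x^uy^vz^w,\ q_2=x^{a_2-1-u}y^{2\alpha-v}z^{H-w},\ p_3=(-1)^\delta x^\delta z^\ell,\ q_3=(-1)^{1-\delta}x^{1-\delta}z^{L-\ell},$$ $$\Phi_\theta=\begin{pmatrix} p_1 & -q_2 & -q_3 & 0 \\ p_2 & q_1 & 0 & -q_3 \\ p_3 & 0 & q_1 & q_2 \\ 0 & p_3 & -p_2 & p_1 \end{pmatrix},\qquad \Psi_\theta=\begin{pmatrix} q_1 & q_2 & q_3 & 0 \\ -p_2 & p_1 & 0 & q_3 \\ -p_3 & 0 & p_1 & -q_2 \\ 0 & -p_3 & p_2 & q_1 \end{pmatrix}.$$ The pair $(\Phi_\theta,\Psi_\theta)$ is a matrix factorization of $F$. $\Theta_{\min}$ is the set of such $\theta$ for which all of $p_1,q_1,p_2,q_2,p_3,q_3$ lie in the maximal ideal $\mathfrak m=(x,y,z)$. A finitely generated $A$-module $M$ is maximal Cohen-Macaulay if its depth equals $\dim A$; rank means dimension over $\operatorname{Frac}(A)$ after tensoring. *)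

theory Defs
  imports
    "HOL-Algebra.QuotRing"
    "HOL-Algebra.Free_Abelian_Groups"
    "HOL-Library.Extended_Nat"
    "Jordan_Normal_Form.VS_Connect"
begin

section \<open>Commutative algebra of modules over \<open>HOL-Algebra\<close> rings\<close>

subsection \<open>Quotients and cokernels\<close>

definition quot_module :: "('a, 'b) module \<Rightarrow> 'b set \<Rightarrow> ('a, 'b set) module" where
  "quot_module M N =
     \<lparr>carrier = a_rcosets\<^bsub>M\<^esub> N, mult = undefined, one = undefined,
      ring.zero = N, add = set_add M,
      smult = (\<lambda>r X. \<Union>x\<in>X. N +>\<^bsub>M\<^esub> (r \<odot>\<^bsub>M\<^esub> x))\<rparr>"

text \<open>The column-vector convention is used: an \<open>m \<times> n\<close> matrix over \<open>R\<close> is a map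
  \<open>R\<^sup>n \<rightarrow> R\<^sup>m\<close>. The free module \<open>R\<^sup>n\<close> is \<^const>\<open>ring.func_space\<close> on \<open>{..<n}\<close>.\<close>

definition mat_map :: "('a, 'r) ring_scheme \<Rightarrow> 'a mat \<Rightarrow> (nat \<Rightarrow> 'a) \<Rightarrow> nat \<Rightarrow> 'a" where
  "mat_map R P v =
     restrict (\<lambda>i. \<Oplus>\<^bsub>R\<^esub>j\<in>{..<dim_col P}. P $$ (i, j) \<otimes>\<^bsub>R\<^esub> v j) {..<dim_row P}"

definition coker :: "('a, 'r) ring_scheme \<Rightarrow> 'a mat \<Rightarrow> ('a, (nat \<Rightarrow> 'a) set) module" where
  "coker R P =
     quot_module (ring.func_space R {..<dim_row P})
       (mat_map R P ` carrier (ring.func_space R {..<dim_col P}))"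


subsection \<open>Generators\<close>

definition finitely_generated :: "('a, 'r) ring_scheme \<Rightarrow> ('a, 'b) module \<Rightarrow> bool" where
  "finitely_generated R M \<longleftrightarrow>
     (\<exists>B. finite B \<and> B \<subseteq> carrier M \<and> LinearCombinations.module.gen_set R M B)"

text \<open>Some generating set has \<open>k\<close> elements and none has fewer.\<close>

definition minimally_generated_by :: "('a, 'r) ring_scheme \<Rightarrow> ('a, 'b) module \<Rightarrow> nat \<Rightarrow> bool" where
  "minimally_generated_by R M k \<longleftrightarrow>
     (\<exists>B. finite B \<and> card B = k \<and> B \<subseteq> carrier M \<and> LinearCombinations.module.gen_set R M B) \<and>
     (\<forall>B. finite B \<and> B \<subseteq> carrier M \<and> LinearCombinations.module.gen_set R M B \<longrightarrow> k \<le> card B)"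


subsection \<open>Krull dimension, depth, maximal Cohen-Macaulay modules\<close>

definition krull_dim :: "('a, 'r) ring_scheme \<Rightarrow> enat" where
  "krull_dim R = Sup {enat n | n. \<exists>P :: nat \<Rightarrow> 'a set.
     (\<forall>i\<le>n. primeideal (P i) R) \<and> (\<forall>i<n. P i \<subset> P (Suc i))}"

text \<open>The submodule \<open>(f\<^sub>1, \<dots>, f\<^sub>k) M\<close>.\<close>

definition seq_times_module :: "('a, 'b) module \<Rightarrow> 'a list \<Rightarrow> 'b set" where
  "seq_times_module M fs =
     {\<Oplus>\<^bsub>M\<^esub>i\<in>{..<length fs}. (fs ! i) \<odot>\<^bsub>M\<^esub> m i | m. m \<in> {..<length fs} \<rightarrow> carrier M}"

definition regular_sequence :: "('a, 'r) ring_scheme \<Rightarrow> ('a, 'b) module \<Rightarrow> 'a list \<Rightarrow> bool" where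
  "regular_sequence R M fs \<longleftrightarrow>
     set fs \<subseteq> carrier R \<and>
     (\<forall>i<length fs. \<forall>m\<in>carrier M.
        (fs ! i) \<odot>\<^bsub>M\<^esub> m \<in> seq_times_module M (take i fs) \<longrightarrow>
        m \<in> seq_times_module M (take i fs)) \<and>
     seq_times_module M fs \<noteq> carrier M"

definition depth :: "('a, 'r) ring_scheme \<Rightarrow> 'a set \<Rightarrow> ('a, 'b) module \<Rightarrow> enat" where
  "depth R I M = Sup {enat (length fs) | fs. set fs \<subseteq> I \<and> regular_sequence R M fs}"

text \<open>The ring is not assumed to be local, so the depth condition is required at every maximal
  ideal \<open>\<nn>\<close>, with \<open>depth(\<nn>, M)\<close> the supremum of the lengths of \<open>M\<close>-regular sequences in \<open>\<nn>\<close>.\<close>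

definition maximal_cohen_macaulay :: "('a, 'r) ring_scheme \<Rightarrow> ('a, 'b) module \<Rightarrow> bool" where
  "maximal_cohen_macaulay R M \<longleftrightarrow>
     Module.module R M \<and> finitely_generated R M \<and>
     (\<forall>\<nn>. maximalideal \<nn> R \<longrightarrow> depth R \<nn> M = krull_dim R)"


subsection \<open>Rank of a module over a domain\<close>

text \<open>\<open>frac_class R a b\<close> is the fraction \<open>a/b\<close>, as the set of all pairs representing it.\<close>

definition frac_class :: "('a, 'r) ring_scheme \<Rightarrow> 'a \<Rightarrow> 'a \<Rightarrow> ('a \<times> 'a) set" where
  "frac_class R a b =
     {(c, d). c \<in> carrier R \<and> d \<in> carrier R - {\<zero>\<^bsub>R\<^esub>} \<and> a \<otimes>\<^bsub>R\<^esub> d = c \<otimes>\<^bsub>R\<^esub> b}"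

definition frac_field :: "('a, 'r) ring_scheme \<Rightarrow> ('a \<times> 'a) set ring" where
  "frac_field R =
     \<lparr>carrier = {frac_class R a b | a b. a \<in> carrier R \<and> b \<in> carrier R - {\<zero>\<^bsub>R\<^esub>}},
      mult = (\<lambda>X Y. \<Union>(a, b)\<in>X. \<Union>(c, d)\<in>Y. frac_class R (a \<otimes>\<^bsub>R\<^esub> c) (b \<otimes>\<^bsub>R\<^esub> d)),
      one = frac_class R \<one>\<^bsub>R\<^esub> \<one>\<^bsub>R\<^esub>,
      ring.zero = frac_class R \<zero>\<^bsub>R\<^esub> \<one>\<^bsub>R\<^esub>,
      add = (\<lambda>X Y. \<Union>(a, b)\<in>X. \<Union>(c, d)\<in>Y.
        frac_class R (a \<otimes>\<^bsub>R\<^esub> d \<oplus>\<^bsub>R\<^esub> c \<otimes>\<^bsub>R\<^esub> b) (b \<otimes>\<^bsub>R\<^esub> d))\<rparr>"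

text \<open>\<open>base_change R K \<phi> M\<close> is the \<open>K\<close>-module \<open>K \<otimes>\<^sub>R M\<close> for a ring homomorphism
  \<open>\<phi> : R \<rightarrow> K\<close>: the free abelian group on \<open>K \<times> M\<close> modulo the bilinearity relations.\<close>

definition tensor_relations ::
  "('a, 'r) ring_scheme \<Rightarrow> ('k, 's) ring_scheme \<Rightarrow> ('a \<Rightarrow> 'k) \<Rightarrow> ('a, 'b) module
     \<Rightarrow> ('k \<times> 'b \<Rightarrow>\<^sub>0 int) set" where
  "tensor_relations R K \<phi> M =
     {frag_of (k \<oplus>\<^bsub>K\<^esub> k', m) - frag_of (k, m) - frag_of (k', m) | k k' m.
        k \<in> carrier K \<and> k' \<in> carrier K \<and> m \<in> carrier M} \<union>
     {frag_of (k, m \<oplus>\<^bsub>M\<^esub> m') - frag_of (k, m) - frag_of (k, m') | k m m'.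
        k \<in> carrier K \<and> m \<in> carrier M \<and> m' \<in> carrier M} \<union>
     {frag_of (k \<otimes>\<^bsub>K\<^esub> \<phi> r, m) - frag_of (k, r \<odot>\<^bsub>M\<^esub> m) | k r m.
        k \<in> carrier K \<and> r \<in> carrier R \<and> m \<in> carrier M}"

definition base_change ::
  "('a, 'r) ring_scheme \<Rightarrow> ('k, 's) ring_scheme \<Rightarrow> ('a \<Rightarrow> 'k) \<Rightarrow> ('a, 'b) module
     \<Rightarrow> ('k, ('k \<times> 'b \<Rightarrow>\<^sub>0 int) set) module" where
  "base_change R K \<phi> M =
     (let G = free_Abelian_group (carrier K \<times> carrier M);
          N = generate G (tensor_relations R K \<phi> M)
      in \<lparr>carrier = rcosets\<^bsub>G\<^esub> N, mult = undefined, one = undefined,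
          ring.zero = N, add = set_mult G,
          smult = (\<lambda>k X. \<Union>c\<in>X. N #>\<^bsub>G\<^esub> frag_extend (\<lambda>(k', m). frag_of (k \<otimes>\<^bsub>K\<^esub> k', m)) c)\<rparr>)"

definition has_rank :: "('a, 'r) ring_scheme \<Rightarrow> ('a, 'b) module \<Rightarrow> nat \<Rightarrow> bool" where
  "has_rank R M k \<longleftrightarrow>
     (let K = frac_field R; V = base_change R K (\<lambda>a. frac_class R a \<one>\<^bsub>R\<^esub>) M
      in vectorspace K V \<and> vectorspace.fin_dim K V \<and> vectorspace.dim K V = k)"


section \<open>Exponents attached to a continued fraction\<close>

text \<open>The negative continued fraction \<open>[c\<^sub>1, \<dots>, c\<^sub>m] = c\<^sub>1 - 1/(c\<^sub>2 - 1/(\<dots> - 1/c\<^sub>m))\<close>.\<close>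

fun neg_cfrac :: "int list \<Rightarrow> rat" where
  "neg_cfrac [] = undefined"
| "neg_cfrac [c] = of_int c"
| "neg_cfrac (c # d # cs) = of_int c - 1 / neg_cfrac (d # cs)"

text \<open>\<open>s_exp a e j\<close> is \<open>s\<^sub>j\<close>. \<open>s_hat\<close> obeys the same recursion, started one index
  lower. Both are only used for indices \<open>j \<ge> 3\<close>. The values prescribed separately for \<open>e = 4\<close> are
  the ones the general definition gives (lemma \<open>exponents_e4\<close>).\<close>

function s_exp :: "(nat \<Rightarrow> int) \<Rightarrow> nat \<Rightarrow> nat \<Rightarrow> int" where
  "s_exp a e j =
     (if j \<ge> e then 0
      else if j = e - 1 then 1
      else if j = e - 2 then a (e - 1)
      else (a (j + 1) - 1) * s_exp a e (j + 1) + (a (j + 2) - 1) * s_exp a e (j + 2)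
           - s_exp a e (j + 3))"
  by auto
termination by (relation "measure (\<lambda>(a, e, j). e - j)") auto

declare s_exp.simps [simp del]

function s_hat :: "(nat \<Rightarrow> int) \<Rightarrow> nat \<Rightarrow> nat \<Rightarrow> int" where
  "s_hat a e j =
     (if j \<ge> e - 1 then 0
      else if j = e - 2 then 1
      else if j = e - 3 then a (e - 2)
      else (a (j + 1) - 1) * s_hat a e (j + 1) + (a (j + 2) - 1) * s_hat a e (j + 2)
           - s_hat a e (j + 3))"
  by auto
termination by (relation "measure (\<lambda>(a, e, j). e - j)") auto

declare s_hat.simps [simp del]

definition alpha :: "(nat \<Rightarrow> int) \<Rightarrow> nat \<Rightarrow> int" where
  "alpha a e = 1 + (\<Sum>j = 3..e - 1. (a j - 2) * s_exp a e j)"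

definition beta :: "(nat \<Rightarrow> int) \<Rightarrow> nat \<Rightarrow> int" where
  "beta a e = 1 + (\<Sum>j = 3..e - 2. (a j - 2) * s_hat a e j)"

lemma exponents_e4:
  "s_exp a 4 3 = 1" "s_hat a 4 3 = 0" "alpha a 4 = a 3 - 1" "beta a 4 = 1"
  by (simp_all add: alpha_def beta_def s_exp.simps s_hat.simps)

text \<open>The integers below are nonnegative whenever all \<open>a\<^sub>i \<ge> 2\<close>, so \<^const>\<open>nat\<close> loses nothing.\<close>

definition exp_N :: "(nat \<Rightarrow> int) \<Rightarrow> nat \<Rightarrow> nat" where
  "exp_N a e = nat (2 * alpha a e + 2 * s_exp a e 3)"

definition exp_H :: "(nat \<Rightarrow> int) \<Rightarrow> nat \<Rightarrow> nat" where
  "exp_H a e = nat (2 * s_hat a e 3)"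

definition exp_L :: "(nat \<Rightarrow> int) \<Rightarrow> nat \<Rightarrow> nat" where
  "exp_L a e = nat (2 * beta a e + 2 * s_hat a e 3)"

definition exp_x :: "(nat \<Rightarrow> int) \<Rightarrow> nat" where
  "exp_x a = nat (a 2 - 1)"

definition exp_y :: "(nat \<Rightarrow> int) \<Rightarrow> nat \<Rightarrow> nat" where
  "exp_y a e = nat (2 * alpha a e)"


section \<open>The hypersurface ring\<close>

text \<open>\<open>\<complex>[x, y, z]\<close> is realised as the iterated polynomial ring \<open>\<complex>[x][z][y]\<close>.\<close>

type_synonym poly3 = "complex poly poly poly"

abbreviation poly3_ring :: "poly3 ring" where
  "poly3_ring \<equiv> class_ring"

definition x_var :: poly3 where "x_var = [:[:[:0, 1:]:]:]"
definition y_var :: poly3 where "y_var = [:0, 1:]"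
definition z_var :: poly3 where "z_var = [:[:0, 1:]:]"

definition F_poly :: "(nat \<Rightarrow> int) \<Rightarrow> nat \<Rightarrow> poly3" where
  "F_poly a e = y_var ^ exp_N a e + x_var ^ exp_x a * y_var ^ exp_y a e * z_var ^ exp_H a e
                - x_var * z_var ^ exp_L a e"

definition F_ideal :: "(nat \<Rightarrow> int) \<Rightarrow> nat \<Rightarrow> poly3 set" where
  "F_ideal a e = genideal poly3_ring {F_poly a e}"

definition A_ring :: "(nat \<Rightarrow> int) \<Rightarrow> nat \<Rightarrow> poly3 set ring" where
  "A_ring a e = poly3_ring Quot F_ideal a e"

definition A_class :: "(nat \<Rightarrow> int) \<Rightarrow> nat \<Rightarrow> poly3 \<Rightarrow> poly3 set" where
  "A_class a e f = F_ideal a e +>\<^bsub>poly3_ring\<^esub> f"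

definition xyz_ideal :: "poly3 set" where
  "xyz_ideal = genideal poly3_ring {x_var, y_var, z_var}"


section \<open>The matrices and the modules\<close>

text \<open>A parameter \<open>\<theta> = (r, u, v, w, \<delta>, \<ell>)\<close>.\<close>

record param =
  r_of :: nat
  u_of :: nat
  v_of :: nat
  w_of :: nat
  \<delta>_of :: nat
  l_of :: nat

definition param_range :: "(nat \<Rightarrow> int) \<Rightarrow> nat \<Rightarrow> param \<Rightarrow> bool" where
  "param_range a e \<theta> \<longleftrightarrow>
     1 \<le> r_of \<theta> \<and> r_of \<theta> \<le> exp_N a e - 1 \<and> u_of \<theta> \<le> exp_x a \<and> v_of \<theta> \<le> exp_y a e \<and>
     w_of \<theta> \<le> exp_H a e \<and> \<delta>_of \<theta> \<in> {0, 1} \<and> 1 \<le> l_of \<theta> \<and> l_of \<theta> \<le> exp_L a e - 1"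

definition p\<^sub>1 :: "(nat \<Rightarrow> int) \<Rightarrow> nat \<Rightarrow> param \<Rightarrow> poly3" where
  "p\<^sub>1 a e \<theta> = y_var ^ r_of \<theta>"

definition q\<^sub>1 :: "(nat \<Rightarrow> int) \<Rightarrow> nat \<Rightarrow> param \<Rightarrow> poly3" where
  "q\<^sub>1 a e \<theta> = y_var ^ (exp_N a e - r_of \<theta>)"

definition p\<^sub>2 :: "(nat \<Rightarrow> int) \<Rightarrow> nat \<Rightarrow> param \<Rightarrow> poly3" where
  "p\<^sub>2 a e \<theta> = x_var ^ u_of \<theta> * y_var ^ v_of \<theta> * z_var ^ w_of \<theta>"

definition q\<^sub>2 :: "(nat \<Rightarrow> int) \<Rightarrow> nat \<Rightarrow> param \<Rightarrow> poly3" where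
  "q\<^sub>2 a e \<theta> = x_var ^ (exp_x a - u_of \<theta>) * y_var ^ (exp_y a e - v_of \<theta>)
              * z_var ^ (exp_H a e - w_of \<theta>)"

definition p\<^sub>3 :: "(nat \<Rightarrow> int) \<Rightarrow> nat \<Rightarrow> param \<Rightarrow> poly3" where
  "p\<^sub>3 a e \<theta> = (- 1) ^ \<delta>_of \<theta> * x_var ^ \<delta>_of \<theta> * z_var ^ l_of \<theta>"

definition q\<^sub>3 :: "(nat \<Rightarrow> int) \<Rightarrow> nat \<Rightarrow> param \<Rightarrow> poly3" where
  "q\<^sub>3 a e \<theta> = (- 1) ^ (1 - \<delta>_of \<theta>) * x_var ^ (1 - \<delta>_of \<theta>) * z_var ^ (exp_L a e - l_of \<theta>)"

definition \<Theta>_min :: "(nat \<Rightarrow> int) \<Rightarrow> nat \<Rightarrow> param set" where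
  "\<Theta>_min a e = {\<theta>. param_range a e \<theta> \<and>
     {p\<^sub>1 a e \<theta>, q\<^sub>1 a e \<theta>, p\<^sub>2 a e \<theta>, q\<^sub>2 a e \<theta>, p\<^sub>3 a e \<theta>, q\<^sub>3 a e \<theta>} \<subseteq> xyz_ideal}"

definition \<Phi> :: "(nat \<Rightarrow> int) \<Rightarrow> nat \<Rightarrow> param \<Rightarrow> poly3 mat" where
  "\<Phi> a e \<theta> = mat_of_rows_list 4
     [[p\<^sub>1 a e \<theta>, - q\<^sub>2 a e \<theta>, - q\<^sub>3 a e \<theta>, 0],
      [p\<^sub>2 a e \<theta>, q\<^sub>1 a e \<theta>, 0, - q\<^sub>3 a e \<theta>],
      [p\<^sub>3 a e \<theta>, 0, q\<^sub>1 a e \<theta>, q\<^sub>2 a e \<theta>],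
      [0, p\<^sub>3 a e \<theta>, - p\<^sub>2 a e \<theta>, p\<^sub>1 a e \<theta>]]"

text \<open>The cokernel of \<open>\<Phi>\<^sub>\<theta> : A\<^sup>4 \<rightarrow> A\<^sup>4\<close>.\<close>

definition E_mod :: "(nat \<Rightarrow> int) \<Rightarrow> nat \<Rightarrow> param \<Rightarrow> (poly3 set, (nat \<Rightarrow> poly3 set) set) module" where
  "E_mod a e \<theta> = coker (A_ring a e) (map_mat (A_class a e) (\<Phi> a e \<theta>))"

end

theory Submission
  imports
    Defs
    "HOL-Computational_Algebra.Field_as_Ring"
    "HOL-Computational_Algebra.Polynomial_Factorial"
    "HOL-Computational_Algebra.Fundamental_Theorem_Algebra"
    "HOL-Analysis.Continuum_Not_Denumerable"
begin

text \<open>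
  Since \<open>F\<close> is Eisenstein at \<open>x\<close> and monic in \<open>y\<close>, it is prime, and \<open>\<Phi> \<Psi> = \<Psi> \<Phi> = F\<close> makes
  \<open>E\<close> the quotient of the free module over \<open>\<complex>[x, y, z]\<close> by the image of \<open>\<Phi>\<close>.

  Both upper bounds in \<open>depth E = 2 = dim A\<close> come from one identity: counting monomials shows that
  four polynomials \<open>F, f\<^sub>1, f\<^sub>2, f\<^sub>3\<close> are algebraically dependent, and factoring a dependence by its
  lexicographically lowest term gives
  \<open>f\<^sub>1\<^sup>k (f\<^sub>2\<^sup>l (f\<^sub>3\<^sup>m (1 + a\<^sub>3 f\<^sub>3) + a\<^sub>2 f\<^sub>2) + a\<^sub>1 f\<^sub>1) = 0\<close> in \<open>A\<close>, which is incompatible with a chain of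
  four primes as well as with a regular sequence of length three. Conversely, at the maximal ideal of
  a point \<open>(s, u, t)\<close> the sequence \<open>x - s, z - t\<close> is regular on \<open>E\<close>: multiply a relation by \<open>\<Psi>\<close> and
  use that \<open>F\<close>, being monic in \<open>y\<close>, stays a nonzerodivisor after setting \<open>x = s\<close> and \<open>z = t\<close>.

  All entries of \<open>\<Phi>\<close> vanish at the origin, so four generators are needed. After inverting \<open>p\<^sub>1\<close>, the
  relations eliminate the first and last generator, and rows 2 and 3 of \<open>\<Psi>\<close> show that the other two
  are independent; hence the rank is two.
\<close>

section \<open>Polynomials in three variables\<close>

text \<open>One identity serves twice. For a chain of primes take \<open>f_i\<close> in the i-th
  prime but not in the one before; for a regular sequence take its members. In both settings a power
  of \<open>f_i\<close> cancels at stage i - 1, and the summand \<open>a_i f_i\<close> is absorbed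
  at stage i. Three stages consume everything except the constant 1, so the last prime would be the
  whole ring, or the last submodule all of \<open>E\<close>. The 1 appears because the lowest
  coefficient of a dependence over a field is a unit. \<open>F\<close> comes first in the
  dependence: its power cancels in the polynomial domain, and what remains is a relation modulo
  \<open>F\<close>.

  \<open>A\<close> is not local, so depth is tested at every maximal ideal, which must first be
  shown to contain some x - s and z - t belonging to a point of the surface. That (x - s, z -
  t)\<open>E\<close> is not all of \<open>E\<close> needs its own argument, since
  \<open>\<Phi>\<close> need not vanish away from the origin; a nonzero row vector killing
  \<open>\<Phi>\<close> at the point supplies it.

  With y as the outermost variable, monicity, Eisenstein's criterion and restriction to a line x =
  s, z = t are all statements about the coefficients of powers of y.\<close>

lemma homogeneous_system:
  fixes a :: "'i \<Rightarrow> 'j \<Rightarrow> 'k :: field"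
  assumes "finite I" "finite J" "card J < card I"
  shows "\<exists>c. (\<exists>i\<in>I. c i \<noteq> 0) \<and> (\<forall>j\<in>J. (\<Sum>i\<in>I. c i * a i j) = 0)"
  using assms(2,1,3)
proof (induction J arbitrary: I a rule: finite_induct)
  case empty
  then have "I \<noteq> {}" by auto
  then show ?case by (intro exI[of _ "\<lambda>_. 1"]) auto
next
  case (insert j0 J)
  show ?case
  proof (cases "\<forall>i\<in>I. a i j0 = 0")
    case True
    have "card J < card I" using insert by simp
    from insert.IH[OF insert.prems(1) this] obtain c where
      "\<exists>i\<in>I. c i \<noteq> 0" "\<forall>j\<in>J. (\<Sum>i\<in>I. c i * a i j) = 0" by blast
    with True show ?thesis by (intro exI[of _ c]) auto
  next
    case False
    then obtain i0 where i0: "i0 \<in> I" "a i0 j0 \<noteq> 0" by auto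
    define I' where "I' = I - {i0}"
    have fin: "finite I'" and I: "I = insert i0 I'" "i0 \<notin> I'"
      using insert.prems i0 by (auto simp: I'_def)
    have "card J < card I'" using insert.prems insert.hyps fin I by simp
    \<comment> \<open>Gaussian elimination: equation \<open>j0\<close> is solved for the unknown
      \<open>i0\<close> and substituted into the others; \<open>t\<close> below is the
      back-substituted value of that unknown.\<close>
    from insert.IH[OF fin this, of "\<lambda>i j. a i j - a i j0 / a i0 j0 * a i0 j"] obtain c where
      c: "\<exists>i\<in>I'. c i \<noteq> 0" "\<forall>j\<in>J. (\<Sum>i\<in>I'. c i * (a i j - a i j0 / a i0 j0 * a i0 j)) = 0"
      by blast
    define t where "t = - (\<Sum>i\<in>I'. c i * a i j0) / a i0 j0"
    define d where "d = c(i0 := t)"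
    have sum_d: "(\<Sum>i\<in>I. d i * a i j) = t * a i0 j + (\<Sum>i\<in>I'. c i * a i j)" for j
    proof -
      have "(\<Sum>i\<in>I'. d i * a i j) = (\<Sum>i\<in>I'. c i * a i j)"
        using I by (intro sum.cong) (auto simp: d_def)
      then show ?thesis using fin I by (simp add: d_def)
    qed
    have "(\<Sum>i\<in>I. d i * a i j) = 0" if "j \<in> insert j0 J" for j
    proof (cases "j = j0")
      case True
      then show ?thesis using i0 by (simp add: sum_d t_def)
    next
      case False
      with that have "0 = (\<Sum>i\<in>I'. c i * (a i j - a i j0 / a i0 j0 * a i0 j))" using c by auto
      also have "\<dots> = (\<Sum>i\<in>I'. c i * a i j) - (\<Sum>i\<in>I'. c i * a i j0) / a i0 j0 * a i0 j"
        unfolding sum_divide_distrib sum_distrib_right sum_subtractf[symmetric]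
        by (intro sum.cong) (simp_all add: right_diff_distrib)
      finally show ?thesis by (simp add: sum_d t_def)
    qed
    moreover have "\<exists>i\<in>I. d i \<noteq> 0" using c(1) I by (auto simp: d_def)
    ultimately show ?thesis by blast
  qed
qed

section \<open>Degree boxes and algebraic dependence by counting monomials\<close>

definition box :: "nat \<Rightarrow> 'a::comm_ring_1 poly poly poly \<Rightarrow> bool" where
  "box d p \<longleftrightarrow> degree p \<le> d \<and> (\<forall>k. degree (coeff p k) \<le> d) \<and>
     (\<forall>k j. degree (coeff (coeff p k) j) \<le> d)"

lemma box_coeff_0:
  assumes "box d p" "i > d \<or> j > d \<or> k > d"
  shows "coeff (coeff (coeff p k) j) i = 0"
proof -
  consider "k > d" | "j > d" | "i > d" using assms(2) by auto
  then show ?thesis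
  proof cases
    case 1
    then have "coeff p k = 0" using assms(1) by (intro coeff_eq_0) (auto simp: box_def)
    then show ?thesis by simp
  next
    case 2
    then have "coeff (coeff p k) j = 0" using assms(1)
      by (intro coeff_eq_0) (auto simp: box_def intro: le_less_trans)
    then show ?thesis by simp
  next
    case 3
    then show ?thesis using assms(1) by (intro coeff_eq_0) (auto simp: box_def intro: le_less_trans)
  qed
qed

lemma boxI:
  assumes "\<And>i j k. i > d \<or> j > d \<or> k > d \<Longrightarrow> coeff (coeff (coeff p k) j) i = 0"
  shows "box d p"
  unfolding box_def using assms by (auto intro!: degree_le poly_eqI)

lemma ex_box: "\<exists>d. box d p"
proof -
  define K where "K = {..degree p}"
  define d1 where "d1 = (\<Sum>k\<in>K. degree (coeff p k))"
  define d2 where "d2 = (\<Sum>k\<in>K. \<Sum>j\<in>{..d1}. degree (coeff (coeff p k) j))"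
  have 1: "degree (coeff p k) \<le> d1" for k
    by (cases "k \<in> K") (auto simp: d1_def K_def coeff_eq_0 intro: member_le_sum)
  have "degree (coeff (coeff p k) j) \<le> d2" for k j
  proof (cases "k \<in> K \<and> j \<le> d1")
    case True
    have "degree (coeff (coeff p k) j) \<le> (\<Sum>j\<in>{..d1}. degree (coeff (coeff p k) j))"
      using True by (intro member_le_sum) auto
    also have "\<dots> \<le> d2" unfolding d2_def
      using True by (intro member_le_sum[where f = "\<lambda>k. \<Sum>j\<in>{..d1}. degree (coeff (coeff p k) j)"]) (auto simp: K_def)
    finally show ?thesis .
  next
    case False
    then have "coeff (coeff p k) j = 0" using 1[of k]
      by (auto simp: K_def coeff_eq_0)
    then show ?thesis by simp
  qed
  with 1 show ?thesis
    by (intro exI[of _ "degree p + d1 + d2"]) (auto simp: box_def intro: trans_le_add1 trans_le_add2)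
qed

lemma box_mono: "box d p \<Longrightarrow> d \<le> e \<Longrightarrow> box e p"
  by (auto simp: box_def intro: order_trans)

lemma box_mult: "box d p \<Longrightarrow> box e q \<Longrightarrow> box (d + e) (p * q)"
proof -
  assume p: "box d p" and q: "box e q"
  have 2: "degree (coeff p k * coeff q l) \<le> d + e" for k l
    using p q by (intro order_trans[OF degree_mult_le] add_mono) (auto simp: box_def)
  have 3: "degree (coeff (coeff p k * coeff q l) j) \<le> d + e" for k l j
    unfolding coeff_mult using p q
    by (intro degree_sum_le order_trans[OF degree_mult_le] add_mono) (auto simp: box_def)
  have "degree (p * q) \<le> d + e"
    using p q by (intro order_trans[OF degree_mult_le] add_mono) (auto simp: box_def)
  moreover have "degree (coeff (p * q) k) \<le> d + e" for k
    unfolding coeff_mult by (intro degree_sum_le 2) auto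
  moreover have "degree (coeff (coeff (p * q) k) j) \<le> d + e" for k j
    unfolding coeff_mult[of p] coeff_sum by (intro degree_sum_le 3) auto
  ultimately show ?thesis by (simp add: box_def)
qed

lemma box_1: "box d 1"
  by (rule boxI) (auto simp: coeff_1)

lemma box_power: "box d p \<Longrightarrow> box (n * d) (p ^ n)"
proof (induction n)
  case (Suc n)
  then show ?case using box_mult[of d p "n * d" "p ^ n"] by simp
qed (simp add: box_1)

text \<open>Each monomial coefficient of the combination is one linear equation in the
  \<open>c i\<close>. Bounding the degree in every variable separately makes the monomials a product
  of three intervals, which gives the count (D + 1)^3.\<close>

lemma bounded_family_dependent:
  fixes v :: "'i \<Rightarrow> 'k::field poly poly poly"
  assumes "finite I" "\<And>i. i \<in> I \<Longrightarrow> box D (v i)" "(D + 1) ^ 3 < card I"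
  shows "\<exists>c. (\<exists>i\<in>I. c i \<noteq> 0) \<and> (\<Sum>i\<in>I. [:[:[:c i:]:]:] * v i) = 0"
proof -
  define J where "J = {..D} \<times> {..D} \<times> {..D}"
  have "card J = (D + 1) ^ 3" by (simp add: J_def card_cartesian_product power3_eq_cube)
  then have "card J < card I" "finite J" using assms(3) by (auto simp: J_def)
  from homogeneous_system[OF assms(1) this(2,1), of "\<lambda>s (i, j, k). coeff (coeff (coeff (v s) k) j) i"]
  obtain c where c: "\<exists>i\<in>I. c i \<noteq> 0"
    "\<forall>(i,j,k)\<in>J. (\<Sum>s\<in>I. c s * coeff (coeff (coeff (v s) k) j) i) = 0" by fastforce
  have "coeff (coeff (coeff (\<Sum>i\<in>I. [:[:[:c i:]:]:] * v i) k) j) i = 0" for i j k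
  proof (cases "(i, j, k) \<in> J")
    case True
    then show ?thesis using c(2) by (auto simp: coeff_sum)
  next
    case False
    then have "coeff (coeff (coeff (v s) k) j) i = 0" if "s \<in> I" for s
      using box_coeff_0[OF assms(2)[OF that]] by (auto simp: J_def)
    then show ?thesis by (simp add: coeff_sum)
  qed
  then have "(\<Sum>i\<in>I. [:[:[:c i:]:]:] * v i) = 0" by (intro poly_eqI) simp
  with c(1) show ?thesis by blast
qed

text \<open>All terms beyond the lowest contain f^(m+1), and \<open>a\<close> collects them. This is
  one layer of the lexicographic factorization.\<close>

lemma factor_lowest_power:
  fixes g :: "nat \<Rightarrow> 'a::comm_ring_1"
  assumes "\<And>i. i < m \<Longrightarrow> g i = 0" "m < d"
  shows "\<exists>a. (\<Sum>i<d. g i * f ^ i) = f ^ m * (g m + a * f)"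
proof -
  have "{..<d} = {..<m} \<union> {m..<d}" using assms(2) by auto
  then have "(\<Sum>i<d. g i * f ^ i) = (\<Sum>i\<in>{m..<d}. g i * f ^ i)"
    using assms(1) by (simp add: sum.union_disjoint ivl_disj_int)
  also have "\<dots> = g m * f ^ m + (\<Sum>i\<in>{Suc m..<d}. g i * f ^ i)"
    using assms(2) by (simp add: sum.atLeast_Suc_lessThan)
  also have "(\<Sum>i\<in>{Suc m..<d}. g i * f ^ i) = (\<Sum>i\<in>{Suc m..<d}. f ^ m * (g i * f ^ (i - Suc m) * f))"
  proof (intro sum.cong refl)
    fix i assume "i \<in> {Suc m..<d}"
    then obtain k where "i = Suc m + k" using le_Suc_ex[of "Suc m" i] by auto
    then show "g i * f ^ i = f ^ m * (g i * f ^ (i - Suc m) * f)" by (simp add: power_add ac_simps)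
  qed
  finally show ?thesis
    by (intro exI[of _ "\<Sum>i\<in>{Suc m..<d}. g i * f ^ (i - Suc m)"])
       (simp add: sum_distrib_left sum_distrib_right algebra_simps)
qed

text \<open>The d^4 monomials with exponents below d lie in a box whose number of coefficients grows
  only like d^3, so for large d they are dependent over the field.\<close>

lemma four_elements_relation:
  fixes f0 f1 f2 f3 :: "'k::field poly poly poly"
  shows "\<exists>m0 m1 m2 m3 a0 a1 a2 a3.
    f0 ^ m0 * (f1 ^ m1 * (f2 ^ m2 * (f3 ^ m3 * (1 + a3 * f3) + a2 * f2) + a1 * f1) + a0 * f0) = 0"
proof -
  obtain e0 e1 e2 e3 where e': "box e0 f0" "box e1 f1" "box e2 f2" "box e3 f3" using ex_box by metis
  define e where "e = e0 + e1 + e2 + e3"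
  have e: "box e f0" "box e f1" "box e f2" "box e f3"
    by (rule e'[THEN box_mono], simp add: e_def)+
  \<comment> \<open>Chosen so that (4 (d - 1) e + 1)^3 is at most (4 e + 1)^3 d^3 = (d - 1) d^3,
    which is below d^4.\<close>
  define d where "d = (4 * e + 1) ^ 3 + 1"
  define I where "I = {..<d} \<times> {..<d} \<times> {..<d} \<times> {..<d}"
  define v where "v = (\<lambda>(i, j, k, l). f0 ^ i * (f1 ^ j * (f2 ^ k * f3 ^ l)))"
  have "box (4 * (d - 1) * e) (v s)" if s: "s \<in> I" for s
  proof -
    obtain i j k l where s': "s = (i, j, k, l)" "i \<le> d - 1" "j \<le> d - 1" "k \<le> d - 1" "l \<le> d - 1"
      using s by (cases s) (auto simp: I_def)
    have "box (i * e + (j * e + (k * e + l * e))) (v s)"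
      using e by (auto simp: v_def s' intro!: box_mult box_power)
    moreover have "i * e + (j * e + (k * e + l * e)) = (i + j + k + l) * e"
      by (simp add: algebra_simps)
    moreover have "\<dots> \<le> (4 * (d - 1)) * e" using s' by (intro mult_right_mono) auto
    ultimately show ?thesis using box_mono by metis
  qed
  moreover have "(4 * (d - 1) * e + 1) ^ 3 < card I"
  proof -
    have d1: "d - 1 = (4 * e + 1) ^ 3" and d0: "d > 0" by (simp_all add: d_def)
    have "4 * (d - 1) * e \<le> 4 * e * d" by simp
    then have "4 * (d - 1) * e + 1 \<le> (4 * e + 1) * d" using d0 unfolding add_mult_distrib by linarith
    then have "(4 * (d - 1) * e + 1) ^ 3 \<le> ((4 * e + 1) * d) ^ 3" by (rule power_mono) simp
    also have "\<dots> = (d - 1) * d ^ 3" unfolding power_mult_distrib d1 ..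
    also have "\<dots> < d * d ^ 3" using d0 by simp
    also have "\<dots> = card I" by (simp add: I_def card_cartesian_product power3_eq_cube)
    finally show ?thesis .
  qed
  moreover have "finite I" by (simp add: I_def)
  ultimately obtain c where c: "\<exists>s\<in>I. c s \<noteq> 0" "(\<Sum>s\<in>I. [:[:[:c s:]:]:] * v s) = 0"
    using bounded_family_dependent by blast
  \<comment> \<open>The exponents \<open>m0\<close>, \<open>m1\<close>, \<open>m2\<close>,
    \<open>m3\<close> are minimized one after another, each with the earlier ones fixed. This
    selects the lexicographically lowest term with nonzero coefficient.\<close>
  define P0 where "P0 i \<longleftrightarrow> (\<exists>j<d. \<exists>k<d. \<exists>l<d. c (i, j, k, l) \<noteq> 0)" for i
  define m0 where "m0 = (LEAST i. P0 i)"
  obtain i where i: "i < d" "P0 i" using c(1) by (auto simp: P0_def I_def)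
  have m0: "P0 m0" "m0 < d" and m0_least: "\<And>i. i < m0 \<Longrightarrow> \<not> P0 i"
    unfolding m0_def by (rule LeastI[of P0, OF i(2)], rule le_less_trans[OF Least_le[of P0, OF i(2)] i(1)], rule not_less_Least)
  define P1 where "P1 j \<longleftrightarrow> (\<exists>k<d. \<exists>l<d. c (m0, j, k, l) \<noteq> 0)" for j
  define m1 where "m1 = (LEAST i. P1 i)"
  obtain i where i: "i < d" "P1 i" using m0(1) by (auto simp: P0_def P1_def)
  have m1: "P1 m1" "m1 < d" and m1_least: "\<And>i. i < m1 \<Longrightarrow> \<not> P1 i"
    unfolding m1_def by (rule LeastI[of P1, OF i(2)], rule le_less_trans[OF Least_le[of P1, OF i(2)] i(1)], rule not_less_Least)
  define P2 where "P2 k \<longleftrightarrow> (\<exists>l<d. c (m0, m1, k, l) \<noteq> 0)" for k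
  define m2 where "m2 = (LEAST i. P2 i)"
  obtain i where i: "i < d" "P2 i" using m1(1) by (auto simp: P2_def P1_def)
  have m2: "P2 m2" "m2 < d" and m2_least: "\<And>i. i < m2 \<Longrightarrow> \<not> P2 i"
    unfolding m2_def by (rule LeastI[of P2, OF i(2)], rule le_less_trans[OF Least_le[of P2, OF i(2)] i(1)], rule not_less_Least)
  define P3 where "P3 l \<longleftrightarrow> c (m0, m1, m2, l) \<noteq> 0" for l
  define m3 where "m3 = (LEAST i. P3 i)"
  obtain i where i: "i < d" "P3 i" using m2(1) by (auto simp: P2_def P3_def)
  have m3: "P3 m3" "m3 < d" and m3_least: "\<And>i. i < m3 \<Longrightarrow> \<not> P3 i"
    unfolding m3_def by (rule LeastI[of P3, OF i(2)], rule le_less_trans[OF Least_le[of P3, OF i(2)] i(1)], rule not_less_Least)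
  \<comment> \<open>The sum is nested as a polynomial in \<open>f0\<close> whose coefficients are
    polynomials in \<open>f1\<close>, and so on. At each level minimality makes the coefficients
    below the chosen exponent vanish.\<close>
  define C where "C i j k l = [:[:[:c (i, j, k, l):]:]:]" for i j k l
  define g3 where "g3 i j k = (\<Sum>l<d. C i j k l * f3 ^ l)" for i j k
  define g2 where "g2 i j = (\<Sum>k<d. g3 i j k * f2 ^ k)" for i j
  define g1 where "g1 i = (\<Sum>j<d. g2 i j * f1 ^ j)" for i
  have C0: "C i j k l = 0" if "c (i, j, k, l) = 0" for i j k l using that by (simp add: C_def)
  have "(\<Sum>i<d. g1 i * f0 ^ i) = (\<Sum>s\<in>I. [:[:[:c s:]:]:] * v s)"
    unfolding I_def sum.cartesian_product' v_def g1_def g2_def g3_def C_def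
      sum_distrib_left sum_distrib_right prod.case
    by (intro sum.cong refl) (simp only: mult_ac)
  then have "(\<Sum>i<d. g1 i * f0 ^ i) = 0" using c by simp
  moreover have "g1 i = 0" if "i < m0" for i
    using m0_least[OF that] by (auto simp: g1_def g2_def g3_def P0_def C0 intro!: sum.neutral)
  then obtain a0 where "(\<Sum>i<d. g1 i * f0 ^ i) = f0 ^ m0 * (g1 m0 + a0 * f0)"
    using factor_lowest_power[of m0 g1 d f0] m0 by blast
  moreover have "g2 m0 i = 0" if "i < m1" for i
    using m1_least[OF that] by (auto simp: g2_def g3_def P1_def C0 intro!: sum.neutral)
  then obtain a1 where "g1 m0 = f1 ^ m1 * (g2 m0 m1 + a1 * f1)"
    using factor_lowest_power[of m1 "g2 m0" d f1] m1 unfolding g1_def by blast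
  moreover have "g3 m0 m1 i = 0" if "i < m2" for i
    using m2_least[OF that] by (auto simp: g3_def P2_def C0 intro!: sum.neutral)
  then obtain a2 where "g2 m0 m1 = f2 ^ m2 * (g3 m0 m1 m2 + a2 * f2)"
    using factor_lowest_power[of m2 "g3 m0 m1" d f2] m2 unfolding g2_def by blast
  moreover have "C m0 m1 m2 i = 0" if "i < m3" for i
    using m3_least[OF that] by (auto simp: P3_def C0 intro!: sum.neutral)
  then obtain a3 where "g3 m0 m1 m2 = f3 ^ m3 * (C m0 m1 m2 m3 + a3 * f3)"
    using factor_lowest_power[of m3 "C m0 m1 m2" d f3] m3 unfolding g3_def by blast
  ultimately have rel: "f0 ^ m0 * (f1 ^ m1 * (f2 ^ m2 * (f3 ^ m3 * (C m0 m1 m2 m3 + a3 * f3)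
      + a2 * f2) + a1 * f1) + a0 * f0) = 0" by simp
  \<comment> \<open>The lowest coefficient is a nonzero constant. Multiplying the relation by its
    inverse turns it into 1 and only rescales the \<open>a0\<close>, ..., \<open>a3\<close>.\<close>
  define u where "u = [:[:[:inverse (c (m0, m1, m2, m3)):]:]:]"
  have u: "u * C m0 m1 m2 m3 = 1" using m3(1) by (simp add: u_def C_def P3_def one_pCons)
  have "f0 ^ m0 * (f1 ^ m1 * (f2 ^ m2 * (f3 ^ m3 * (1 + (u * a3) * f3)
      + (u * a2) * f2) + (u * a1) * f1) + (u * a0) * f0) = u * (f0 ^ m0 * (f1 ^ m1 * (f2 ^ m2 * (f3 ^ m3 * (C m0 m1 m2 m3 + a3 * f3)
      + a2 * f2) + a1 * f1) + a0 * f0))"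
    unfolding u[symmetric] by (simp add: algebra_simps)
  also have "\<dots> = 0" by (simp only: rel mult_zero_right)
  finally show ?thesis by blast
qed

section \<open>Substitution of an element into a polynomial, and the weak Nullstellensatz\<close>

definition cst :: "'a :: zero \<Rightarrow> 'a poly poly poly" where "cst c = [:[:[:c:]:]:]"

lemma cst_simps: "cst 0 = 0" "cst 1 = (1 :: 'a :: comm_ring_1 poly poly poly)"
  "cst (b + c) = cst b + cst c" "cst (b * c) = cst b * cst (c :: 'a)" "cst (b - c) = cst b - cst c"
  "cst (- c) = - cst c"
  by (simp_all add: cst_def one_pCons)

definition at_elem :: "complex poly \<Rightarrow> poly3 \<Rightarrow> poly3" where "at_elem q f = poly (map_poly cst q) f"

lemma at_elem_pCons [simp]: "at_elem (pCons c q) f = cst c + f * at_elem q f"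
  by (simp add: at_elem_def map_poly_pCons cst_simps)

lemma at_elem_0 [simp]: "at_elem 0 f = 0"
  by (simp add: at_elem_def)

lemma at_elem_add [simp]: "at_elem (p + q) f = at_elem p f + at_elem q f"
proof -
  have "map_poly cst (p + q) = map_poly cst p + map_poly cst q"
    by (rule poly_eqI) (simp add: coeff_map_poly cst_simps)
  then show ?thesis by (simp add: at_elem_def)
qed

lemma at_elem_smult [simp]: "at_elem (smult c q) f = cst c * at_elem q f"
  by (induction q) (simp_all add: cst_simps algebra_simps)

lemma at_elem_mult [simp]: "at_elem (p * q) f = at_elem p f * at_elem q f"
  by (induction p) (simp_all add: cst_simps algebra_simps)

lemma at_elem_sum: "at_elem (\<Sum>s\<in>S. p s) f = (\<Sum>s\<in>S. at_elem (p s) f)"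
  by (induction S rule: infinite_finite_induct) simp_all

text \<open>If no \<open>f - c\<close> were in the ideal, the uncountably many inverses of the \<open>f - c\<close> modulo the
  ideal would include infinitely many of bounded degree, hence linearly dependent ones; clearing
  denominators gives a nonzero polynomial in \<open>f\<close> lying in the ideal.\<close>

lemma weak_nullstellensatz:
  fixes J :: "poly3 set"
  assumes add: "\<And>g h. g \<in> J \<Longrightarrow> h \<in> J \<Longrightarrow> g + h \<in> J" and mult: "\<And>g h. g \<in> J \<Longrightarrow> h * g \<in> J"
    and one: "1 \<notin> J" and max: "\<And>g. g \<notin> J \<Longrightarrow> \<exists>h. h * g - 1 \<in> J"
  shows "\<exists>c. f - cst c \<in> J"
proof (rule ccontr)
  assume "\<nexists>c. f - cst c \<in> J"
  then have "\<exists>g. g * (f - cst c) - 1 \<in> J" for c using max by blast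
  then obtain g where g: "\<And>c. g c * (f - cst c) - 1 \<in> J" by metis
  have zero: "0 \<in> J" using mult[OF g, of 0] by simp
  have sum: "(\<Sum>s\<in>S. p s) \<in> J" if "\<And>s. s \<in> S \<Longrightarrow> p s \<in> J" for S :: "complex set" and p
    using that by (induction S rule: infinite_finite_induct) (auto simp: zero add)
  have prime: "q \<in> J" if "p * q \<in> J" "p \<notin> J" for p q
  proof -
    obtain h where "h * p - 1 \<in> J" using max \<open>p \<notin> J\<close> by blast
    from add[OF mult[OF this, of "- q"] mult[OF \<open>p * q \<in> J\<close>, of h]] show ?thesis
      by (simp add: algebra_simps)
  qed
  have "\<exists>d. infinite {c. box d (g c)}"
  proof (rule ccontr)
    assume "\<nexists>d. infinite {c. box d (g c)}"
    then have "countable (\<Union>d. {c. box d (g c)})" by (intro countable_UN) (auto intro: countable_finite)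
    moreover have "(\<Union>d. {c. box d (g c)}) = UNIV" using ex_box by auto
    ultimately show False using uncountable_UNIV_complex by simp
  qed
  then obtain d where d: "infinite {c. box d (g c)}" by blast
  from infinite_arbitrarily_large[OF this, of "(d + 1) ^ 3 + 1"]
  obtain S where S: "finite S" "card S = (d + 1) ^ 3 + 1" "S \<subseteq> {c. box d (g c)}" by blast
  then obtain k where k: "\<exists>s\<in>S. k s \<noteq> 0" "(\<Sum>s\<in>S. [:[:[:k s:]:]:] * g s) = 0"
    using bounded_family_dependent[of S d g] by auto
  \<comment> \<open>\<open>P s\<close> is the product of the linear factors other than T - s, so the
    full product serves as a common denominator. At a root s with \<open>k s\<close> nonzero every
    other \<open>P t\<close> vanishes and \<open>P s\<close> does not, as in Lagrange interpolation;
    hence the combination \<open>q\<close> is nonzero.\<close>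
  define P where "P s = (\<Prod>t\<in>S - {s}. [:- t, 1:])" for s
  have P: "(f - cst s) * at_elem (P s) f = at_elem (\<Prod>t\<in>S. [:- t, 1:]) f" if "s \<in> S" for s
    unfolding prod.remove[OF S(1) that] at_elem_mult P_def by (simp add: cst_simps)
  define q where "q = (\<Sum>s\<in>S. smult (k s) (P s))"
  obtain s where s: "s \<in> S" "k s \<noteq> 0" using k by blast
  have "poly (P t) s = 0" if "t \<in> S - {s}" for t
    using that s S(1) by (auto simp: P_def poly_prod prod_zero_iff)
  then have "poly q s = k s * poly (P s) s"
    using sum.remove[OF S(1) s(1), of "\<lambda>t. k t * poly (P t) s"] by (simp add: q_def poly_sum)
  also have "\<dots> \<noteq> 0" using s S(1) by (auto simp: P_def poly_prod prod_zero_iff)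
  finally have "q \<noteq> 0" by auto
  \<comment> \<open>Expanding a summand gives k_s P_s(f) minus k_s g_s times the full product at f.
    The subtracted parts add up to zero by the dependence of the \<open>g s\<close>, which leaves
    q(f).\<close>
  have "(\<Sum>s\<in>S. (- (cst (k s) * at_elem (P s) f)) * (g s * (f - cst s) - 1)) \<in> J"
    by (intro sum mult g)
  also have "(\<Sum>s\<in>S. (- (cst (k s) * at_elem (P s) f)) * (g s * (f - cst s) - 1)) =
     (\<Sum>s\<in>S. cst (k s) * at_elem (P s) f - cst (k s) * g s * ((f - cst s) * at_elem (P s) f))"
    by (intro sum.cong refl) (simp add: algebra_simps)
  also have "\<dots> = (\<Sum>s\<in>S. cst (k s) * at_elem (P s) f - cst (k s) * g s * at_elem (\<Prod>t\<in>S. [:- t, 1:]) f)"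
    using P by (intro sum.cong refl) simp
  also have "\<dots> = at_elem q f"
    by (simp add: q_def at_elem_sum sum_subtractf k(2)[folded cst_def] flip: sum_distrib_right)
  finally have "at_elem q f \<in> J" .
  with \<open>q \<noteq> 0\<close> have "\<exists>c. f - cst c \<in> J"
  \<comment> \<open>Over the complex numbers \<open>q\<close> has a linear factor. Since
    \<open>J\<close> is prime, either f - z or the value of the cofactor at f lies in
    \<open>J\<close>; in degree zero a unit would lie in \<open>J\<close>.\<close>
  proof (induction "degree q" arbitrary: q)
    case 0
    then obtain c where c: "q = [:c:]" "c \<noteq> 0" by (metis degree_eq_zeroE pCons_eq_0_iff)
    with 0 have "cst c \<in> J" by simp
    from mult[OF this, of "cst (inverse c)"] have "cst (inverse c * c) \<in> J" by (simp only: cst_simps)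
    with c one show ?case by (simp add: cst_simps)
  next
    case (Suc n)
    have "\<not> constant (poly q)" using Suc(2) by (simp add: constant_degree)
    then obtain z where "poly q z = 0" using fundamental_theorem_of_algebra by blast
    then obtain q' where q': "q = [:- z, 1:] * q'" by (auto simp: poly_eq_0_iff_dvd)
    then have q'0: "q' \<noteq> 0" using Suc by auto
    moreover have "degree q = Suc (degree q')" unfolding q' using q'0 by (subst degree_mult_eq) auto
    then have "degree q' = n" using Suc(2) by simp
    moreover have "at_elem q f = (f - cst z) * at_elem q' f"
      unfolding q' at_elem_mult by (simp add: cst_simps)
    then have "(f - cst z) * at_elem q' f \<in> J" using Suc by simp
    ultimately show ?case using Suc(1)[of q'] prime by blast
  qed
  with \<open>\<nexists>c. f - cst c \<in> J\<close> show False by blast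
qed

section \<open>Irreducibility of \<open>F\<close>\<close>

text \<open>The coefficients lie in an arbitrary domain, so a leading coefficient 1 takes the place
  of primitivity: it makes a factor of degree zero a unit.\<close>

lemma eisenstein_irreducible:
  fixes f :: "'a :: idom poly"
  assumes p: "prime_elem p" and monic: "lead_coeff f = 1" and deg: "degree f > 0"
    and low: "\<And>i. i < degree f \<Longrightarrow> p dvd coeff f i" and p2: "\<not> p ^ 2 dvd coeff f 0"
  shows "irreducible f"
proof (rule irreducibleI)
  show "f \<noteq> 0" using deg by auto
  show "\<not> f dvd 1" using deg by (auto simp: is_unit_poly_iff)
  \<comment> \<open>As p^2 does not divide the product of the two constant coefficients, p misses
    one of them, say that of h. Let i be the first index where p misses a coefficient of g; it
    exists because the leading coefficient of g is a unit. All other summands of the i-th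
    coefficient of f are divisible by p, and i is below the degree of f.\<close>
  have wlog: False
    if gh: "f = g * h" and dg: "degree g < degree f" and h0: "\<not> p dvd coeff h 0" and dg0: "degree g > 0"
    for g h
  proof -
    have lc: "lead_coeff g * lead_coeff h = 1" using monic gh by (simp add: lead_coeff_mult)
    have np: "\<not> p dvd lead_coeff g"
      using p lc by (metis dvd_mult2 prime_elem_def)
    define i where "i = (LEAST i. \<not> p dvd coeff g i)"
    have i: "\<not> p dvd coeff g i" unfolding i_def by (rule LeastI[of _ "degree g"]) (use np in simp)
    have least: "p dvd coeff g j" if "j < i" for j
      using not_less_Least[of j "\<lambda>i. \<not> p dvd coeff g i"] that by (auto simp: i_def)
    have "i \<le> degree g" unfolding i_def by (rule Least_le) (use np in simp)
    then have "p dvd coeff f i" using dg low by auto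
    also have "coeff f i = (\<Sum>j<i. coeff g j * coeff h (i - j)) + coeff g i * coeff h 0"
      by (simp add: gh coeff_mult flip: lessThan_Suc_atMost)
    finally have "p dvd coeff g i * coeff h 0"
      by (subst (asm) dvd_add_right_iff) (auto intro!: dvd_sum dvd_mult2 least)
    with i h0 p show False using prime_elem_dvd_mult_iff by blast
  qed
  fix g h assume gh: "f = g * h"
  have lc: "lead_coeff g * lead_coeff h = 1" using monic gh by (simp add: lead_coeff_mult)
  have const: "a dvd 1" if "degree a = 0" "lead_coeff a * lead_coeff b = 1" for a b :: "'a poly"
    using that by (metis degree_eq_zeroE coeff_pCons_0 dvd_triv_left is_unit_const_poly_iff)
  have "degree f = degree g + degree h" using gh deg by (subst gh, subst degree_mult_eq) auto
  moreover have "\<not> (p dvd coeff g 0 \<and> p dvd coeff h 0)"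
    using p2 by (auto simp: gh coeff_mult power2_eq_square intro: mult_dvd_mono)
  ultimately show "g dvd 1 \<or> h dvd 1"
    using wlog[of g h] wlog[of h g] const[of g h] const[of h g] gh lc
    by (cases "degree g = 0"; cases "degree h = 0") (auto simp: mult.commute)
qed

section \<open>Positivity of the exponents and primality of \<open>F\<close>\<close>

lemma decreasing_recursion:
  fixes s :: "nat \<Rightarrow> int"
  assumes zero: "\<And>j. j \<ge> m \<Longrightarrow> s j = 0"
    and one: "1 \<le> m \<Longrightarrow> s (m - 1) = 1"
    and two: "lo + 2 \<le> m \<Longrightarrow> 2 \<le> s (m - 2)"
    and rec: "\<And>j. lo \<le> j \<Longrightarrow> j + 3 \<le> m \<Longrightarrow> \<exists>b c. 2 \<le> b \<and> 2 \<le> c \<and>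
       s j = (b - 1) * s (j + 1) + (c - 1) * s (j + 2) - s (j + 3)"
  shows "lo \<le> j \<Longrightarrow> 0 \<le> s j \<and> s (j + 1) \<le> s j \<and> (j < m \<longrightarrow> 1 \<le> s j)"
proof (induction "m - j" arbitrary: j rule: less_induct)
  case less
  consider "j \<ge> m" | "j + 1 = m" | "j + 2 = m" | "j + 3 \<le> m" by linarith
  then show ?case
  proof cases
    case 1
    then show ?thesis using zero[of j] zero[of "j + 1"] by simp
  next
    case 2
    then have "s j = 1" "s (j + 1) = 0" using one zero by auto
    then show ?thesis by simp
  next
    case 3
    then have "m - 2 = j" "m - 1 = j + 1" by auto
    then have "s (j + 1) = 1" "2 \<le> s j" using one two less.prems 3 by auto
    then show ?thesis by simp
  next
    case 4
    then obtain b c where bc: "2 \<le> b" "2 \<le> c"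
      "s j = (b - 1) * s (j + 1) + (c - 1) * s (j + 2) - s (j + 3)" using rec less.prems by blast
    have IH: "0 \<le> s (j + 1) \<and> (j + 1 < m \<longrightarrow> 1 \<le> s (j + 1))"
       "0 \<le> s (j + 2) \<and> s (j + 2 + 1) \<le> s (j + 2)"
      using less.hyps[of "j + 1"] less.hyps[of "j + 2"] 4 less.prems by auto
    \<comment> \<open>The subtracted s(j+3) is outweighed by the term with s(j+2) because the
      sequence decreases there. This is why monotonicity is carried through the induction together
      with positivity.\<close>
    have "1 * s (j + 1) \<le> (b - 1) * s (j + 1)" "1 * s (j + 2) \<le> (c - 1) * s (j + 2)"
      using bc IH mult_right_mono[of 1 "b - 1" "s (j + 1)"] mult_right_mono[of 1 "c - 1" "s (j + 2)"]
      by linarith+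
    moreover have "j + 2 + 1 = j + 3" by simp
    ultimately show ?thesis using bc(3) IH 4 by (intro conjI impI) (simp_all only:, linarith+)
  qed
qed

lemma x_prime: "prime_elem ([:[:0, 1:]:] :: complex poly poly)"
proof -
  have "prime_elem ([:0, 1:] :: complex poly)" by (rule prime_elem_linear_field_poly) simp
  then show ?thesis by (simp add: prime_elem_const_poly_iff)
qed

locale hypersurface =
  fixes a :: "nat \<Rightarrow> int" and e :: nat
  assumes e: "4 \<le> e" and a: "\<forall>i\<in>{2..e - 1}. 2 \<le> a i"
begin

lemma s_exp_pos:
  assumes "1 \<le> j"
  shows "0 \<le> s_exp a e j \<and> s_exp a e (j + 1) \<le> s_exp a e j \<and> (j < e \<longrightarrow> 1 \<le> s_exp a e j)"
\<comment> \<open>From index 1 on, the recursion reads only \<open>a i\<close> with i between 2 and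
  e - 1, where the bound 2 is available.\<close>
proof (rule decreasing_recursion[where m = "e" and lo = 1, OF _ _ _ _ assms])
  fix j assume j: "1 \<le> j" "j + 3 \<le> e"
  then have "a (j + 1) \<ge> 2" "a (j + 2) \<ge> 2" using a by auto
  then show "\<exists>b c. 2 \<le> b \<and> 2 \<le> c \<and> s_exp a e j =
      (b - 1) * s_exp a e (j + 1) + (c - 1) * s_exp a e (j + 2) - s_exp a e (j + 3)"
    using j by (subst s_exp.simps) auto
next
  show "s_exp a e (e - 1) = 1" if "1 \<le> e" using that by (subst s_exp.simps) auto
  show "2 \<le> s_exp a e (e - 2)" using e a by (subst s_exp.simps) auto
qed (use e in \<open>simp_all add: s_exp.simps[of _ _ "_"]\<close>)

lemma s_hat_pos:
  assumes "1 \<le> j"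
  shows "0 \<le> s_hat a e j \<and> s_hat a e (j + 1) \<le> s_hat a e j \<and> (j < e - 1 \<longrightarrow> 1 \<le> s_hat a e j)"
\<comment> \<open>The zeros of \<open>s_hat\<close> begin at e - 1, one index before those of
  \<open>s_exp\<close>.\<close>
proof (rule decreasing_recursion[where m = "e - 1" and lo = 1, OF _ _ _ _ assms])
  fix j assume j: "1 \<le> j" "j + 3 \<le> e - 1"
  then have "a (j + 1) \<ge> 2" "a (j + 2) \<ge> 2" using a by auto
  then show "\<exists>b c. 2 \<le> b \<and> 2 \<le> c \<and> s_hat a e j =
      (b - 1) * s_hat a e (j + 1) + (c - 1) * s_hat a e (j + 2) - s_hat a e (j + 3)"
    using j by (subst s_hat.simps) auto
next
  have *: "e - 1 - 1 = e - 2" "e - 1 - 2 = e - 3" and e2: "e - 2 \<in> {2..e - 1}" using e by auto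
  show "s_hat a e (e - 1 - 1) = 1" using e unfolding * by (subst s_hat.simps) auto
  show "2 \<le> s_hat a e (e - 1 - 2)" using e a[rule_format, of "e - 2", OF e2] unfolding * by (subst s_hat.simps) auto
qed (use e in \<open>simp_all add: s_hat.simps[of _ _ "_"]\<close>)

text \<open>The y-degree of the middle term lies strictly between 0 and N, so \<open>F\<close> is
  monic in y with constant coefficient -x z^L; the positive power of x makes the middle coefficient
  divisible by x. These are the inputs to Eisenstein's criterion.\<close>

lemma exponent_bounds:
  "0 < exp_x a" "0 < exp_y a e" "exp_y a e < exp_N a e" "0 < exp_L a e"
proof -
  have "0 \<le> (\<Sum>j = 3..e - 1. (a j - 2) * s_exp a e j)"
    using a s_exp_pos by (intro sum_nonneg mult_nonneg_nonneg) auto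
  then have alpha: "1 \<le> alpha a e" by (simp add: alpha_def)
  have "0 \<le> (\<Sum>j = 3..e - 2. (a j - 2) * s_hat a e j)"
    using a s_hat_pos by (intro sum_nonneg mult_nonneg_nonneg) auto
  then have beta: "1 \<le> beta a e" by (simp add: beta_def)
  have "1 \<le> s_exp a e 3" "0 \<le> s_hat a e 3" using s_exp_pos[of 3] s_hat_pos[of 3] e by auto
  moreover have "2 \<le> a 2" using a e by auto
  ultimately show "0 < exp_x a" "0 < exp_y a e" "exp_y a e < exp_N a e" "0 < exp_L a e"
    using alpha beta by (auto simp: exp_x_def exp_y_def exp_N_def exp_L_def)
qed

lemma F_poly_monom:
  "F_poly a e = monom 1 (exp_N a e) + monom ([:[:0, 1:]:] ^ exp_x a * [:0, 1:] ^ exp_H a e) (exp_y a e)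
     - [:[:[:0, 1:]:] * [:0, 1:] ^ exp_L a e:]"
proof -
  have y: "y_var ^ k = monom 1 k" for k by (simp add: y_var_def monom_altdef)
  have "x_var ^ exp_x a * y_var ^ exp_y a e * z_var ^ exp_H a e =
    monom ([:[:0, 1:]:] ^ exp_x a * [:0, 1:] ^ exp_H a e) (exp_y a e)"
    by (simp add: y x_var_def z_var_def smult_monom mult.assoc poly_const_pow mult.commute[of "monom _ _"])
  moreover have "x_var * z_var ^ exp_L a e = [:[:[:0, 1:]:] * [:0, 1:] ^ exp_L a e:]"
    by (simp add: x_var_def z_var_def poly_const_pow)
  ultimately show ?thesis unfolding F_poly_def y by simp
qed

lemma coeff_F:
  "coeff (F_poly a e) i = (if i = exp_N a e then 1 else 0)
     + (if i = exp_y a e then [:[:0, 1:]:] ^ exp_x a * [:0, 1:] ^ exp_H a e else 0)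
     - (if i = 0 then [:[:0, 1:]:] * [:0, 1:] ^ exp_L a e else 0)"
  using exponent_bounds unfolding F_poly_monom by (auto simp: coeff_pCons split: nat.split)

lemma degree_F: "degree (F_poly a e) = exp_N a e"
  using exponent_bounds
  by (intro antisym degree_le le_degree) (auto simp: coeff_F)

lemma monic_F: "lead_coeff (F_poly a e) = 1"
  using exponent_bounds by (simp add: degree_F coeff_F)

lemma F_prime: "prime_elem (F_poly a e)"
proof -
  let ?x = "[:[:0, 1:]:] :: complex poly poly"
  have "irreducible (F_poly a e)"
  proof (rule eisenstein_irreducible[OF x_prime monic_F])
    show "0 < degree (F_poly a e)" using exponent_bounds by (simp add: degree_F)
    show "?x dvd coeff (F_poly a e) i" if "i < degree (F_poly a e)" for i
      using that exponent_bounds by (auto simp: coeff_F degree_F simp del: mult_pCons_left intro!: dvd_diff dvd_mult2 dvd_power)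
    \<comment> \<open>Here \<open>[:0, 1:]\<close> is z, whose linear coefficient 1 is not divisible
      by x. Together with x being prime this keeps x^2 from dividing x z^L.\<close>
    have "\<not> ?x dvd [:0, 1:]"
      unfolding const_poly_dvd_iff by (intro notI, drule spec[of _ 1], simp add: is_unit_poly_iff)
    then have "\<not> ?x dvd [:0, 1:] ^ exp_L a e" using x_prime prime_elem_dvd_power by blast
    moreover have "coeff (F_poly a e) 0 = - (?x * [:0, 1:] ^ exp_L a e)"
      using exponent_bounds by (auto simp: coeff_F)
    ultimately show "\<not> ?x ^ 2 dvd coeff (F_poly a e) 0"
      by (simp add: power2_eq_square dvd_mult_cancel_left del: mult_pCons_left mult_pCons_right)
  qed
  \<comment> \<open>The iterated polynomial ring over a field is factorial, so an irreducible
    element is prime.\<close>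
  then show ?thesis by (rule irreducible_imp_prime_elem)
qed

end

section \<open>Modules\<close>

subsection \<open>Quotient modules\<close>

locale module_quotient = submodule R N M
  for R and N and M :: "('a, 'b) module" (structure)
begin

interpretation M: module R M by (rule module)

lemma abelian_subgroup: "abelian_subgroup N M"
proof (rule abelian_subgroupI3[OF additive_subgroupI M.abelian_group_axioms])
  show "subgroup N (add_monoid M)"
  proof (rule group.subgroupI[OF M.a_group])
    show "inv\<^bsub>add_monoid M\<^esub> v \<in> N" if "v \<in> N" for v
    proof -
      have "\<ominus>\<^bsub>M\<^esub> v = (\<ominus>\<^bsub>R\<^esub> \<one>\<^bsub>R\<^esub>) \<odot>\<^bsub>M\<^esub> v" using that subset by (subst M.smult_minus_1) auto
      also have "\<dots> \<in> N" using that by (intro smult_closed) auto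
      finally show ?thesis by (simp add: a_inv_def)
    qed
    show "N \<noteq> {}" using zero_closed by blast
  qed (use subset in auto)
qed

interpretation S: abelian_subgroup N M by (rule abelian_subgroup)

lemma coset_eq_iff:
  assumes "v \<in> carrier M" "w \<in> carrier M"
  shows "N +>\<^bsub>M\<^esub> v = N +>\<^bsub>M\<^esub> w \<longleftrightarrow> v \<ominus>\<^bsub>M\<^esub> w \<in> N"
proof -
  have "v \<ominus>\<^bsub>M\<^esub> w \<in> N \<longleftrightarrow> v \<in> N +>\<^bsub>M\<^esub> w"
    using S.a_rcos_module[OF assms(2,1)] by (simp add: a_minus_def)
  also have "\<dots> \<longleftrightarrow> N +>\<^bsub>M\<^esub> v = N +>\<^bsub>M\<^esub> w"
    using S.a_repr_independence'[OF _ assms(2), of v] S.a_repr_independenceD[OF assms(1), of w] by blast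
  finally show ?thesis ..
qed

lemma quot_carrier: "carrier (quot_module M N) = (+>\<^bsub>M\<^esub>) N ` carrier M"
  by (auto simp: quot_module_def A_RCOSETS_def')

lemma quot_zero: "\<zero>\<^bsub>quot_module M N\<^esub> = N +>\<^bsub>M\<^esub> \<zero>\<^bsub>M\<^esub>"
  using subset by (simp add: quot_module_def)

lemma quot_add:
  assumes "v \<in> carrier M" "w \<in> carrier M"
  shows "(N +>\<^bsub>M\<^esub> v) \<oplus>\<^bsub>quot_module M N\<^esub> (N +>\<^bsub>M\<^esub> w) = N +>\<^bsub>M\<^esub> (v \<oplus>\<^bsub>M\<^esub> w)"
  using assms S.a_rcos_sum by (simp add: quot_module_def)

text \<open>The scalar product is defined as a union of cosets over all representatives. They all
  coincide because r (w - v) stays in \<open>N\<close>, so the union is a single coset.\<close>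

lemma quot_smult:
  assumes r: "r \<in> carrier R" and v: "v \<in> carrier M"
  shows "r \<odot>\<^bsub>quot_module M N\<^esub> (N +>\<^bsub>M\<^esub> v) = N +>\<^bsub>M\<^esub> (r \<odot>\<^bsub>M\<^esub> v)"
proof -
  have const: "N +>\<^bsub>M\<^esub> (r \<odot>\<^bsub>M\<^esub> w) = N +>\<^bsub>M\<^esub> (r \<odot>\<^bsub>M\<^esub> v)" if w: "w \<in> N +>\<^bsub>M\<^esub> v" for w
  proof -
    have wc: "w \<in> carrier M" using S.a_elemrcos_carrier[OF v w] .
    have "w \<ominus>\<^bsub>M\<^esub> v \<in> N" using S.a_rcos_module[OF v wc] w by (simp add: a_minus_def)
    then have "r \<odot>\<^bsub>M\<^esub> (w \<ominus>\<^bsub>M\<^esub> v) \<in> N" by (rule smult_closed[OF r])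
    also have "r \<odot>\<^bsub>M\<^esub> (w \<ominus>\<^bsub>M\<^esub> v) = r \<odot>\<^bsub>M\<^esub> w \<ominus>\<^bsub>M\<^esub> r \<odot>\<^bsub>M\<^esub> v"
      unfolding a_minus_def
      using M.smult_r_distr[OF r wc M.a_inv_closed[OF v]] M.smult_r_minus[OF r v] by (simp only:)
    finally show ?thesis
      by (rule coset_eq_iff[OF M.smult_closed[OF r wc] M.smult_closed[OF r v], THEN iffD2])
  qed
  have "N +>\<^bsub>M\<^esub> v \<noteq> {}" using S.a_rcos_self[OF v] by blast
  then have "(\<Union>w\<in>N +>\<^bsub>M\<^esub> v. N +>\<^bsub>M\<^esub> (r \<odot>\<^bsub>M\<^esub> w)) = N +>\<^bsub>M\<^esub> (r \<odot>\<^bsub>M\<^esub> v)"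
    by (rule SUP_eq_const) (rule const)
  then show ?thesis by (simp add: quot_module_def)
qed

lemmas quot_simps = quot_add quot_smult

lemma module_quot: "module R (quot_module M N)"
proof (rule module_criteria)
  show "cring R" by (rule M.R.cring_axioms)
  show "\<forall>v\<in>carrier (quot_module M N). \<exists>w\<in>carrier (quot_module M N).
      v \<oplus>\<^bsub>quot_module M N\<^esub> w = \<zero>\<^bsub>quot_module M N\<^esub>"
  proof
    fix V assume "V \<in> carrier (quot_module M N)"
    then obtain v where v: "v \<in> carrier M" "V = N +>\<^bsub>M\<^esub> v" by (auto simp: quot_carrier)
    then have "V \<oplus>\<^bsub>quot_module M N\<^esub> (N +>\<^bsub>M\<^esub> (\<ominus>\<^bsub>M\<^esub> v)) = \<zero>\<^bsub>quot_module M N\<^esub>"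
      by (simp add: quot_zero quot_add M.r_neg)
    moreover have "N +>\<^bsub>M\<^esub> (\<ominus>\<^bsub>M\<^esub> v) \<in> carrier (quot_module M N)"
      using v by (auto simp: quot_carrier)
    ultimately show "\<exists>w\<in>carrier (quot_module M N). V \<oplus>\<^bsub>quot_module M N\<^esub> w = \<zero>\<^bsub>quot_module M N\<^esub>"
      by blast
  qed
  show "\<zero>\<^bsub>quot_module M N\<^esub> \<in> carrier (quot_module M N)" by (auto simp: quot_carrier quot_zero)
qed (unfold quot_carrier, auto simp: quot_zero quot_simps M.a_ac M.smult_assoc1
    M.smult_l_distr M.smult_r_distr)

end

subsection \<open>The fraction field\<close>

context domain
begin

abbreviation nonzero where "nonzero \<equiv> carrier R - {\<zero>}"
abbreviation frac where "frac \<equiv> frac_class R"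
abbreviation K where "K \<equiv> frac_field R"

text \<open>Transitivity of cross-multiplication; the common factor \<open>b\<close> is cancelled,
  which is where the ring being a domain enters.\<close>

lemma frac_class_subset:
  assumes "a \<in> carrier R" "b \<in> nonzero" "c \<in> carrier R" "d \<in> nonzero" "a \<otimes> d = c \<otimes> b"
  shows "frac a b \<subseteq> frac c d"
proof
  fix p assume "p \<in> frac a b"
  then obtain x y where p: "p = (x, y)" "x \<in> carrier R" "y \<in> nonzero" "a \<otimes> y = x \<otimes> b"
    by (auto simp: frac_class_def)
  note carr = assms(1-4) p(2,3)
  have "b \<otimes> (c \<otimes> y) = (c \<otimes> b) \<otimes> y" using carr by (simp add: m_ac)
  also have "\<dots> = (a \<otimes> d) \<otimes> y" by (simp only: assms(5))
  also have "\<dots> = (a \<otimes> y) \<otimes> d" using carr by (simp add: m_ac)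
  also have "\<dots> = (x \<otimes> b) \<otimes> d" by (simp only: p)
  also have "\<dots> = b \<otimes> (x \<otimes> d)" using carr by (simp add: m_ac)
  finally have "c \<otimes> y = x \<otimes> d" using carr m_lcancel[of b "c \<otimes> y" "x \<otimes> d"] by auto
  then show "p \<in> frac c d" using p by (simp add: frac_class_def)
qed

lemma frac_eq_iff:
  assumes "a \<in> carrier R" "b \<in> nonzero" "c \<in> carrier R" "d \<in> nonzero"
  shows "frac a b = frac c d \<longleftrightarrow> a \<otimes> d = c \<otimes> b"
proof
  assume "frac a b = frac c d"
  moreover have "(c, d) \<in> frac c d" using assms by (simp add: frac_class_def)
  ultimately show "a \<otimes> d = c \<otimes> b" by (auto simp: frac_class_def)
next
  assume "a \<otimes> d = c \<otimes> b"
  then show "frac a b = frac c d" using assms frac_class_subset by (intro equalityI) auto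
qed

lemma nonzero_mult [simp, intro]: "b \<in> nonzero \<Longrightarrow> d \<in> nonzero \<Longrightarrow> b \<otimes> d \<in> nonzero"
  using integral by auto

lemma nonzero_one [simp]: "\<one> \<in> nonzero"
  by auto

lemma in_fracD:
  assumes "(x, y) \<in> frac a b"
  shows "x \<in> carrier R" "y \<in> nonzero" "a \<otimes> y = x \<otimes> b"
  using assms by (auto simp: frac_class_def)

text \<open>Sums and products of fractions are unions over all pairs of representatives; once the
  result is independent of the choice, the union collapses to one class.\<close>

lemma UN_frac_const:
  assumes "a \<in> carrier R" "b \<in> nonzero" "c \<in> carrier R" "d \<in> nonzero"
    and const: "\<And>x y z w. (x, y) \<in> frac a b \<Longrightarrow> (z, w) \<in> frac c d \<Longrightarrow> h x y z w = C"
  shows "(\<Union>(x, y)\<in>frac a b. \<Union>(z, w)\<in>frac c d. h x y z w) = C"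
proof -
  have "(a, b) \<in> frac a b" "(c, d) \<in> frac c d" using assms by (simp_all add: frac_class_def)
  then show ?thesis using const by fastforce
qed

lemma frac_mult:
  assumes "a \<in> carrier R" "b \<in> nonzero" "c \<in> carrier R" "d \<in> nonzero"
  shows "frac a b \<otimes>\<^bsub>K\<^esub> frac c d = frac (a \<otimes> c) (b \<otimes> d)"
proof -
  have "frac (x \<otimes> z) (y \<otimes> w) = frac (a \<otimes> c) (b \<otimes> d)"
    if xy: "(x, y) \<in> frac a b" and zw: "(z, w) \<in> frac c d" for x y z w
  proof -
    note xy = in_fracD[OF xy] and zw = in_fracD[OF zw]
    note carr = xy(1,2) zw(1,2) assms
    have "(x \<otimes> z) \<otimes> (b \<otimes> d) = (x \<otimes> b) \<otimes> (z \<otimes> d)" using carr by (simp add: m_ac)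
    also have "\<dots> = (a \<otimes> y) \<otimes> (c \<otimes> w)" by (simp only: xy zw)
    also have "\<dots> = (a \<otimes> c) \<otimes> (y \<otimes> w)" using carr by (simp add: m_ac)
    finally show ?thesis using carr nonzero_mult by (subst frac_eq_iff) auto
  qed
  then show ?thesis using assms by (simp add: frac_field_def) (rule UN_frac_const, auto)
qed

lemma frac_add:
  assumes "a \<in> carrier R" "b \<in> nonzero" "c \<in> carrier R" "d \<in> nonzero"
  shows "frac a b \<oplus>\<^bsub>K\<^esub> frac c d = frac (a \<otimes> d \<oplus> c \<otimes> b) (b \<otimes> d)"
proof -
  have "frac (x \<otimes> w \<oplus> z \<otimes> y) (y \<otimes> w) = frac (a \<otimes> d \<oplus> c \<otimes> b) (b \<otimes> d)"
    if xy: "(x, y) \<in> frac a b" and zw: "(z, w) \<in> frac c d" for x y z w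
  proof -
    note xy = in_fracD[OF xy] and zw = in_fracD[OF zw]
    note carr = xy(1,2) zw(1,2) assms
    have "(x \<otimes> w \<oplus> z \<otimes> y) \<otimes> (b \<otimes> d) = (x \<otimes> b) \<otimes> (w \<otimes> d) \<oplus> (z \<otimes> d) \<otimes> (y \<otimes> b)"
      using carr by (simp add: m_ac l_distr r_distr)
    also have "\<dots> = (a \<otimes> y) \<otimes> (w \<otimes> d) \<oplus> (c \<otimes> w) \<otimes> (y \<otimes> b)" by (simp only: xy zw)
    also have "\<dots> = (a \<otimes> d \<oplus> c \<otimes> b) \<otimes> (y \<otimes> w)" using carr by (simp add: m_ac l_distr r_distr)
    finally show ?thesis using carr nonzero_mult by (subst frac_eq_iff) auto
  qed
  then show ?thesis using assms by (simp add: frac_field_def) (rule UN_frac_const, auto)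
qed

lemma frac_carrier: "carrier K = {frac a b | a b. a \<in> carrier R \<and> b \<in> nonzero}"
  by (simp add: frac_field_def)

lemma frac_in_carrier [simp, intro]: "a \<in> carrier R \<Longrightarrow> b \<in> nonzero \<Longrightarrow> frac a b \<in> carrier K"
  by (auto simp: frac_carrier)

lemma frac_zero: "\<zero>\<^bsub>K\<^esub> = frac \<zero> \<one>" and frac_one: "\<one>\<^bsub>K\<^esub> = frac \<one> \<one>"
  by (simp_all add: frac_field_def)

lemma frac_cases:
  assumes "X \<in> carrier K"
  obtains a b where "a \<in> carrier R" "b \<in> nonzero" "X = frac a b"
  using assms by (auto simp: frac_carrier)

lemma cring_frac_field: "cring K"
proof (rule cringI)
  show "abelian_group K"
  proof (rule abelian_groupI)
    fix X Y Z assume "X \<in> carrier K" "Y \<in> carrier K" "Z \<in> carrier K"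
    then obtain a b c d f g where *: "a \<in> carrier R" "b \<in> nonzero" "c \<in> carrier R" "d \<in> nonzero"
      "f \<in> carrier R" "g \<in> nonzero" and XYZ: "X = frac a b" "Y = frac c d" "Z = frac f g"
      by (elim frac_cases) (rule that)
    note m = nonzero_mult[OF *(2,4)] nonzero_mult[OF *(4,6)]
    show "X \<oplus>\<^bsub>K\<^esub> Y \<in> carrier K" unfolding XYZ using * m by (simp add: frac_add)
    show "X \<oplus>\<^bsub>K\<^esub> Y = Y \<oplus>\<^bsub>K\<^esub> X" unfolding XYZ using * by (simp add: frac_add m_comm a_comm)
    have "frac a b \<oplus>\<^bsub>K\<^esub> frac c d \<oplus>\<^bsub>K\<^esub> frac f g = frac ((a \<otimes> d \<oplus> c \<otimes> b) \<otimes> g \<oplus> f \<otimes> (b \<otimes> d)) (b \<otimes> d \<otimes> g)"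
      using * m by (simp only: frac_add) (subst frac_add, auto)
    moreover have "frac a b \<oplus>\<^bsub>K\<^esub> (frac c d \<oplus>\<^bsub>K\<^esub> frac f g) = frac (a \<otimes> (d \<otimes> g) \<oplus> (c \<otimes> g \<oplus> f \<otimes> d) \<otimes> b) (b \<otimes> (d \<otimes> g))"
      using * m by (simp only: frac_add) (subst frac_add, auto)
    moreover have "(a \<otimes> d \<oplus> c \<otimes> b) \<otimes> g \<oplus> f \<otimes> (b \<otimes> d) = a \<otimes> (d \<otimes> g) \<oplus> (c \<otimes> g \<oplus> f \<otimes> d) \<otimes> b"
      using * by (simp add: l_distr r_distr m_ac a_ac)
    moreover have "b \<otimes> d \<otimes> g = b \<otimes> (d \<otimes> g)" using * by (simp add: m_assoc)
    ultimately show "X \<oplus>\<^bsub>K\<^esub> Y \<oplus>\<^bsub>K\<^esub> Z = X \<oplus>\<^bsub>K\<^esub> (Y \<oplus>\<^bsub>K\<^esub> Z)" by (simp only: XYZ)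
  next
    show "\<zero>\<^bsub>K\<^esub> \<in> carrier K" by (simp add: frac_zero)
    fix X assume "X \<in> carrier K"
    then obtain a b where *: "a \<in> carrier R" "b \<in> nonzero" and X: "X = frac a b" by (rule frac_cases)
    show "\<zero>\<^bsub>K\<^esub> \<oplus>\<^bsub>K\<^esub> X = X" unfolding X using * by (simp add: frac_zero frac_add)
    have "frac (\<ominus> a) b \<oplus>\<^bsub>K\<^esub> X = frac \<zero> (b \<otimes> b)"
      unfolding X using * by (simp add: frac_add l_minus l_neg)
    also have "\<dots> = \<zero>\<^bsub>K\<^esub>" using * by (simp add: frac_zero frac_eq_iff integral_iff)
    finally show "\<exists>Y\<in>carrier K. Y \<oplus>\<^bsub>K\<^esub> X = \<zero>\<^bsub>K\<^esub>" using * by (intro bexI[of _ "frac (\<ominus> a) b"]) auto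
  qed
  show "comm_monoid K"
  proof (rule comm_monoidI)
    fix X Y Z assume "X \<in> carrier K" "Y \<in> carrier K" "Z \<in> carrier K"
    then obtain a b c d f g where *: "a \<in> carrier R" "b \<in> nonzero" "c \<in> carrier R" "d \<in> nonzero"
      "f \<in> carrier R" "g \<in> nonzero" and XYZ: "X = frac a b" "Y = frac c d" "Z = frac f g"
      by (elim frac_cases) (rule that)
    note m = nonzero_mult[OF *(2,4)] nonzero_mult[OF *(4,6)]
    show "X \<otimes>\<^bsub>K\<^esub> Y \<in> carrier K" unfolding XYZ using * m by (simp add: frac_mult)
    show "X \<otimes>\<^bsub>K\<^esub> Y = Y \<otimes>\<^bsub>K\<^esub> X" unfolding XYZ using * by (simp add: frac_mult m_comm)
    have "frac a b \<otimes>\<^bsub>K\<^esub> frac c d \<otimes>\<^bsub>K\<^esub> frac f g = frac (a \<otimes> c \<otimes> f) (b \<otimes> d \<otimes> g)"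
      using * m by (simp only: frac_mult) (subst frac_mult, auto)
    moreover have "frac a b \<otimes>\<^bsub>K\<^esub> (frac c d \<otimes>\<^bsub>K\<^esub> frac f g) = frac (a \<otimes> (c \<otimes> f)) (b \<otimes> (d \<otimes> g))"
      using * m by (simp only: frac_mult) (subst frac_mult, auto)
    ultimately show "X \<otimes>\<^bsub>K\<^esub> Y \<otimes>\<^bsub>K\<^esub> Z = X \<otimes>\<^bsub>K\<^esub> (Y \<otimes>\<^bsub>K\<^esub> Z)" using * by (simp add: XYZ m_assoc)
  next
    show "\<one>\<^bsub>K\<^esub> \<in> carrier K" by (simp add: frac_one)
    fix X assume "X \<in> carrier K"
    then obtain a b where *: "a \<in> carrier R" "b \<in> nonzero" and X: "X = frac a b" by (rule frac_cases)
    show "\<one>\<^bsub>K\<^esub> \<otimes>\<^bsub>K\<^esub> X = X" unfolding X using * by (simp add: frac_one frac_mult)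
  qed
  fix X Y Z assume "X \<in> carrier K" "Y \<in> carrier K" "Z \<in> carrier K"
  then obtain a b c d f g where *: "a \<in> carrier R" "b \<in> nonzero" "c \<in> carrier R" "d \<in> nonzero"
    "f \<in> carrier R" "g \<in> nonzero" and XYZ: "X = frac a b" "Y = frac c d" "Z = frac f g"
    by (elim frac_cases) (rule that)
  note m = nonzero_mult[OF *(2,4)] nonzero_mult[OF *(2,6)] nonzero_mult[OF *(4,6)]
  have "(X \<oplus>\<^bsub>K\<^esub> Y) \<otimes>\<^bsub>K\<^esub> Z = frac ((a \<otimes> d \<oplus> c \<otimes> b) \<otimes> f) (b \<otimes> d \<otimes> g)"
    unfolding XYZ using * m by (simp only: frac_add) (subst frac_mult, auto)
  moreover have "X \<otimes>\<^bsub>K\<^esub> Z \<oplus>\<^bsub>K\<^esub> Y \<otimes>\<^bsub>K\<^esub> Z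
      = frac (a \<otimes> f \<otimes> (d \<otimes> g) \<oplus> c \<otimes> f \<otimes> (b \<otimes> g)) (b \<otimes> g \<otimes> (d \<otimes> g))"
    unfolding XYZ using * m by (simp only: frac_mult) (subst frac_add, auto)
  \<comment> \<open>The two sides of distributivity differ by an extra factor \<open>g\<close> in
    numerator and denominator, so they agree only as classes.\<close>
  moreover have "frac ((a \<otimes> d \<oplus> c \<otimes> b) \<otimes> f) (b \<otimes> d \<otimes> g)
      = frac (a \<otimes> f \<otimes> (d \<otimes> g) \<oplus> c \<otimes> f \<otimes> (b \<otimes> g)) (b \<otimes> g \<otimes> (d \<otimes> g))"
  proof (subst frac_eq_iff)
    show "(a \<otimes> d \<oplus> c \<otimes> b) \<otimes> f \<otimes> (b \<otimes> g \<otimes> (d \<otimes> g))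
        = (a \<otimes> f \<otimes> (d \<otimes> g) \<oplus> c \<otimes> f \<otimes> (b \<otimes> g)) \<otimes> (b \<otimes> d \<otimes> g)"
      using * by (simp add: l_distr r_distr m_ac)
    show "b \<otimes> d \<otimes> g \<in> nonzero" "b \<otimes> g \<otimes> (d \<otimes> g) \<in> nonzero" 
      by (rule nonzero_mult[OF m(1) *(6)], rule nonzero_mult[OF m(2,3)])
  qed (use * in auto)
  ultimately show "(X \<oplus>\<^bsub>K\<^esub> Y) \<otimes>\<^bsub>K\<^esub> Z = X \<otimes>\<^bsub>K\<^esub> Z \<oplus>\<^bsub>K\<^esub> Y \<otimes>\<^bsub>K\<^esub> Z" by simp
qed

lemma field_frac_field: "field K"
proof (rule cring.cring_fieldI2[OF cring_frac_field])
  show "\<zero>\<^bsub>K\<^esub> \<noteq> \<one>\<^bsub>K\<^esub>" by (simp add: frac_zero frac_one frac_eq_iff)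
  fix X assume X: "X \<in> carrier K" "X \<noteq> \<zero>\<^bsub>K\<^esub>"
  then obtain a b where *: "a \<in> carrier R" "b \<in> nonzero" "X = frac a b" by (metis frac_cases)
  with X have a: "a \<in> nonzero" by (auto simp: frac_zero frac_eq_iff)
  have "X \<otimes>\<^bsub>K\<^esub> frac b a = \<one>\<^bsub>K\<^esub>"
    using a * by (simp add: frac_mult frac_one frac_eq_iff integral_iff m_ac)
  then show "\<exists>Y\<in>carrier K. X \<otimes>\<^bsub>K\<^esub> Y = \<one>\<^bsub>K\<^esub>" using a * by (intro bexI[of _ "frac b a"]) auto
qed

lemma frac_hom: "(\<lambda>a. frac a \<one>) \<in> Ring.ring_hom R K"
  by (rule ring_hom_memI) (simp_all add: frac_mult frac_add frac_one)

lemma frac_hom_eq_0_iff: "a \<in> carrier R \<Longrightarrow> frac a \<one> = \<zero>\<^bsub>K\<^esub> \<longleftrightarrow> a = \<zero>"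
  by (simp add: frac_zero frac_eq_iff)

end

subsection \<open>Regular sequences\<close>

lemma seq_times_submodule:
  fixes M :: "('a, 'b) module"
  assumes "module R M" and fs: "set fs \<subseteq> carrier R"
  shows "submodule R (seq_times_module M fs) M"
proof (rule submodule.intro[OF assms(1)])
  interpret module R M by fact
  have fs': "fs ! i \<in> carrier R" if "i \<in> {..<length fs}" for i using fs that by (auto intro: nth_mem)
  show "seq_times_module M fs \<subseteq> carrier M"
    using fs' by (fastforce simp: seq_times_module_def intro!: M.finsum_closed)
  show "\<zero>\<^bsub>M\<^esub> \<in> seq_times_module M fs"
  proof -
    have "(\<Oplus>\<^bsub>M\<^esub>i\<in>{..<length fs}. fs ! i \<odot>\<^bsub>M\<^esub> \<zero>\<^bsub>M\<^esub>) = (\<Oplus>\<^bsub>M\<^esub>i\<in>{..<length fs}. \<zero>\<^bsub>M\<^esub>)"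
      using fs' by (intro M.finsum_cong') auto
    then show ?thesis unfolding seq_times_module_def by (intro CollectI exI[of _ "\<lambda>_. \<zero>\<^bsub>M\<^esub>"]) simp
  qed
  fix v assume "v \<in> seq_times_module M fs"
  then obtain m where m: "m \<in> {..<length fs} \<rightarrow> carrier M"
    "v = (\<Oplus>\<^bsub>M\<^esub>i\<in>{..<length fs}. fs ! i \<odot>\<^bsub>M\<^esub> m i)" by (auto simp: seq_times_module_def)
  show "c \<odot>\<^bsub>M\<^esub> v \<in> seq_times_module M fs" if c: "c \<in> carrier R" for c
  proof -
    have "c \<odot>\<^bsub>M\<^esub> v = (\<Oplus>\<^bsub>M\<^esub>i\<in>{..<length fs}. c \<odot>\<^bsub>M\<^esub> (fs ! i \<odot>\<^bsub>M\<^esub> m i))"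
      unfolding m(2) using m(1) c fs' by (intro finsum_smult) auto
    also have "\<dots> = (\<Oplus>\<^bsub>M\<^esub>i\<in>{..<length fs}. fs ! i \<odot>\<^bsub>M\<^esub> (c \<odot>\<^bsub>M\<^esub> m i))"
      using m(1) c fs' by (intro M.finsum_cong') (auto simp: smult_assoc_simp m_comm Pi_iff)
    finally show ?thesis unfolding seq_times_module_def
      using m(1) c by (intro CollectI exI[of _ "\<lambda>i. c \<odot>\<^bsub>M\<^esub> m i"]) auto
  qed
  fix w assume "w \<in> seq_times_module M fs"
  then obtain m' where m': "m' \<in> {..<length fs} \<rightarrow> carrier M"
    "w = (\<Oplus>\<^bsub>M\<^esub>i\<in>{..<length fs}. fs ! i \<odot>\<^bsub>M\<^esub> m' i)" by (auto simp: seq_times_module_def)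
  have "v \<oplus>\<^bsub>M\<^esub> w = (\<Oplus>\<^bsub>M\<^esub>i\<in>{..<length fs}. fs ! i \<odot>\<^bsub>M\<^esub> m i \<oplus>\<^bsub>M\<^esub> fs ! i \<odot>\<^bsub>M\<^esub> m' i)"
    unfolding m(2) m'(2) using m(1) m'(1) fs' by (intro M.finsum_addf[symmetric]) auto
  also have "\<dots> = (\<Oplus>\<^bsub>M\<^esub>i\<in>{..<length fs}. fs ! i \<odot>\<^bsub>M\<^esub> (m i \<oplus>\<^bsub>M\<^esub> m' i))"
    using m(1) m'(1) fs' by (intro M.finsum_cong') (auto simp: smult_r_distr Pi_iff)
  finally show "v \<oplus>\<^bsub>M\<^esub> w \<in> seq_times_module M fs" unfolding seq_times_module_def
    using m(1) m'(1) by (intro CollectI exI[of _ "\<lambda>i. m i \<oplus>\<^bsub>M\<^esub> m' i"]) auto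
qed

lemma seq_times_mem:
  fixes M :: "('a, 'b) module"
  assumes "module R M" and fs: "set fs \<subseteq> carrier R" and f: "f \<in> set fs" and m: "m \<in> carrier M"
  shows "f \<odot>\<^bsub>M\<^esub> m \<in> seq_times_module M fs"
proof -
  interpret module R M by fact
  have fs': "fs ! i \<in> carrier R" if "i \<in> {..<length fs}" for i using fs that by (auto intro: nth_mem)
  obtain i where i: "i < length fs" "f = fs ! i" using f by (metis in_set_conv_nth)
  have "(\<Oplus>\<^bsub>M\<^esub>j\<in>{..<length fs}. fs ! j \<odot>\<^bsub>M\<^esub> (if i = j then m else \<zero>\<^bsub>M\<^esub>))
      = (\<Oplus>\<^bsub>M\<^esub>j\<in>{..<length fs}. if i = j then fs ! j \<odot>\<^bsub>M\<^esub> m else \<zero>\<^bsub>M\<^esub>)"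
    using fs' m by (intro M.finsum_cong') auto
  also have "\<dots> = f \<odot>\<^bsub>M\<^esub> m"
    using i fs' m M.finsum_singleton[of i "{..<length fs}" "\<lambda>j. fs ! j \<odot>\<^bsub>M\<^esub> m"] by auto
  finally have "f \<odot>\<^bsub>M\<^esub> m = (\<Oplus>\<^bsub>M\<^esub>j\<in>{..<length fs}. fs ! j \<odot>\<^bsub>M\<^esub> (if i = j then m else \<zero>\<^bsub>M\<^esub>))" ..
  then show ?thesis unfolding seq_times_module_def
    using m by (intro CollectI exI[of _ "\<lambda>j. if i = j then m else \<zero>\<^bsub>M\<^esub>"]) auto
qed

lemma seq_times_subset:
  fixes M :: "('a, 'b) module"
  assumes W: "submodule R W M" and mem: "\<And>f m. f \<in> set fs \<Longrightarrow> m \<in> carrier M \<Longrightarrow> f \<odot>\<^bsub>M\<^esub> m \<in> W"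
  shows "seq_times_module M fs \<subseteq> W"
proof
  interpret W: submodule R W M by fact
  interpret module R M by (rule W.module)
  fix v assume "v \<in> seq_times_module M fs"
  then obtain m where m: "m \<in> {..<length fs} \<rightarrow> carrier M"
    "v = (\<Oplus>\<^bsub>M\<^esub>i\<in>{..<length fs}. fs ! i \<odot>\<^bsub>M\<^esub> m i)" by (auto simp: seq_times_module_def)
  have *: "fs ! i \<odot>\<^bsub>M\<^esub> m i \<in> W" if "i < length fs" for i using that m(1) mem[of "fs ! i" "m i"] by auto
  have "(\<Oplus>\<^bsub>M\<^esub>i\<in>I. fs ! i \<odot>\<^bsub>M\<^esub> m i) \<in> W" if "finite I" "I \<subseteq> {..<length fs}" for I
    using that
  proof (induction I rule: finite_induct)
    case empty
    then show ?case using W.zero_closed by simp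
  next
    case (insert i I)
    then show ?case using * W.subset W.m_closed by (subst M.finsum_insert) auto
  qed
  from this[of "{..<length fs}"] m show "v \<in> W" by simp
qed

lemma seq_times_Nil:
  assumes "module R M"
  shows "seq_times_module M [] = {\<zero>\<^bsub>M\<^esub>}"
proof -
  interpret module R M by fact
  show ?thesis by (auto simp: seq_times_module_def)
qed

lemma seq_times_single:
  fixes M :: "('a, 'b) module"
  assumes "module R M" "f \<in> carrier R"
  shows "seq_times_module M [f] = {f \<odot>\<^bsub>M\<^esub> m | m. m \<in> carrier M}"
proof
  interpret module R M by fact
  have *: "(\<Oplus>\<^bsub>M\<^esub>i\<in>{..<length [f]}. [f] ! i \<odot>\<^bsub>M\<^esub> m i) = f \<odot>\<^bsub>M\<^esub> m 0" if "m 0 \<in> carrier M" for m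
    using that assms(2) by (simp add: lessThan_Suc)
  show "seq_times_module M [f] \<subseteq> {f \<odot>\<^bsub>M\<^esub> m | m. m \<in> carrier M}"
  proof
    fix v assume "v \<in> seq_times_module M [f]"
    then obtain m where m: "m \<in> {..<length [f]} \<rightarrow> carrier M"
      "v = (\<Oplus>\<^bsub>M\<^esub>i\<in>{..<length [f]}. [f] ! i \<odot>\<^bsub>M\<^esub> m i)" unfolding seq_times_module_def by blast
    then have "m 0 \<in> carrier M" by auto
    with m(2) * show "v \<in> {f \<odot>\<^bsub>M\<^esub> m | m. m \<in> carrier M}" by auto
  qed
  show "{f \<odot>\<^bsub>M\<^esub> m | m. m \<in> carrier M} \<subseteq> seq_times_module M [f]"
    using seq_times_mem[OF assms(1), of "[f]" f] assms(2) by auto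
qed

subsection \<open>Extension of scalars\<close>

locale scalar_extension = M: module R M + K: cring K
  for R :: "('a, 'r) ring_scheme" and M :: "('a, 'b) module" and K :: "('k, 's) ring_scheme" +
  fixes \<phi> :: "'a \<Rightarrow> 'k"
  assumes hom: "\<phi> \<in> Ring.ring_hom R K"
begin

abbreviation "S \<equiv> carrier K \<times> carrier M"
abbreviation "G \<equiv> free_Abelian_group S"
definition "N = generate G (tensor_relations R K \<phi> M)"
text \<open>Cosets of \<open>N\<close> as translates inside the whole type of formal sums. In this
  form the rules for equality and addition carry no membership conditions.\<close>

definition "cl c = (\<lambda>n. n + c) ` N"
abbreviation "V \<equiv> base_change R K \<phi> M"
definition "scale k = frag_extend (\<lambda>(k', m). frag_of (k \<otimes>\<^bsub>K\<^esub> k', m))"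
definition "tensor k m = cl (frag_of (k, m))"

lemma \<phi>_closed [simp]: "r \<in> carrier R \<Longrightarrow> \<phi> r \<in> carrier K"
  by (rule ring_hom_closed[OF hom])

lemma relations_subset: "tensor_relations R K \<phi> M \<subseteq> carrier G"
  by (auto simp: tensor_relations_def dest!: subsetD[OF keys_diff])

lemma tensor_relations_cases:
  assumes "c \<in> tensor_relations R K \<phi> M"
  obtains
      k1 k2 m where "k1 \<in> carrier K" "k2 \<in> carrier K" "m \<in> carrier M"
        "c = frag_of (k1 \<oplus>\<^bsub>K\<^esub> k2, m) - frag_of (k1, m) - frag_of (k2, m)"
    | k1 m m' where "k1 \<in> carrier K" "m \<in> carrier M" "m' \<in> carrier M"
        "c = frag_of (k1, m \<oplus>\<^bsub>M\<^esub> m') - frag_of (k1, m) - frag_of (k1, m')"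
    | k1 r m where "k1 \<in> carrier K" "r \<in> carrier R" "m \<in> carrier M"
        "c = frag_of (k1 \<otimes>\<^bsub>K\<^esub> \<phi> r, m) - frag_of (k1, r \<odot>\<^bsub>M\<^esub> m)"
  using assms unfolding tensor_relations_def
  by (elim UnE CollectE exE conjE) (erule (3) that)+

lemma subgroup_N: "subgroup N G"
  unfolding N_def by (rule group.generate_is_subgroup[OF group_free_Abelian_group relations_subset])

lemma N_subset: "c \<in> N \<Longrightarrow> Poly_Mapping.keys c \<subseteq> S"
  using subsetD[OF subgroup.subset[OF subgroup_N], of c] by simp

lemma N_zero [simp]: "0 \<in> N"
  using subgroup.one_closed[OF subgroup_N] by simp

lemma N_add: "c \<in> N \<Longrightarrow> d \<in> N \<Longrightarrow> c + d \<in> N"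
  using subgroup.m_closed[OF subgroup_N, of c d] by simp

lemma N_minus: "c \<in> N \<Longrightarrow> - c \<in> N"
  using subgroup.m_inv_closed[OF subgroup_N, of c] N_subset[of c] by simp

lemma N_diff: "c \<in> N \<Longrightarrow> d \<in> N \<Longrightarrow> c - d \<in> N"
  using N_add[OF _ N_minus, of c d] by simp

text \<open>A single case for differences covers both inverses and products in the generated
  subgroup: -h is 0 - h, and c + d is c - (0 - d).\<close>

lemma N_induct [consumes 1, case_names rel zero diff]:
  assumes "c \<in> N" "\<And>c. c \<in> tensor_relations R K \<phi> M \<Longrightarrow> P c" "P 0"
    and diff: "\<And>c d. c \<in> N \<Longrightarrow> d \<in> N \<Longrightarrow> P c \<Longrightarrow> P d \<Longrightarrow> P (c - d)"
  shows "P c"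
  using assms(1) unfolding N_def
proof (induction rule: generate.induct)
  case (inv h)
  then have "h \<in> N" by (auto simp: N_def intro: generate.incl)
  then have "P (0 - h)" using inv assms(2,3) by (intro diff) auto
  then show ?case using N_subset[OF \<open>h \<in> N\<close>] by simp
next
  case (eng c d)
  then have "c \<in> N" "d \<in> N" by (auto simp: N_def)
  then have "P (c - (0 - d))" using eng assms(3) by (intro diff N_diff) auto
  then show ?case by simp
qed (use assms in auto)

lemma frag_induct [consumes 1, case_names zero diff of]:
  assumes "Poly_Mapping.keys c \<subseteq> S" "P 0"
    and "\<And>c d. \<lbrakk>Poly_Mapping.keys c \<subseteq> S; Poly_Mapping.keys d \<subseteq> S; P c; P d\<rbrakk> \<Longrightarrow> P (c - d)"
    and "\<And>k m. \<lbrakk>k \<in> carrier K; m \<in> carrier M\<rbrakk> \<Longrightarrow> P (frag_of (k, m))"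
  shows "P c"
  using assms(1) by (rule free_Abelian_group_induct) (use assms in auto)

lemma rcoset_eq_cl: "N #>\<^bsub>G\<^esub> c = cl c"
  by (auto simp: r_coset_def cl_def)

lemma cl_eq_iff: "cl c = cl d \<longleftrightarrow> c - d \<in> N"
proof
  assume "cl c = cl d"
  moreover have "c \<in> cl c" by (force simp: cl_def)
  ultimately show "c - d \<in> N" by (auto simp: cl_def)
next
  have *: "cl c \<subseteq> cl d" if "c - d \<in> N" for c d
  proof
    fix x assume "x \<in> cl c"
    then obtain n where n: "n \<in> N" "x = n + c" by (auto simp: cl_def)
    then have "x = (n + (c - d)) + d" "n + (c - d) \<in> N" using that by (auto intro: N_add)
    then show "x \<in> cl d" unfolding cl_def by (rule image_eqI)
  qed
  assume "c - d \<in> N"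
  then show "cl c = cl d" using *[of c d] *[of d c] N_minus[of "c - d"] by auto
qed

lemma carrier_V: "carrier V = cl ` carrier G"
  by (auto simp: base_change_def Let_def RCOSETS_def rcoset_eq_cl simp flip: N_def)

lemma zero_V: "\<zero>\<^bsub>V\<^esub> = cl 0"
  by (simp add: base_change_def Let_def cl_def flip: N_def)

lemma add_V: "cl c \<oplus>\<^bsub>V\<^esub> cl d = cl (c + d)"
proof -
  have "cl c <#>\<^bsub>G\<^esub> cl d = cl (c + d)"
  proof (intro equalityI subsetI)
    fix x assume "x \<in> cl c <#>\<^bsub>G\<^esub> cl d"
    then obtain m n where "m \<in> N" "n \<in> N" "x = (m + c) + (n + d)" by (auto simp: set_mult_def cl_def)
    then have "m + n \<in> N" "x = (m + n) + (c + d)" by (auto intro: N_add)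
    then show "x \<in> cl (c + d)" by (auto simp: cl_def)
  next
    fix x assume "x \<in> cl (c + d)"
    then obtain m where m: "m \<in> N" "x = (m + c) + (0 + d)" by (auto simp: cl_def add.assoc)
    then have "m + c \<in> cl c" "0 + d \<in> cl d" by (auto simp: cl_def)
    with m show "x \<in> cl c <#>\<^bsub>G\<^esub> cl d" by (force simp: set_mult_def)
  qed
  then show ?thesis by (simp add: base_change_def Let_def)
qed

lemma scale_simps [simp]:
  "scale k 0 = 0" "scale k (c - d) = scale k c - scale k d" "scale k (c + d) = scale k c + scale k d"
  "scale k (frag_of (k', m)) = frag_of (k \<otimes>\<^bsub>K\<^esub> k', m)"
  by (simp_all add: scale_def frag_extend_diff frag_extend_add)

lemma relation_add_left:
  "\<lbrakk>k \<in> carrier K; k' \<in> carrier K; m \<in> carrier M\<rbrakk> \<Longrightarrow>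
     frag_of (k \<oplus>\<^bsub>K\<^esub> k', m) - frag_of (k, m) - frag_of (k', m) \<in> N"
  unfolding N_def by (rule generate.incl) (auto simp: tensor_relations_def)

lemma relation_add_right:
  "\<lbrakk>k \<in> carrier K; m \<in> carrier M; m' \<in> carrier M\<rbrakk> \<Longrightarrow>
     frag_of (k, m \<oplus>\<^bsub>M\<^esub> m') - frag_of (k, m) - frag_of (k, m') \<in> N"
  unfolding N_def by (rule generate.incl) (auto simp: tensor_relations_def)

lemma relation_smult:
  "\<lbrakk>k \<in> carrier K; r \<in> carrier R; m \<in> carrier M\<rbrakk> \<Longrightarrow>
     frag_of (k \<otimes>\<^bsub>K\<^esub> \<phi> r, m) - frag_of (k, r \<odot>\<^bsub>M\<^esub> m) \<in> N"
  unfolding N_def by (rule generate.incl) (auto simp: tensor_relations_def)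

text \<open>Scaling the first factor turns each relation into a relation of the same kind; this
  makes the action of \<open>K\<close> on cosets well defined.\<close>

lemma scale_N:
  assumes k: "k \<in> carrier K" and "c \<in> N"
  shows "scale k c \<in> N"
  using assms(2)
proof (induction rule: N_induct)
  case (rel c)
  then show ?case
  proof (cases rule: tensor_relations_cases)
    case (1 k1 k2 m)
    then show ?thesis using k relation_add_left[of "k \<otimes>\<^bsub>K\<^esub> k1" "k \<otimes>\<^bsub>K\<^esub> k2" m] by (simp add: K.r_distr)
  next
    case (2 k1 m m')
    then show ?thesis using k relation_add_right[of "k \<otimes>\<^bsub>K\<^esub> k1" m m'] by simp
  next
    case (3 k1 r m)
    then show ?thesis using k relation_smult[of "k \<otimes>\<^bsub>K\<^esub> k1" r m] by (simp add: K.m_assoc)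
  qed
qed (auto intro: N_diff)

lemma keys_scale:
  assumes "k \<in> carrier K" "Poly_Mapping.keys c \<subseteq> S"
  shows "Poly_Mapping.keys (scale k c) \<subseteq> S"
  using assms(2)
proof (induction c rule: frag_induct)
  case (diff x y)
  then show ?case using keys_diff[of "scale k x" "scale k y"] by auto
qed (use assms in auto)

lemma smult_V:
  assumes k: "k \<in> carrier K"
  shows "k \<odot>\<^bsub>V\<^esub> cl c = cl (scale k c)"
proof -
  have const: "cl (scale k d) = cl (scale k c)" if "d \<in> cl c" for d
  proof -
    from that obtain n where "n \<in> N" "d = n + c" by (auto simp: cl_def)
    then show ?thesis using scale_N[OF k] by (simp add: cl_eq_iff)
  qed
  have "cl c \<noteq> {}" using N_zero unfolding cl_def by blast
  then have "(\<Union>d\<in>cl c. cl (scale k d)) = cl (scale k c)"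
    by (rule SUP_eq_const) (rule const)
  then show ?thesis by (simp add: base_change_def Let_def rcoset_eq_cl flip: N_def scale_def)
qed

lemma keys_add_closed: "Poly_Mapping.keys c \<subseteq> S \<Longrightarrow> Poly_Mapping.keys d \<subseteq> S \<Longrightarrow> Poly_Mapping.keys (c + d) \<subseteq> S"
  using keys_add[of c d] by blast

lemma V_cases:
  assumes "v \<in> carrier V"
  obtains c where "Poly_Mapping.keys c \<subseteq> S" "v = cl c"
  using assms by (auto simp: carrier_V)

lemma module_V: "module K V"
proof (rule module_criteria)
  show "cring K" by (rule K.cring_axioms)
  show "\<zero>\<^bsub>V\<^esub> \<in> carrier V" by (auto simp: carrier_V zero_V)
  show "\<forall>v w. v \<in> carrier V \<and> w \<in> carrier V \<longrightarrow> v \<oplus>\<^bsub>V\<^esub> w \<in> carrier V"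
  proof (intro allI impI, elim conjE)
    fix v w assume "v \<in> carrier V" "w \<in> carrier V"
    then obtain c d where "Poly_Mapping.keys c \<subseteq> S" "v = cl c" "Poly_Mapping.keys d \<subseteq> S" "w = cl d"
      by (metis V_cases)
    then show "v \<oplus>\<^bsub>V\<^esub> w \<in> carrier V" using keys_add_closed[of c d] by (simp add: add_V carrier_V)
  qed
  show "\<forall>v\<in>carrier V. \<exists>w\<in>carrier V. v \<oplus>\<^bsub>V\<^esub> w = \<zero>\<^bsub>V\<^esub>"
  proof
    fix v assume "v \<in> carrier V"
    then obtain c where c: "Poly_Mapping.keys c \<subseteq> S" "v = cl c" by (rule V_cases)
    then show "\<exists>w\<in>carrier V. v \<oplus>\<^bsub>V\<^esub> w = \<zero>\<^bsub>V\<^esub>"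
      by (intro bexI[of _ "cl (- c)"]) (auto simp: carrier_V zero_V add_V)
  qed
  show "\<forall>k v. k \<in> carrier K \<and> v \<in> carrier V \<longrightarrow> k \<odot>\<^bsub>V\<^esub> v \<in> carrier V"
  proof (intro allI impI, elim conjE)
    fix k v assume k: "k \<in> carrier K" and "v \<in> carrier V"
    then obtain c where "Poly_Mapping.keys c \<subseteq> S" "v = cl c" by (metis V_cases)
    then show "k \<odot>\<^bsub>V\<^esub> v \<in> carrier V" using k keys_scale[of k c] by (simp add: smult_V carrier_V)
  qed
  show "\<forall>v w. v \<in> carrier V \<and> w \<in> carrier V \<longrightarrow> v \<oplus>\<^bsub>V\<^esub> w = w \<oplus>\<^bsub>V\<^esub> v"
    by (auto simp: carrier_V add_V add.commute)
  show "\<forall>v w x. v \<in> carrier V \<and> w \<in> carrier V \<and> x \<in> carrier V \<longrightarrow>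
      (v \<oplus>\<^bsub>V\<^esub> w) \<oplus>\<^bsub>V\<^esub> x = v \<oplus>\<^bsub>V\<^esub> (w \<oplus>\<^bsub>V\<^esub> x)"
    by (auto simp: carrier_V add_V add.assoc)
  show "\<forall>v\<in>carrier V. v \<oplus>\<^bsub>V\<^esub> \<zero>\<^bsub>V\<^esub> = v"
    by (auto simp: carrier_V zero_V add_V)
  show "\<forall>a b v. a \<in> carrier K \<and> b \<in> carrier K \<and> v \<in> carrier V \<longrightarrow>
      (a \<otimes>\<^bsub>K\<^esub> b) \<odot>\<^bsub>V\<^esub> v = a \<odot>\<^bsub>V\<^esub> (b \<odot>\<^bsub>V\<^esub> v)"
  proof (intro allI impI, elim conjE)
    fix a b v assume ab: "a \<in> carrier K" "b \<in> carrier K" and "v \<in> carrier V"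
    then obtain c where c: "Poly_Mapping.keys c \<subseteq> S" "v = cl c" by (metis V_cases)
    have "scale (a \<otimes>\<^bsub>K\<^esub> b) c = scale a (scale b c)"
      using c(1) by (induction c rule: frag_induct) (use ab in \<open>auto simp: K.m_assoc\<close>)
    then show "(a \<otimes>\<^bsub>K\<^esub> b) \<odot>\<^bsub>V\<^esub> v = a \<odot>\<^bsub>V\<^esub> (b \<odot>\<^bsub>V\<^esub> v)" using ab c by (simp add: smult_V)
  qed
  show "\<forall>v\<in>carrier V. \<one>\<^bsub>K\<^esub> \<odot>\<^bsub>V\<^esub> v = v"
  proof
    fix v assume "v \<in> carrier V"
    then obtain c where c: "Poly_Mapping.keys c \<subseteq> S" "v = cl c" by (rule V_cases)
    have "scale \<one>\<^bsub>K\<^esub> c = c" using c(1) by (induction c rule: frag_induct) auto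
    then show "\<one>\<^bsub>K\<^esub> \<odot>\<^bsub>V\<^esub> v = v" using c by (simp add: smult_V)
  qed
  show "\<forall>a b v. a \<in> carrier K \<and> b \<in> carrier K \<and> v \<in> carrier V \<longrightarrow>
      (a \<oplus>\<^bsub>K\<^esub> b) \<odot>\<^bsub>V\<^esub> v = (a \<odot>\<^bsub>V\<^esub> v) \<oplus>\<^bsub>V\<^esub> (b \<odot>\<^bsub>V\<^esub> v)"
  proof (intro allI impI, elim conjE)
    fix a b v assume ab: "a \<in> carrier K" "b \<in> carrier K" and "v \<in> carrier V"
    then obtain c where c: "Poly_Mapping.keys c \<subseteq> S" "v = cl c" by (metis V_cases)
    \<comment> \<open>Additivity in the scalar holds only modulo the relations, whereas the other
      laws of the action hold already for formal sums.\<close>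
    have "scale (a \<oplus>\<^bsub>K\<^esub> b) c - (scale a c + scale b c) \<in> N"
      using c(1)
    proof (induction c rule: frag_induct)
      case (diff x y)
      from N_diff[OF diff(3,4)] show ?case by (simp add: algebra_simps)
    next
      case (of k m)
      then show ?case using ab relation_add_left[of "a \<otimes>\<^bsub>K\<^esub> k" "b \<otimes>\<^bsub>K\<^esub> k" m]
        by (simp add: K.l_distr algebra_simps)
    qed auto
    then show "(a \<oplus>\<^bsub>K\<^esub> b) \<odot>\<^bsub>V\<^esub> v = (a \<odot>\<^bsub>V\<^esub> v) \<oplus>\<^bsub>V\<^esub> (b \<odot>\<^bsub>V\<^esub> v)"
      using ab c by (simp add: smult_V add_V cl_eq_iff)
  qed
  show "\<forall>a v w. a \<in> carrier K \<and> v \<in> carrier V \<and> w \<in> carrier V \<longrightarrow>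
      a \<odot>\<^bsub>V\<^esub> (v \<oplus>\<^bsub>V\<^esub> w) = (a \<odot>\<^bsub>V\<^esub> v) \<oplus>\<^bsub>V\<^esub> (a \<odot>\<^bsub>V\<^esub> w)"
    by (auto simp: carrier_V smult_V add_V)
qed

lemma tensor_closed [simp]: "k \<in> carrier K \<Longrightarrow> m \<in> carrier M \<Longrightarrow> tensor k m \<in> carrier V"
  by (auto simp: tensor_def carrier_V)

lemma tensor_smult_left:
  "\<lbrakk>k \<in> carrier K; k' \<in> carrier K\<rbrakk> \<Longrightarrow> k \<odot>\<^bsub>V\<^esub> tensor k' m = tensor (k \<otimes>\<^bsub>K\<^esub> k') m"
  by (simp add: tensor_def smult_V)

lemma tensor_add_right:
  "\<lbrakk>k \<in> carrier K; m \<in> carrier M; m' \<in> carrier M\<rbrakk> \<Longrightarrow>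
     tensor k (m \<oplus>\<^bsub>M\<^esub> m') = tensor k m \<oplus>\<^bsub>V\<^esub> tensor k m'"
  using relation_add_right by (simp add: tensor_def add_V cl_eq_iff diff_diff_eq)

lemma tensor_smult_right:
  "\<lbrakk>k \<in> carrier K; r \<in> carrier R; m \<in> carrier M\<rbrakk> \<Longrightarrow>
     tensor k (r \<odot>\<^bsub>M\<^esub> m) = tensor (k \<otimes>\<^bsub>K\<^esub> \<phi> r) m"
  using relation_smult[of k r m] by (simp add: tensor_def cl_eq_iff N_minus[of "_ - _", simplified])

lemma submodule_eqI:
  assumes "submodule K W V" and gen: "\<And>k m. k \<in> carrier K \<Longrightarrow> m \<in> carrier M \<Longrightarrow> tensor k m \<in> W"
  shows "W = carrier V"
proof
  interpret W: submodule K W V by fact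
  interpret V: module K V by (rule module_V)
  show "W \<subseteq> carrier V" by (rule W.subset)
  show "carrier V \<subseteq> W"
  proof
    fix v assume "v \<in> carrier V"
    then obtain c where c: "Poly_Mapping.keys c \<subseteq> S" "v = cl c" by (rule V_cases)
    have "cl c \<in> W" using c(1)
    proof (induction c rule: frag_induct)
      case zero
      then show ?case using W.zero_closed by (simp add: zero_V)
    next
      case (diff x y)
      have y: "cl y \<in> carrier V" using diff(2) by (auto simp: carrier_V)
      have "- y = 0 - y" by simp
      then have "cl y \<oplus>\<^bsub>V\<^esub> cl (- y) = \<zero>\<^bsub>V\<^esub>" by (simp add: add_V zero_V)
      moreover have "cl (- y) \<in> carrier V" using diff(2) by (auto simp: carrier_V)
      ultimately have "cl (- y) = \<ominus>\<^bsub>V\<^esub> cl y" using y V.M.minus_equality[of "cl (- y)" "cl y"] V.M.a_comm by simp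
      also have "\<dots> = (\<ominus>\<^bsub>K\<^esub> \<one>\<^bsub>K\<^esub>) \<odot>\<^bsub>V\<^esub> cl y" using y by (subst V.smult_minus_1) auto
      also have "\<dots> \<in> W" using diff(4) by (intro W.smult_closed) auto
      finally have "cl (- y) \<in> W" .
      from W.m_closed[OF diff(3) this] show ?case by (simp add: add_V)
    next
      case (of k m)
      then show ?case using gen by (auto simp: tensor_def)
    qed
    with c show "v \<in> W" by simp
  qed
qed

text \<open>\<open>L\<close> is the tensor product of the identity of \<open>K\<close> with
  \<open>l\<close>. The universal property of the free abelian group gives a map on formal sums, and
  linearity of \<open>l\<close> makes it kill the three kinds of relations.\<close>

lemma extend_functional:
  assumes l_closed: "\<And>m. m \<in> carrier M \<Longrightarrow> l m \<in> carrier R"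
    and l_add: "\<And>m m'. m \<in> carrier M \<Longrightarrow> m' \<in> carrier M \<Longrightarrow> l (m \<oplus>\<^bsub>M\<^esub> m') = l m \<oplus>\<^bsub>R\<^esub> l m'"
    and l_smult: "\<And>r m. r \<in> carrier R \<Longrightarrow> m \<in> carrier M \<Longrightarrow> l (r \<odot>\<^bsub>M\<^esub> m) = r \<otimes>\<^bsub>R\<^esub> l m"
  obtains L where "\<And>v. v \<in> carrier V \<Longrightarrow> L v \<in> carrier K"
    "\<And>v w. v \<in> carrier V \<Longrightarrow> w \<in> carrier V \<Longrightarrow> L (v \<oplus>\<^bsub>V\<^esub> w) = L v \<oplus>\<^bsub>K\<^esub> L w"
    "\<And>k v. k \<in> carrier K \<Longrightarrow> v \<in> carrier V \<Longrightarrow> L (k \<odot>\<^bsub>V\<^esub> v) = k \<otimes>\<^bsub>K\<^esub> L v"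
    "\<And>k m. k \<in> carrier K \<Longrightarrow> m \<in> carrier M \<Longrightarrow> L (tensor k m) = k \<otimes>\<^bsub>K\<^esub> \<phi> (l m)"
proof -
  define f where "f = (\<lambda>(k, m). k \<otimes>\<^bsub>K\<^esub> \<phi> (l m))"
  have "f ` S \<subseteq> carrier (add_monoid K)" using l_closed by (auto simp: f_def)
  then obtain h where h: "h \<in> hom G (add_monoid K)" "\<And>p. p \<in> S \<Longrightarrow> h (frag_of p) = f p"
    using comm_group.free_Abelian_group_universal[OF K.a_comm_group] by metis
  interpret h: group_hom G "add_monoid K" h
    using h(1) by (intro group_hom.intro K.a_group group_free_Abelian_group) (simp add: group_hom_axioms_def)
  have h_closed: "h c \<in> carrier K" if "Poly_Mapping.keys c \<subseteq> S" for c
    using h.hom_closed[of c] that by simp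
  have h_add: "h (c + d) = h c \<oplus>\<^bsub>K\<^esub> h d" if "Poly_Mapping.keys c \<subseteq> S" "Poly_Mapping.keys d \<subseteq> S" for c d
    using h.hom_mult[of c d] that by simp
  have h_diff: "h (c - d) = h c \<ominus>\<^bsub>K\<^esub> h d" if "Poly_Mapping.keys c \<subseteq> S" "Poly_Mapping.keys d \<subseteq> S" for c d
    using h_add[of c "- d"] h.hom_inv[of d] that by (simp add: a_minus_def a_inv_def)
  have h_zero: "h 0 = \<zero>\<^bsub>K\<^esub>" using h.hom_one by simp
  have h_N: "h c = \<zero>\<^bsub>K\<^esub>" if "c \<in> N" for c
    using that
  proof (induction rule: N_induct)
    case (rel c)
    have *: "k \<oplus>\<^bsub>K\<^esub> k' \<ominus>\<^bsub>K\<^esub> k \<ominus>\<^bsub>K\<^esub> k' = \<zero>\<^bsub>K\<^esub>" if "k \<in> carrier K" "k' \<in> carrier K" for k k'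
      using that by algebra
    note hom' = ring_hom_add[OF hom] ring_hom_mult[OF hom]
    from rel show ?case
    proof (cases rule: tensor_relations_cases)
      case 1
      then show ?thesis using l_closed
        by (simp add: h_diff order_trans[OF keys_diff] h f_def K.l_distr *)
    next
      case 2
      then show ?thesis using l_closed
        by (simp add: h_diff order_trans[OF keys_diff] h f_def K.r_distr l_add hom' *)
    next
      case 3
      then show ?thesis using l_closed
        by (simp add: h_diff order_trans[OF keys_diff] h f_def l_smult hom' K.m_assoc)
    qed
  next
    case (diff c d)
    then show ?case using N_subset by (simp add: h_diff)
  qed (rule h_zero)
  have h_scale: "h (scale k c) = k \<otimes>\<^bsub>K\<^esub> h c" if k: "k \<in> carrier K" and c: "Poly_Mapping.keys c \<subseteq> S" for k c
    using c
  proof (induction c rule: frag_induct)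
    case zero
    then show ?case using k by (simp add: h_zero)
  next
    case (diff x y)
    then show ?case using k h_closed
      by (simp add: h_diff keys_scale a_minus_def K.r_distr K.r_minus)
  next
    case (of k m)
    then show ?case using k l_closed by (simp add: h f_def K.m_assoc)
  qed
  \<comment> \<open>The choice of representative is harmless, since \<open>h\<close> vanishes on
    \<open>N\<close>.\<close>
  define L where "L v = h (SOME c. Poly_Mapping.keys c \<subseteq> S \<and> v = cl c)" for v
  have L: "L (cl c) = h c" if c: "Poly_Mapping.keys c \<subseteq> S" for c
  proof -
    define d where "d = (SOME d. Poly_Mapping.keys d \<subseteq> S \<and> cl c = cl d)"
    have d: "Poly_Mapping.keys d \<subseteq> S \<and> cl c = cl d" unfolding d_def by (rule someI[of _ c]) (simp add: c)
    then have "c - d \<in> N" by (simp add: cl_eq_iff)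
    then have "h c \<ominus>\<^bsub>K\<^esub> h d = \<zero>\<^bsub>K\<^esub>" using h_N[of "c - d"] h_diff c d by simp
    then have "h c = h d" using h_closed c d by simp
    then show ?thesis by (simp add: L_def d_def)
  qed
  show thesis
  proof (rule that[of L])
    fix v assume "v \<in> carrier V"
    then obtain c where c: "Poly_Mapping.keys c \<subseteq> S" "v = cl c" by (rule V_cases)
    show "L v \<in> carrier K" using c h_closed by (simp add: L)
    show "L (k \<odot>\<^bsub>V\<^esub> v) = k \<otimes>\<^bsub>K\<^esub> L v" if "k \<in> carrier K" for k
      using c that by (simp add: L smult_V keys_scale h_scale)
    fix w assume "w \<in> carrier V"
    then obtain d where d: "Poly_Mapping.keys d \<subseteq> S" "w = cl d" by (rule V_cases)
    show "L (v \<oplus>\<^bsub>V\<^esub> w) = L v \<oplus>\<^bsub>K\<^esub> L w"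
      using c d by (simp add: L add_V keys_add_closed h_add)
  next
    fix k m assume "k \<in> carrier K" "m \<in> carrier M"
    then show "L (tensor k m) = k \<otimes>\<^bsub>K\<^esub> \<phi> (l m)" by (simp add: tensor_def L h f_def)
  qed
qed

end

text \<open>Inverting \<open>s\<close>, the \<open>b i\<close> become a basis with dual basis \<open>l i / s\<close>.\<close>

lemma (in domain) has_rankI:
  fixes M :: "('a, 'c) module" and b :: "nat \<Rightarrow> 'c" and l :: "nat \<Rightarrow> 'c \<Rightarrow> 'a"
  assumes M: "module R M" and b: "\<And>i. i < n \<Longrightarrow> b i \<in> carrier M"
    and s: "s \<in> carrier R" "s \<noteq> \<zero>"
    and l_closed: "\<And>i m. i < n \<Longrightarrow> m \<in> carrier M \<Longrightarrow> l i m \<in> carrier R"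
    and l_add: "\<And>i m m'. i < n \<Longrightarrow> m \<in> carrier M \<Longrightarrow> m' \<in> carrier M \<Longrightarrow> l i (m \<oplus>\<^bsub>M\<^esub> m') = l i m \<oplus> l i m'"
    and l_smult: "\<And>i r m. i < n \<Longrightarrow> r \<in> carrier R \<Longrightarrow> m \<in> carrier M \<Longrightarrow> l i (r \<odot>\<^bsub>M\<^esub> m) = r \<otimes> l i m"
    and dual: "\<And>i j. i < n \<Longrightarrow> j < n \<Longrightarrow> l i (b j) = (if i = j then s else \<zero>)"
    and span: "\<And>m. m \<in> carrier M \<Longrightarrow> s \<odot>\<^bsub>M\<^esub> m \<in> LinearCombinations.module.span R M (b ` {..<n})"
  shows "has_rank R M n"
proof -
  let ?\<phi> = "\<lambda>a. frac a \<one>"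
  interpret K: field K by (rule field_frac_field)
  interpret M: module R M by (rule M)
  interpret E: scalar_extension R M K ?\<phi>
    by (intro scalar_extension.intro scalar_extension_axioms.intro M K.cring_axioms frac_hom)
  let ?V = "base_change R K ?\<phi> M"
  interpret V: vectorspace K ?V
    by (intro vectorspace.intro E.module_V field_frac_field)
  define t where "t = frac \<one> s"
  have t: "t \<in> carrier K" "t \<otimes>\<^bsub>K\<^esub> ?\<phi> s = \<one>\<^bsub>K\<^esub>"
    using s by (auto simp: t_def frac_mult frac_one frac_eq_iff)
  define c where "c i = E.tensor \<one>\<^bsub>K\<^esub> (b i)" for i
  define B where "B = c ` {..<n}"
  have c: "c i \<in> carrier ?V" if "i < n" for i using b that by (simp add: c_def)
  have B: "finite B" "B \<subseteq> carrier ?V" using c by (auto simp: B_def)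
  define W where "W = V.span B"
  have W: "submodule K W ?V" unfolding W_def by (rule V.span_is_submodule[OF B(2)])
  interpret W: submodule K W ?V by (rule W)
  \<comment> \<open>Collecting all m whose tensors fall into \<open>W\<close> gives a submodule over
    \<open>R\<close>. It contains the \<open>b i\<close>, hence their span, and this carries the
    spanning hypothesis over to \<open>K\<close>.\<close>
  define U where "U = {m \<in> carrier M. \<forall>k\<in>carrier K. E.tensor k m \<in> W}"
  have "submodule R U M"
  proof
    show "U \<subseteq> carrier M" by (auto simp: U_def)
    show "v \<oplus>\<^bsub>M\<^esub> w \<in> U" if "v \<in> U" "w \<in> U" for v w
      using that W.m_closed by (auto simp: U_def E.tensor_add_right)
    show "a \<odot>\<^bsub>M\<^esub> v \<in> U" if "a \<in> carrier R" "v \<in> U" for a v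
      using that by (auto simp: U_def E.tensor_smult_right)
    have "E.tensor k \<zero>\<^bsub>M\<^esub> \<in> W" if k: "k \<in> carrier K" for k
    proof -
      have "E.tensor k \<zero>\<^bsub>M\<^esub> = E.tensor k (\<zero> \<odot>\<^bsub>M\<^esub> \<zero>\<^bsub>M\<^esub>)" by simp
      also have "\<dots> = E.tensor (k \<otimes>\<^bsub>K\<^esub> \<zero>\<^bsub>K\<^esub>) \<zero>\<^bsub>M\<^esub>"
        using k by (subst E.tensor_smult_right) (simp_all add: frac_zero)
      also have "\<dots> = \<zero>\<^bsub>K\<^esub> \<odot>\<^bsub>?V\<^esub> E.tensor \<one>\<^bsub>K\<^esub> \<zero>\<^bsub>M\<^esub>"
        using k by (simp add: E.tensor_smult_left del: V.lmult_0)
      also have "\<dots> = \<zero>\<^bsub>?V\<^esub>" by (rule V.lmult_0) simp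
      finally show ?thesis using W.zero_closed by simp
    qed
    then show "\<zero>\<^bsub>M\<^esub> \<in> U" by (simp add: U_def)
  qed
  moreover have "b ` {..<n} \<subseteq> U"
  proof
    fix m assume "m \<in> b ` {..<n}"
    then obtain i where i: "i < n" "m = b i" by auto
    have "E.tensor k (b i) \<in> W" if k: "k \<in> carrier K" for k
    proof -
      have "c i \<in> W" using V.in_own_span[OF B(2)] i by (auto simp: W_def B_def)
      then have "k \<odot>\<^bsub>?V\<^esub> c i \<in> W" using k by simp
      then show ?thesis using k by (simp add: c_def E.tensor_smult_left)
    qed
    then show "m \<in> U" using i b by (simp add: U_def)
  qed
  ultimately have "M.span (b ` {..<n}) \<subseteq> U" by (intro M.span_is_subset)
  then have U: "s \<odot>\<^bsub>M\<^esub> m \<in> U" if "m \<in> carrier M" for m using span that by blast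
  have W_all: "W = carrier ?V"
  proof (rule E.submodule_eqI[OF W])
    fix k m assume km: "k \<in> carrier K" "m \<in> carrier M"
    \<comment> \<open>With t = 1/s, the tensor of k and m equals that of k t and s m.\<close>
    have "E.tensor (k \<otimes>\<^bsub>K\<^esub> t) (s \<odot>\<^bsub>M\<^esub> m) \<in> W" using U km t by (simp add: U_def)
    then show "E.tensor k m \<in> W" using km t s by (simp add: E.tensor_smult_right K.m_assoc)
  qed
  \<comment> \<open>\<open>L\<close> is a \<open>K\<close>-linear functional that is s on
    \<open>c i\<close> and zero on the other \<open>c j\<close>. It separates the
    \<open>c i\<close>, and applied to a vanishing combination it leaves the i-th coefficient times
    s.\<close>
  define dual_to where "dual_to i L \<longleftrightarrow> (\<forall>v\<in>carrier ?V. L v \<in> carrier K) \<and>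
     (\<forall>v\<in>carrier ?V. \<forall>w\<in>carrier ?V. L (v \<oplus>\<^bsub>?V\<^esub> w) = L v \<oplus>\<^bsub>K\<^esub> L w) \<and>
     (\<forall>k\<in>carrier K. \<forall>v\<in>carrier ?V. L (k \<odot>\<^bsub>?V\<^esub> v) = k \<otimes>\<^bsub>K\<^esub> L v) \<and>
     (\<forall>j<n. L (c j) = (if i = j then ?\<phi> s else \<zero>\<^bsub>K\<^esub>))" for i L
  have ex_L: "\<exists>L. dual_to i L" if i: "i < n" for i
  proof (rule E.extend_functional[of "l i"], erule l_closed[OF i], erule (1) l_add[OF i],
      erule (1) l_smult[OF i])
    fix L
    assume L: "\<And>v. v \<in> carrier ?V \<Longrightarrow> L v \<in> carrier K"
      "\<And>v w. v \<in> carrier ?V \<Longrightarrow> w \<in> carrier ?V \<Longrightarrow> L (v \<oplus>\<^bsub>?V\<^esub> w) = L v \<oplus>\<^bsub>K\<^esub> L w"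
      "\<And>k v. k \<in> carrier K \<Longrightarrow> v \<in> carrier ?V \<Longrightarrow> L (k \<odot>\<^bsub>?V\<^esub> v) = k \<otimes>\<^bsub>K\<^esub> L v"
      "\<And>k m. k \<in> carrier K \<Longrightarrow> m \<in> carrier M \<Longrightarrow> L (E.tensor k m) = k \<otimes>\<^bsub>K\<^esub> ?\<phi> (l i m)"
    have L_c: "L (c j) = (if i = j then ?\<phi> s else \<zero>\<^bsub>K\<^esub>)" if j: "j < n" for j
      using L(4)[OF K.one_closed b[OF j]] dual[OF i j] s by (simp add: c_def frac_zero)
    show ?thesis unfolding dual_to_def
      by (intro exI[of _ L] conjI ballI allI impI, erule L(1), erule (1) L(2), erule (1) L(3), erule L_c)
  qed
  have \<phi>s: "?\<phi> s \<in> carrier K" "?\<phi> s \<noteq> \<zero>\<^bsub>K\<^esub>" using s frac_hom_eq_0_iff by auto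
  have "inj_on c {..<n}"
  proof (rule inj_onI, rule ccontr)
    fix i j assume ij: "i \<in> {..<n}" "j \<in> {..<n}" "c i = c j" "i \<noteq> j"
    then obtain L where "dual_to i L" using ex_L by auto
    then have "\<And>j. j < n \<Longrightarrow> L (c j) = (if i = j then ?\<phi> s else \<zero>\<^bsub>K\<^esub>)"
      unfolding dual_to_def by blast
    from this[of i] this[of j] ij \<phi>s show False by simp
  qed
  then have card: "card B = n" by (simp add: B_def card_image)
  have "V.lin_indpt B"
  proof (rule V.finite_lin_indpt2[OF B], intro ballI)
    fix a v assume a: "a \<in> B \<rightarrow> carrier K" and lc: "V.lincomb a B = \<zero>\<^bsub>?V\<^esub>" and v: "v \<in> B"
    obtain i where i: "i < n" "v = c i" using v by (auto simp: B_def)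
    obtain L where "dual_to i L" using ex_L[OF i(1)] by blast
    then have L: "\<And>v. v \<in> carrier ?V \<Longrightarrow> L v \<in> carrier K"
      "\<And>v w. v \<in> carrier ?V \<Longrightarrow> w \<in> carrier ?V \<Longrightarrow> L (v \<oplus>\<^bsub>?V\<^esub> w) = L v \<oplus>\<^bsub>K\<^esub> L w"
      "\<And>k v. k \<in> carrier K \<Longrightarrow> v \<in> carrier ?V \<Longrightarrow> L (k \<odot>\<^bsub>?V\<^esub> v) = k \<otimes>\<^bsub>K\<^esub> L v"
      "\<And>j. j < n \<Longrightarrow> L (c j) = (if i = j then ?\<phi> s else \<zero>\<^bsub>K\<^esub>)"
      unfolding dual_to_def by simp_all
    have L0: "L \<zero>\<^bsub>?V\<^esub> = \<zero>\<^bsub>K\<^esub>" using L(3)[of "\<zero>\<^bsub>K\<^esub>" "\<zero>\<^bsub>?V\<^esub>"] L(1) by simp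
    have vanish: "L (V.lincomb a C) = \<zero>\<^bsub>K\<^esub>" if "finite C" "C \<subseteq> B - {v}" for C
      using that
    proof (induction C rule: finite_induct)
      case empty
      then show ?case by (simp add: V.lincomb_def L0)
    next
      case (insert w C)
      then obtain j where j: "j < n" "w = c j" "j \<noteq> i" using i by (auto simp: B_def)
      have C: "C \<subseteq> carrier ?V" "a \<in> C \<rightarrow> carrier K" "a w \<in> carrier K" using insert.prems B a by auto
      have "V.lincomb a (insert w C) = a w \<odot>\<^bsub>?V\<^esub> w \<oplus>\<^bsub>?V\<^esub> V.lincomb a C"
        using V.lincomb_insert[of C a w] insert.hyps C j c by auto
      then show ?case using insert.IH insert.prems C j c V.lincomb_closed[OF C(1,2)]
        by (simp add: L)
    qed
    have a_v: "a v \<in> carrier K" using a v by auto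
    have C: "B - {v} \<subseteq> carrier ?V" "a \<in> B - {v} \<rightarrow> carrier K" using B a by auto
    have "\<zero>\<^bsub>?V\<^esub> = a v \<odot>\<^bsub>?V\<^esub> v \<oplus>\<^bsub>?V\<^esub> V.lincomb a (B - {v})"
      using V.lincomb_del2[OF B a v] lc by simp
    then have "\<zero>\<^bsub>K\<^esub> = L (a v \<odot>\<^bsub>?V\<^esub> v \<oplus>\<^bsub>?V\<^esub> V.lincomb a (B - {v}))" using L0 by simp
    also have "\<dots> = a v \<otimes>\<^bsub>K\<^esub> ?\<phi> s"
      using a_v i c V.lincomb_closed[OF C] vanish[of "B - {v}"] B(1) \<phi>s by (simp add: L)
    finally show "a v = \<zero>\<^bsub>K\<^esub>" using a_v \<phi>s K.integral_iff by auto
  qed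
  then have "V.basis B" using B W_all by (simp add: V.basis_def W_def)
  then have "V.dim = n" using V.dim_basis[OF B(1)] card by simp
  moreover have "V.fin_dim" using B W_all unfolding V.fin_dim_def W_def by blast
  ultimately show ?thesis using V.vectorspace_axioms by (simp add: has_rank_def Let_def)
qed

section \<open>The ring \<open>A\<close> and the module \<open>E\<close>\<close>

lemma less_4: "i < 4 \<longleftrightarrow> i = 0 \<or> i = 1 \<or> i = 2 \<or> i = (3 :: nat)"
  by auto

lemma sum_less_4: "(\<Sum>i<4. f i) = f 0 + f 1 + f 2 + f (3 :: nat)"
  by (simp add: eval_nat_numeral)

context hypersurface
begin

abbreviation "F \<equiv> F_poly a e"
abbreviation "A \<equiv> A_ring a e"
abbreviation "cls \<equiv> A_class a e"

lemma mem_F_ideal: "f \<in> F_ideal a e \<longleftrightarrow> F dvd f"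
proof -
  have "F_ideal a e = cgenideal poly3_ring F"
    unfolding F_ideal_def by (rule cring.cgenideal_eq_genideal[symmetric]) (auto intro: class_cring.cring_axioms)
  then show ?thesis by (auto simp: cgenideal_def dvd_def mult.commute)
qed

lemma primeideal_F: "primeideal (F_ideal a e) poly3_ring"
proof (rule primeidealI)
  show "ideal (F_ideal a e) poly3_ring"
    unfolding F_ideal_def by (rule ring.genideal_ideal) (auto intro: class_ring.ring_axioms)
  show "carrier poly3_ring \<noteq> F_ideal a e"
    using F_prime mem_F_ideal[of 1] by (auto simp: prime_elem_def)
qed (use F_prime in \<open>auto simp: mem_F_ideal prime_elem_dvd_mult_iff intro: class_cring.cring_axioms\<close>)

sublocale I: primeideal "F_ideal a e" poly3_ring by (rule primeideal_F)

sublocale A: domain A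
  unfolding A_ring_def by (rule I.quotient_is_domain)

lemma cls_hom: "cls \<in> Ring.ring_hom poly3_ring A"
proof -
  have "cls = (+>\<^bsub>poly3_ring\<^esub>) (F_ideal a e)" by (simp add: A_class_def fun_eq_iff)
  then show ?thesis using I.rcos_ring_hom by (simp add: A_ring_def)
qed

lemma cls_add: "cls (f + g) = cls f \<oplus>\<^bsub>A\<^esub> cls g"
  and cls_mult: "cls (f * g) = cls f \<otimes>\<^bsub>A\<^esub> cls g"
  and cls_one: "cls 1 = \<one>\<^bsub>A\<^esub>"
  using ring_hom_add[OF cls_hom, of f g] ring_hom_mult[OF cls_hom, of f g] ring_hom_one[OF cls_hom]
  by simp_all

lemma cls_closed [simp]: "cls f \<in> carrier A"
  using ring_hom_closed[OF cls_hom, of f] by simp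

lemma carrier_A: "carrier A = range cls"
  by (auto simp: A_ring_def A_class_def FactRing_def A_RCOSETS_def')

lemma cls_zero: "cls 0 = \<zero>\<^bsub>A\<^esub>"
  using A.add.r_cancel_one[of "cls 0" "cls 0"] cls_add[of 0 0] by simp

lemma cls_eq_iff: "cls f = cls g \<longleftrightarrow> F dvd f - g"
proof -
  have "F dvd f - g \<longleftrightarrow> f \<in> F_ideal a e +>\<^bsub>poly3_ring\<^esub> g"
    using I.a_rcos_module_minus[OF class_ring.ring_axioms, of g f]
    by (simp add: mem_F_ideal class_ring_simps)
  also have "\<dots> \<longleftrightarrow> cls f = cls g"
    using I.a_repr_independence'[of f g] I.a_repr_independenceD[of f g] by (auto simp: A_class_def)
  finally show ?thesis ..
qed

lemma cls_eq_zero_iff: "cls f = \<zero>\<^bsub>A\<^esub> \<longleftrightarrow> F dvd f"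
  using cls_eq_iff[of f 0] by (simp add: cls_zero)

lemma cls_uminus: "cls (- f) = \<ominus>\<^bsub>A\<^esub> cls f"
  using cls_add[of "- f" f] by (intro A.minus_equality[symmetric]) (auto simp: cls_zero)

lemma cls_sum: "finite S \<Longrightarrow> (\<Oplus>\<^bsub>A\<^esub>i\<in>S. cls (f i)) = cls (\<Sum>i\<in>S. f i)"
  by (induction S rule: finite_induct) (auto simp: cls_zero cls_add)

end

section \<open>The matrix factorization as explicit maps on vectors\<close>

definition factor_map :: "'a :: comm_ring_1 \<Rightarrow> 'a \<Rightarrow> 'a \<Rightarrow> 'a \<Rightarrow> 'a \<Rightarrow> 'a \<Rightarrow> (nat \<Rightarrow> 'a) \<Rightarrow> nat \<Rightarrow> 'a" where
  "factor_map p1 q1 p2 q2 p3 q3 v i =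
     (if i = 0 then p1 * v 0 - q2 * v 1 - q3 * v 2
      else if i = 1 then p2 * v 0 + q1 * v 1 - q3 * v 3
      else if i = 2 then p3 * v 0 + q1 * v 2 + q2 * v 3
      else p3 * v 1 - p2 * v 2 + p1 * v 3)"

definition cofactor_map :: "'a :: comm_ring_1 \<Rightarrow> 'a \<Rightarrow> 'a \<Rightarrow> 'a \<Rightarrow> 'a \<Rightarrow> 'a \<Rightarrow> (nat \<Rightarrow> 'a) \<Rightarrow> nat \<Rightarrow> 'a" where
  "cofactor_map p1 q1 p2 q2 p3 q3 v i =
     (if i = 0 then q1 * v 0 + q2 * v 1 + q3 * v 2
      else if i = 1 then - p2 * v 0 + p1 * v 1 + q3 * v 3
      else if i = 2 then - p3 * v 0 + p1 * v 2 - q2 * v 3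
      else - p3 * v 1 + p2 * v 2 + q1 * v 3)"

text \<open>Up to signs and ordering this is the Koszul factorization of p1 q1 + p2 q2 + p3 q3, the
  tensor product of three factorizations of size one. The mixed terms cancel in pairs over any
  commutative ring.\<close>

lemma factor_cofactor:
  "i < 4 \<Longrightarrow> factor_map p1 q1 p2 q2 p3 q3 (cofactor_map p1 q1 p2 q2 p3 q3 v) i
     = (p1 * q1 + p2 * q2 + p3 * q3) * v i"
  by (auto simp: less_4 factor_map_def cofactor_map_def algebra_simps)

lemma cofactor_factor:
  "i < 4 \<Longrightarrow> cofactor_map p1 q1 p2 q2 p3 q3 (factor_map p1 q1 p2 q2 p3 q3 v) i
     = (p1 * q1 + p2 * q2 + p3 * q3) * v i"
  by (auto simp: less_4 factor_map_def cofactor_map_def algebra_simps)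

locale factorization = hypersurface +
  fixes \<theta> :: param
  assumes \<theta>: "\<theta> \<in> \<Theta>_min a e"
begin

abbreviation "p1 \<equiv> p\<^sub>1 a e \<theta>"
abbreviation "p2 \<equiv> p\<^sub>2 a e \<theta>"
abbreviation "p3 \<equiv> p\<^sub>3 a e \<theta>"
abbreviation "q1 \<equiv> q\<^sub>1 a e \<theta>"
abbreviation "q2 \<equiv> q\<^sub>2 a e \<theta>"
abbreviation "q3 \<equiv> q\<^sub>3 a e \<theta>"
abbreviation "phi \<equiv> factor_map p1 q1 p2 q2 p3 q3"
abbreviation "psi \<equiv> cofactor_map p1 q1 p2 q2 p3 q3"

lemma F_eq: "p1 * q1 + p2 * q2 + p3 * q3 = F"
proof -
  from \<theta> have r: "r_of \<theta> \<le> exp_N a e" "u_of \<theta> \<le> exp_x a" "v_of \<theta> \<le> exp_y a e" "w_of \<theta> \<le> exp_H a e"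
    "\<delta>_of \<theta> = 0 \<or> \<delta>_of \<theta> = 1" "l_of \<theta> \<le> exp_L a e"
    by (auto simp: \<Theta>_min_def param_range_def)
  have "p1 * q1 = y_var ^ exp_N a e" using r by (simp add: p\<^sub>1_def q\<^sub>1_def flip: power_add)
  moreover have "p2 * q2 = (x_var ^ u_of \<theta> * x_var ^ (exp_x a - u_of \<theta>)) *
      (y_var ^ v_of \<theta> * y_var ^ (exp_y a e - v_of \<theta>)) * (z_var ^ w_of \<theta> * z_var ^ (exp_H a e - w_of \<theta>))"
    by (simp only: p\<^sub>2_def q\<^sub>2_def mult_ac)
  then have "p2 * q2 = x_var ^ exp_x a * y_var ^ exp_y a e * z_var ^ exp_H a e"
    using r by (simp flip: power_add)
  moreover have "p3 * q3 = ((- 1) ^ \<delta>_of \<theta> * (- 1) ^ (1 - \<delta>_of \<theta>)) * (x_var ^ \<delta>_of \<theta> * x_var ^ (1 - \<delta>_of \<theta>)) *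
      (z_var ^ l_of \<theta> * z_var ^ (exp_L a e - l_of \<theta>))"
    by (simp only: p\<^sub>3_def q\<^sub>3_def mult_ac)
  \<comment> \<open>Exactly one of \<open>\<delta>_of \<theta>\<close> and 1 -
    \<open>\<delta>_of \<theta>\<close> is 1, so the two factors contribute one sign and one x in
    total.\<close>
  then have "p3 * q3 = - (x_var * z_var ^ exp_L a e)"
    using r by (auto simp flip: power_add)
  ultimately show ?thesis by (simp add: F_poly_def)
qed

lemmas phi_psi = factor_cofactor[of _ p1 q1 p2 q2 p3 q3, unfolded F_eq]
lemmas psi_phi = cofactor_factor[of _ p1 q1 p2 q2 p3 q3, unfolded F_eq]

lemma phi_linear: "phi (\<lambda>i. v i + w i) i = phi v i + phi w i" "phi (\<lambda>i. f * v i) i = f * phi v i"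
  "phi (\<lambda>i. v i - w i) i = phi v i - phi w i"
  by (auto simp: factor_map_def algebra_simps)

lemma psi_linear: "psi (\<lambda>i. v i + w i) i = psi v i + psi w i" "psi (\<lambda>i. f * v i) i = f * psi v i"
  "psi (\<lambda>i. v i - w i) i = psi v i - psi w i"
  by (auto simp: cofactor_map_def algebra_simps)

lemma phi_cong: "(\<And>j. j < 4 \<Longrightarrow> v j = w j) \<Longrightarrow> phi v = phi w"
  by (auto simp: factor_map_def)

lemma psi_cong: "(\<And>j. j < 4 \<Longrightarrow> v j = w j) \<Longrightarrow> psi v = psi w"
  by (auto simp: cofactor_map_def)

lemma dim_\<Phi>: "dim_row (\<Phi> a e \<theta>) = 4" "dim_col (\<Phi> a e \<theta>) = 4"
  by (simp_all add: \<Phi>_def mat_of_rows_list_def)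

lemma sum_\<Phi>: "i < 4 \<Longrightarrow> (\<Sum>j<4. \<Phi> a e \<theta> $$ (i, j) * v j) = phi v i"
  by (auto simp: sum_less_4 less_4 \<Phi>_def mat_of_rows_list_def factor_map_def)

section \<open>Vectors over \<open>A\<close> and the cokernel in terms of polynomial
  representatives\<close>

abbreviation "A4 \<equiv> LinearCombinations.ring.func_space A {..<4 :: nat}"
abbreviation "E \<equiv> E_mod a e \<theta>"

sublocale A4: module A A4 by (rule A.func_space_is_module)

text \<open>Represents vectors over \<open>A\<close> by functions on all naturals with polynomial
  values. Values from index 4 on are discarded, so later statements compare vectors at i < 4
  only.\<close>

definition vec_cls :: "(nat \<Rightarrow> poly3) \<Rightarrow> nat \<Rightarrow> poly3 set" where
  "vec_cls v = restrict (\<lambda>i. cls (v i)) {..<4}"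

lemma vec_cls_closed [simp]: "vec_cls v \<in> carrier A4"
  by (auto simp: vec_cls_def A.func_space_def)

lemma carrier_A4: "carrier A4 = range vec_cls"
proof (intro equalityI subsetI)
  fix w assume w: "w \<in> carrier A4"
  then have "\<forall>i. \<exists>f. i < 4 \<longrightarrow> w i = cls f" by (auto simp: A.func_space_def carrier_A PiE_def Pi_def)
  then obtain v where "\<And>i. i < 4 \<Longrightarrow> w i = cls (v i)" by metis
  then have "w = vec_cls v" using w by (auto simp: A.func_space_def vec_cls_def PiE_def extensional_def restrict_def fun_eq_iff)
  then show "w \<in> range vec_cls" by simp
qed auto

lemma vec_cls_add: "vec_cls v \<oplus>\<^bsub>A4\<^esub> vec_cls w = vec_cls (\<lambda>i. v i + w i)"
  by (auto simp: A.func_space_def vec_cls_def restrict_def fun_eq_iff cls_add)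

lemma vec_cls_smult: "cls f \<odot>\<^bsub>A4\<^esub> vec_cls v = vec_cls (\<lambda>i. f * v i)"
  by (auto simp: A.func_space_def vec_cls_def restrict_def fun_eq_iff cls_mult)

lemma vec_cls_zero: "\<zero>\<^bsub>A4\<^esub> = vec_cls (\<lambda>i. 0)"
  by (auto simp: A.func_space_def vec_cls_def restrict_def fun_eq_iff cls_zero)

lemma vec_cls_eq_iff: "vec_cls v = vec_cls w \<longleftrightarrow> (\<forall>i<4. F dvd v i - w i)"
proof -
  have "vec_cls v = vec_cls w \<longleftrightarrow> (\<forall>i<4. cls (v i) = cls (w i))"
    by (auto simp: vec_cls_def fun_eq_iff restrict_def)
  then show ?thesis by (simp add: cls_eq_iff)
qed

lemma mat_map_\<Phi>: "mat_map A (map_mat cls (\<Phi> a e \<theta>)) (vec_cls u) = vec_cls (phi u)"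
proof -
  have "(\<Oplus>\<^bsub>A\<^esub>j\<in>{..<4}. map_mat cls (\<Phi> a e \<theta>) $$ (i, j) \<otimes>\<^bsub>A\<^esub> vec_cls u j) = cls (phi u i)" if i: "i < 4" for i
  proof -
    have "(\<Oplus>\<^bsub>A\<^esub>j\<in>{..<4}. map_mat cls (\<Phi> a e \<theta>) $$ (i, j) \<otimes>\<^bsub>A\<^esub> vec_cls u j)
        = (\<Oplus>\<^bsub>A\<^esub>j\<in>{..<4}. cls (\<Phi> a e \<theta> $$ (i, j) * u j))"
      using i by (intro A.finsum_cong') (auto simp: dim_\<Phi> vec_cls_def cls_mult)
    also have "\<dots> = cls (phi u i)" using i by (simp only: cls_sum finite_lessThan sum_\<Phi>)
    finally show ?thesis .
  qed
  then show ?thesis by (simp add: mat_map_def vec_cls_def[of "phi u"] dim_\<Phi> restrict_def fun_eq_iff)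
qed

definition im_phi :: "(nat \<Rightarrow> poly3 set) set" where "im_phi = range (\<lambda>u. vec_cls (phi u))"

lemma E_eq: "E = quot_module A4 im_phi"
proof -
  have "mat_map A (map_mat cls (\<Phi> a e \<theta>)) ` carrier A4 = im_phi"
    by (simp only: carrier_A4 im_phi_def image_image mat_map_\<Phi>)
  then show ?thesis by (simp add: E_mod_def coker_def dim_\<Phi>)
qed

text \<open>The multiples of \<open>F\<close> in the relations are absorbed by \<open>F = \<Phi> \<Psi>\<close>.\<close>

lemma vec_cls_in_im_phi: "vec_cls v \<in> im_phi \<longleftrightarrow> (\<exists>u. \<forall>i<4. v i = phi u i)"
proof
  assume "vec_cls v \<in> im_phi"
  then obtain u where "\<forall>i<4. F dvd v i - phi u i" by (auto simp: im_phi_def vec_cls_eq_iff)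
  then have "\<forall>i. \<exists>t. i < 4 \<longrightarrow> v i - phi u i = F * t" by (auto simp: dvd_def)
  then obtain t where t: "\<And>i. i < 4 \<Longrightarrow> v i - phi u i = F * t i" by metis
  have "v i = phi (\<lambda>i. u i + psi t i) i" if "i < 4" for i
    using t[OF that] phi_psi[OF that, of t] by (simp add: phi_linear algebra_simps)
  then show "\<exists>u. \<forall>i<4. v i = phi u i" by blast
next
  assume "\<exists>u. \<forall>i<4. v i = phi u i"
  then obtain u where "\<forall>i<4. v i = phi u i" by blast
  then have "vec_cls v = vec_cls (phi u)" by (simp add: vec_cls_eq_iff)
  then show "vec_cls v \<in> im_phi" by (simp add: im_phi_def)
qed

sublocale Q: module_quotient A im_phi A4
proof (intro module_quotient.intro submodule.intro A4.module_axioms)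
  show "im_phi \<subseteq> carrier A4" by (auto simp: im_phi_def)
  show "\<zero>\<^bsub>A4\<^esub> \<in> im_phi"
    by (auto simp: vec_cls_zero vec_cls_in_im_phi factor_map_def intro!: exI[of _ "\<lambda>_. 0"])
  show "v \<oplus>\<^bsub>A4\<^esub> w \<in> im_phi" if "v \<in> im_phi" "w \<in> im_phi" for v w
    using that by (auto simp: im_phi_def vec_cls_add phi_linear(1)[symmetric])
  show "c \<odot>\<^bsub>A4\<^esub> v \<in> im_phi" if "c \<in> carrier A" "v \<in> im_phi" for c v
    using that by (auto simp: im_phi_def carrier_A vec_cls_smult phi_linear(2)[symmetric])
qed

sublocale E: module A E
  unfolding E_eq by (rule Q.module_quot)

definition pr :: "(nat \<Rightarrow> poly3) \<Rightarrow> (nat \<Rightarrow> poly3 set) set" where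
  "pr v = im_phi +>\<^bsub>A4\<^esub> vec_cls v"

lemma carrier_E: "carrier E = range pr"
  by (simp only: E_eq Q.quot_carrier carrier_A4 image_image pr_def[abs_def])

lemma pr_closed [simp]: "pr v \<in> carrier E"
  by (simp add: carrier_E)

lemma pr_add: "pr v \<oplus>\<^bsub>E\<^esub> pr w = pr (\<lambda>i. v i + w i)"
  by (simp add: E_eq pr_def Q.quot_add vec_cls_add)

lemma pr_smult: "cls f \<odot>\<^bsub>E\<^esub> pr v = pr (\<lambda>i. f * v i)"
  by (simp add: E_eq pr_def Q.quot_smult vec_cls_smult)

lemma pr_zero: "\<zero>\<^bsub>E\<^esub> = pr (\<lambda>i. 0)"
  by (simp add: E_eq pr_def Q.quot_zero vec_cls_zero)

lemma vec_cls_minus: "vec_cls v \<ominus>\<^bsub>A4\<^esub> vec_cls w = vec_cls (\<lambda>i. v i - w i)"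
proof -
  have "vec_cls (\<lambda>i. - w i) \<oplus>\<^bsub>A4\<^esub> vec_cls w = \<zero>\<^bsub>A4\<^esub>" by (simp add: vec_cls_add vec_cls_zero)
  then have "\<ominus>\<^bsub>A4\<^esub> vec_cls w = vec_cls (\<lambda>i. - w i)" by (rule A4.minus_equality) auto
  then show ?thesis by (simp add: a_minus_def vec_cls_add)
qed

text \<open>The equation holds over the polynomial ring itself, with no remainder modulo
  \<open>F\<close>. All arguments about \<open>E\<close> thereby become statements about polynomial
  vectors.\<close>

lemma pr_eq_iff: "pr v = pr w \<longleftrightarrow> (\<exists>u. \<forall>i<4. v i - w i = phi u i)"
  by (simp add: pr_def Q.coset_eq_iff vec_cls_minus vec_cls_in_im_phi)

lemma pr_eq_zero_iff: "pr v = \<zero>\<^bsub>E\<^esub> \<longleftrightarrow> (\<exists>u. \<forall>i<4. v i = phi u i)"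
  using pr_eq_iff[of v "\<lambda>i. 0"] by (simp add: pr_zero)

lemma pr_cong: "(\<And>i. i < 4 \<Longrightarrow> v i = w i) \<Longrightarrow> pr v = pr w"
  unfolding pr_eq_iff by (rule exI[of _ "\<lambda>_. 0"]) (simp add: factor_map_def)

definition unit :: "nat \<Rightarrow> nat \<Rightarrow> poly3" where "unit j i = (if i = j then 1 else 0)"

end

section \<open>Evaluation at the point x = s, z = t, y = u, and the number of generators\<close>

definition evp :: "complex \<Rightarrow> complex \<Rightarrow> complex \<Rightarrow> poly3 \<Rightarrow> complex" where
  "evp s t u f = poly (poly (poly f [:[:u:]:]) [:t:]) s"

lemma evp_simps [simp]: "evp s t u 0 = 0" "evp s t u 1 = 1" "evp s t u (f + g) = evp s t u f + evp s t u g"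
  "evp s t u (f - g) = evp s t u f - evp s t u g" "evp s t u (f * g) = evp s t u f * evp s t u g"
  "evp s t u (- f) = - evp s t u f"
  "evp s t u x_var = s" "evp s t u z_var = t" "evp s t u y_var = u" "evp s t u (cst c) = c"
  by (simp_all add: evp_def x_var_def y_var_def z_var_def cst_def)

lemma evp_sum: "evp s t u (\<Sum>i\<in>I. f i) = (\<Sum>i\<in>I. evp s t u (f i))"
  by (induction I rule: infinite_finite_induct) simp_all

lemma xyz_ideal_evp: "f \<in> xyz_ideal \<Longrightarrow> evp 0 0 0 f = 0"
proof -
  have "ideal {f. evp 0 0 0 f = 0} poly3_ring"
  proof (rule idealI)
    show "ring poly3_ring" by (rule class_ring.ring_axioms)
    show "subgroup {f. evp 0 0 0 f = 0} (add_monoid poly3_ring)"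
    proof (rule group.subgroupI)
      show "group (add_monoid poly3_ring)" using class_ring.a_group by simp
      show "inv\<^bsub>add_monoid poly3_ring\<^esub> f \<in> {f. evp 0 0 0 f = 0}" if "f \<in> {f. evp 0 0 0 f = 0}" for f
      proof -
        have "\<ominus>\<^bsub>poly3_ring\<^esub> f = - f" by (simp only: class_ring_simps)
        then show ?thesis using that unfolding a_inv_def by simp
      qed
    qed (auto intro: exI[of _ 0])
  qed auto
  then have "xyz_ideal \<subseteq> {f. evp 0 0 0 f = 0}"
    unfolding xyz_ideal_def by (rule ring.genideal_minimal[OF class_ring.ring_axioms]) simp
  then show "f \<in> xyz_ideal \<Longrightarrow> evp 0 0 0 f = 0" by blast
qed

context factorization
begin

text \<open>The candidate for a hyperplane in \<open>E\<close>: classes having a representative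
  whose value at a point is killed by the row vector \<open>lam\<close>. It is a submodule for every
  \<open>lam\<close>; if \<open>lam\<close> kills \<open>\<Phi>\<close> at the point, membership can
  be tested on any representative, so a nonzero \<open>lam\<close> gives a proper submodule.\<close>

definition ker_functional :: "(nat \<Rightarrow> complex) \<Rightarrow> (poly3 \<Rightarrow> complex) \<Rightarrow> (nat \<Rightarrow> poly3 set) set set" where
  "ker_functional lam ev = pr ` {v. (\<Sum>i<4. lam i * ev (v i)) = 0}"

lemma ker_functional_mem_iff:
  assumes "\<And>w. (\<Sum>i<4. lam i * evp s t u (phi w i)) = 0"
  shows "pr v \<in> ker_functional lam (evp s t u) \<longleftrightarrow> (\<Sum>i<4. lam i * evp s t u (v i)) = 0"
proof
  assume "pr v \<in> ker_functional lam (evp s t u)"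
  then obtain v' where v': "pr v = pr v'" "(\<Sum>i<4. lam i * evp s t u (v' i)) = 0"
    by (auto simp: ker_functional_def)
  then obtain w where w: "\<forall>i<4. v i - v' i = phi w i" by (auto simp: pr_eq_iff)
  have "(\<Sum>i<4. lam i * evp s t u (v i)) = (\<Sum>i<4. lam i * evp s t u (v i - v' i))"
    using v'(2) by (simp add: right_diff_distrib sum_subtractf)
  also have "\<dots> = (\<Sum>i<4. lam i * evp s t u (phi w i))" using w by (intro sum.cong) auto
  finally show "(\<Sum>i<4. lam i * evp s t u (v i)) = 0" using assms by simp
qed (auto simp: ker_functional_def)

lemma ker_functional_submodule:
  "submodule A (ker_functional lam (evp s t u)) E"
proof
  show "\<zero>\<^bsub>E\<^esub> \<in> ker_functional lam (evp s t u)"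
    unfolding pr_zero ker_functional_def by (intro imageI) simp
  show "ker_functional lam (evp s t u) \<subseteq> carrier E" by (auto simp: ker_functional_def)
  show "X \<oplus>\<^bsub>E\<^esub> Y \<in> ker_functional lam (evp s t u)"
    if XY: "X \<in> ker_functional lam (evp s t u)" "Y \<in> ker_functional lam (evp s t u)" for X Y
  proof -
    obtain v w where vw: "X = pr v" "Y = pr w" "(\<Sum>i<4. lam i * evp s t u (v i)) = 0"
      "(\<Sum>i<4. lam i * evp s t u (w i)) = 0" using XY by (auto simp: ker_functional_def)
    then have "(\<Sum>i<4. lam i * evp s t u (v i + w i)) = 0" by (simp add: distrib_left sum.distrib)
    then show ?thesis unfolding vw pr_add ker_functional_def by (intro imageI) simp
  qed
  show "c \<odot>\<^bsub>E\<^esub> X \<in> ker_functional lam (evp s t u)"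
    if c: "c \<in> carrier A" and X: "X \<in> ker_functional lam (evp s t u)" for c X
  proof -
    obtain v where v: "X = pr v" "(\<Sum>i<4. lam i * evp s t u (v i)) = 0"
      using X by (auto simp: ker_functional_def)
    obtain f where f: "c = cls f" using c by (auto simp: carrier_A)
    have "(\<Sum>i<4. lam i * evp s t u (f * v i)) = evp s t u f * (\<Sum>i<4. lam i * evp s t u (v i))"
      by (simp add: sum_distrib_left ac_simps)
    then show ?thesis using v(2) unfolding v f pr_smult ker_functional_def by (intro imageI) simp
  qed
qed

lemma functional_unit: "j < 4 \<Longrightarrow> (\<Sum>i<4. lam i * evp s t u (unit j i)) = lam j"
  by (auto simp: sum_less_4 less_4 unit_def)

lemma entries_vanish:
  "evp 0 0 0 p1 = 0" "evp 0 0 0 q1 = 0" "evp 0 0 0 p2 = 0" "evp 0 0 0 q2 = 0" "evp 0 0 0 p3 = 0"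
  "evp 0 0 0 q3 = 0"
  using \<theta> by (auto simp: \<Theta>_min_def intro: xyz_ideal_evp)

lemma phi_vanish: "evp 0 0 0 (phi w i) = 0"
  by (simp add: factor_map_def entries_vanish)

lemma unit_expansion: "pr v = cls (v 0) \<odot>\<^bsub>E\<^esub> pr (unit 0) \<oplus>\<^bsub>E\<^esub> (cls (v 1) \<odot>\<^bsub>E\<^esub> pr (unit 1)
    \<oplus>\<^bsub>E\<^esub> (cls (v 2) \<odot>\<^bsub>E\<^esub> pr (unit 2) \<oplus>\<^bsub>E\<^esub> cls (v 3) \<odot>\<^bsub>E\<^esub> pr (unit 3)))"
  unfolding pr_smult pr_add by (rule pr_cong) (auto simp: less_4 unit_def)

lemma units_generate: "E.span (pr ` unit ` {..<4}) = carrier E"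
proof
  let ?B = "pr ` unit ` {..<4}"
  have B: "?B \<subseteq> carrier E" by auto
  interpret W: submodule A "E.span ?B" E by (rule E.span_is_submodule[OF B])
  show "E.span ?B \<subseteq> carrier E" by (rule W.subset)
  have unit: "pr (unit j) \<in> E.span ?B" if "j < 4" for j using E.in_own_span[OF B] that by auto
  show "carrier E \<subseteq> E.span ?B"
  proof
    fix X assume "X \<in> carrier E"
    then obtain v where X: "X = pr v" by (auto simp: carrier_E)
    show "X \<in> E.span ?B"
      unfolding X unit_expansion[of v] by (intro W.m_closed W.smult_closed cls_closed unit) simp_all
  qed
qed

lemma finitely_generated_E: "finitely_generated A E"
  unfolding finitely_generated_def
proof (intro exI conjI)
  show "E.span (pr ` unit ` {..<4}) = carrier E" by (rule units_generate)
qed auto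

text \<open>Equal classes would differ by an element of the image of \<open>\<Phi>\<close>, all of
  whose coordinates vanish at the origin.\<close>

lemma card_units: "card (pr ` unit ` {..<4}) = 4"
proof -
  have "inj_on (\<lambda>j. pr (unit j)) {..<4}"
  proof (rule inj_onI, rule ccontr)
    fix i j :: nat assume ij: "i \<in> {..<4}" "j \<in> {..<4}" "pr (unit i) = pr (unit j)" "i \<noteq> j"
    then obtain w where "unit i i - unit j i = phi w i" by (auto simp: pr_eq_iff)
    then have "evp 0 0 0 (unit i i - unit j i) = 0" by (simp add: phi_vanish)
    then show False using ij by (simp add: unit_def)
  qed
  then show ?thesis by (simp add: image_image card_image)
qed

text \<open>Fewer than four vectors of values at the origin are killed by a common nonzero row
  vector. As \<open>\<Phi>\<close> vanishes there, this row vector cuts out a proper submodule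
  containing all the generators.\<close>

lemma generators_at_least_4:
  assumes B: "finite B" "B \<subseteq> carrier E" "E.span B = carrier E"
  shows "4 \<le> card B"
proof (rule ccontr)
  assume "\<not> 4 \<le> card B"
  then have card: "card B < card {..<4 :: nat}" by simp
  define rep where "rep = inv_into UNIV pr"
  have rep: "pr (rep X) = X" if "X \<in> B" for X
    using subsetD[OF B(2) that] unfolding rep_def carrier_E by (rule f_inv_into_f)
  from homogeneous_system[OF finite_lessThan B(1) card, of "\<lambda>i X. evp 0 0 0 (rep X i)"]
  obtain c where "(\<exists>i\<in>{..<4}. c i \<noteq> 0) \<and> (\<forall>X\<in>B. (\<Sum>i<4. c i * evp 0 0 0 (rep X i)) = 0)"
    by (elim exE) (rule that)
  note c = this[THEN conjunct1] this[THEN conjunct2]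
  have "B \<subseteq> ker_functional c (evp 0 0 0)"
  proof
    fix X assume X: "X \<in> B"
    have "pr (rep X) \<in> ker_functional c (evp 0 0 0)"
      unfolding ker_functional_def using c(2) X by blast
    then show "X \<in> ker_functional c (evp 0 0 0)" by (simp only: rep[OF X])
  qed
  from E.span_is_subset[OF this ker_functional_submodule]
  have all: "pr v \<in> ker_functional c (evp 0 0 0)" for v using B(3) by auto
  have "(\<Sum>i<4. c i * evp 0 0 0 (unit j i)) = 0" for j
    using all[of "unit j"] by (subst (asm) ker_functional_mem_iff) (simp_all add: phi_vanish)
  then have "c j = 0" if "j < 4" for j using functional_unit[OF that, of c 0 0 0] by simp
  then show False using c(1) by auto
qed

lemma minimally_generated_E: "minimally_generated_by A E 4"
  unfolding minimally_generated_by_def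
proof (intro conjI exI allI impI)
  show "card (pr ` unit ` {..<4}) = 4" by (rule card_units)
  show "E.span (pr ` unit ` {..<4}) = carrier E" by (rule units_generate)
  show "4 \<le> card B" if "finite B \<and> B \<subseteq> carrier E \<and> E.span B = carrier E" for B
    using that generators_at_least_4 by blast
qed auto

section \<open>The rank\<close>

lemma p1_nonzero: "cls p1 \<noteq> \<zero>\<^bsub>A\<^esub>"
proof
  assume "cls p1 = \<zero>\<^bsub>A\<^esub>"
  then have "F dvd y_var ^ r_of \<theta>" by (simp add: cls_eq_zero_iff p\<^sub>1_def)
  moreover have "y_var ^ r_of \<theta> = monom 1 (r_of \<theta>)" by (simp add: y_var_def monom_altdef)
  ultimately have "degree F \<le> r_of \<theta>"
    using dvd_imp_degree_le[of F "monom 1 (r_of \<theta>)"] by (simp add: degree_monom_eq)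
  then show False using \<theta> exponent_bounds by (auto simp: degree_F \<Theta>_min_def param_range_def)
qed

text \<open>Modulo the relations, rows 2 and 3 of \<open>\<Psi>\<close> are \<open>p\<^sub>1\<close> times the coordinates with respect to
  the second and third generator.\<close>

lemma has_rank_E: "has_rank A E 2"
proof -
  define rep where "rep = inv_into UNIV pr"
  have rep: "pr (rep X) = X" if "X \<in> carrier E" for X
    using that unfolding rep_def carrier_E by (rule f_inv_into_f)
  \<comment> \<open>Defined through a chosen representative. Another choice changes
    \<open>psi\<close> by \<open>psi\<close> of \<open>phi w\<close>, which is a multiple of
    \<open>F\<close> and so vanishes in \<open>A\<close>.\<close>
  define l where "l i X = cls (psi (rep X) (Suc i))" for i X
  have l_pr: "l i (pr v) = cls (psi v (Suc i))" if i: "i < 2" for i v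
  proof -
    have "pr (rep (pr v)) = pr v" by (rule rep) simp
    then obtain w where w: "\<forall>j<4. rep (pr v) j - v j = phi w j" by (auto simp: pr_eq_iff)
    have "psi (rep (pr v)) (Suc i) - psi v (Suc i) = psi (\<lambda>j. rep (pr v) j - v j) (Suc i)"
      by (simp add: psi_linear)
    also have "\<dots> = psi (phi w) (Suc i)" using w by (subst psi_cong[of _ "phi w"]) auto
    also have "\<dots> = F * w (Suc i)" using i by (simp add: psi_phi)
    finally show ?thesis by (simp add: l_def cls_eq_iff)
  qed
  show ?thesis
  proof (rule A.has_rankI[where b = "\<lambda>i. pr (unit (Suc i))" and l = l and s = "cls p1"])
    show "module A E" by (rule E.module_axioms)
    show "cls p1 \<noteq> \<zero>\<^bsub>A\<^esub>" by (rule p1_nonzero)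
  next
    fix i :: nat and X Y assume i: "i < 2" and X: "X \<in> carrier E" and Y: "Y \<in> carrier E"
    then obtain v w where "X = pr v" "Y = pr w" by (auto simp: carrier_E)
    then show "l i (X \<oplus>\<^bsub>E\<^esub> Y) = l i X \<oplus>\<^bsub>A\<^esub> l i Y"
      by (simp add: pr_add l_pr[OF i] psi_linear cls_add)
  next
    fix i :: nat and c X assume i: "i < 2" and c: "c \<in> carrier A" and X: "X \<in> carrier E"
    then obtain f v where "X = pr v" "c = cls f" by (auto simp: carrier_E carrier_A)
    then show "l i (c \<odot>\<^bsub>E\<^esub> X) = c \<otimes>\<^bsub>A\<^esub> l i X"
      by (simp add: pr_smult l_pr[OF i] psi_linear cls_mult)
  next
    fix i j :: nat assume "i < 2" "j < 2"
    then show "l i (pr (unit (Suc j))) = (if i = j then cls p1 else \<zero>\<^bsub>A\<^esub>)"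
      by (auto simp: l_pr less_2_cases_iff cofactor_map_def unit_def cls_zero)
  next
    fix X assume "X \<in> carrier E"
    then obtain v where X: "X = pr v" by (auto simp: carrier_E)
    let ?B = "(\<lambda>i. pr (unit (Suc i))) ` {..<2}"
    have B: "?B \<subseteq> carrier E" by auto
    interpret W: submodule A "E.span ?B" E by (rule E.span_is_submodule[OF B])
    have unit: "pr (unit (Suc 0)) \<in> E.span ?B" "pr (unit (Suc 1)) \<in> E.span ?B"
      using E.in_own_span[OF B] by auto
    \<comment> \<open>The difference of the two sides is \<open>phi\<close> of (v0, 0, 0, v3): the
      first and last columns of \<open>\<Phi>\<close>, with p1 at the top of one and at the bottom
      of the other, remove the outer coordinates.\<close>
    have "cls p1 \<odot>\<^bsub>E\<^esub> X = cls (psi v 1) \<odot>\<^bsub>E\<^esub> pr (unit (Suc 0)) \<oplus>\<^bsub>E\<^esub> cls (psi v 2) \<odot>\<^bsub>E\<^esub> pr (unit (Suc 1))"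
      unfolding X pr_smult pr_add pr_eq_iff
      by (rule exI[of _ "\<lambda>i. if i = 0 then v 0 else if i = 3 then v 3 else 0"])
         (auto simp: less_4 unit_def factor_map_def cofactor_map_def)
    also have "\<dots> \<in> E.span ?B" using unit by (auto intro!: W.m_closed W.smult_closed)
    finally show "cls p1 \<odot>\<^bsub>E\<^esub> X \<in> E.span ?B" .
  qed (auto simp: l_def)
qed

end

section \<open>Dimension and depth\<close>

lemma map_poly_hom_mult:
  assumes "h 0 = 0" "\<And>c d. h (c + d) = h c + h d" "\<And>c d. h (c * d) = h c * h d"
  shows "map_poly h (p * q) = map_poly h p * map_poly h q"
proof (induction p)
  case (pCons c p)
  have add: "map_poly h (r + s) = map_poly h r + map_poly h s" for r s
    by (rule poly_eqI) (simp add: coeff_map_poly assms)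
  have smult: "map_poly h (smult b r) = smult (h b) (map_poly h r)" for b r
    by (rule poly_eqI) (simp add: coeff_map_poly assms)
  show ?case using pCons.IH by (simp add: add smult map_poly_pCons assms)
qed simp

lemma map_poly_hom_add:
  assumes "h 0 = 0" "\<And>c d. h (c + d) = h c + h d"
  shows "map_poly h (p + q) = map_poly h p + map_poly h q"
  by (rule poly_eqI) (simp add: coeff_map_poly assms)

text \<open>Restriction to the line \<open>x = s, z = t\<close>.\<close>

definition on_line :: "complex \<Rightarrow> complex \<Rightarrow> poly3 \<Rightarrow> complex poly" where
  "on_line s t = map_poly (\<lambda>c. poly (poly c [:t:]) s)"

lemma on_line_simps [simp]:
  "on_line s t (f + g) = on_line s t f + on_line s t g"
  "on_line s t (f * g) = on_line s t f * on_line s t g"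
  "on_line s t (x_var - cst s) = 0" "on_line s t (z_var - cst t) = 0"
  by (simp_all add: on_line_def map_poly_hom_add map_poly_hom_mult x_var_def z_var_def cst_def map_poly_pCons)

lemma on_line_diff: "on_line s t (f - g) = on_line s t f - on_line s t g"
  using on_line_simps(1)[of s t "f - g" g] by (simp del: on_line_simps add: algebra_simps)

lemma line_vars: "x_var - cst s = [:[:[:- s, 1:]:]:]" "z_var - cst t = [:[:- [:t:], 1:]:]"
  by (simp_all add: x_var_def z_var_def cst_def)

lemma synthetic_div_ex: "\<exists>q. p = [:- c, 1:] * q + [:poly p c:]" for p :: "'a :: comm_ring_1 poly"
  using synthetic_div_correct'[of c p] by metis

text \<open>The kernel of restriction is generated by z - t and x - s: each coefficient is divided
  by z - t, and the remainder, a polynomial in x vanishing at s, by x - s.\<close>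

lemma on_line_eq_0D:
  assumes "on_line s t f = 0"
  shows "\<exists>g h. f = (z_var - cst t) * g + (x_var - cst s) * h"
  using assms
proof (induction f)
  case 0
  show ?case by (intro exI[of _ 0]) simp
next
  case (pCons c f)
  have "pCons (poly (poly c [:t:]) s) (on_line s t f) = 0"
    using pCons.prems by (simp add: on_line_def map_poly_pCons)
  then have c: "poly (poly c [:t:]) s = 0" and f: "on_line s t f = 0" by simp_all
  obtain b where b: "c = [:- [:t:], 1:] * b + [:poly c [:t:]:]" using synthetic_div_ex by blast
  obtain k where k: "poly c [:t:] = [:- s, 1:] * k" using synthetic_div_ex[of "poly c [:t:]" s] c by auto
  obtain g h where gh: "f = (z_var - cst t) * g + (x_var - cst s) * h" using pCons.IH f by blast
  have "pCons c f = (z_var - cst t) * pCons b g + (x_var - cst s) * pCons [:k:] h"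
    using gh b k unfolding line_vars by simp
  then show ?case by blast
qed

text \<open>Division by y - u, then z - t, then x - s leaves the value at the point as the final
  remainder.\<close>

lemma point_expansion:
  "\<exists>g h k. f = (y_var - cst u) * g + (z_var - cst t) * h + (x_var - cst s) * k + cst (evp s t u f)"
proof -
  obtain g where g: "f = [:- [:[:u:]:], 1:] * g + [:poly f [:[:u:]:]:]" using synthetic_div_ex by blast
  define f' where "f' = poly f [:[:u:]:]"
  obtain b where b: "f' = [:- [:t:], 1:] * b + [:poly f' [:t:]:]" using synthetic_div_ex by blast
  define f'' where "f'' = poly f' [:t:]"
  obtain k where k: "f'' = [:- s, 1:] * k + [:poly f'' s:]" using synthetic_div_ex by blast
  have "[:f':] = (z_var - cst t) * [:b:] + [:[:f'':]:]"
    unfolding line_vars using b by (simp add: f''_def)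
  moreover have "[:[:f'':]:] = (x_var - cst s) * [:[:k:]:] + cst (poly f'' s)"
    unfolding line_vars using k by (simp add: cst_def)
  moreover have "poly f'' s = evp s t u f" by (simp add: f''_def f'_def evp_def)
  moreover have "y_var - cst u = [:- [:[:u:]:], 1:]" by (simp add: y_var_def cst_def)
  ultimately have "f = (y_var - cst u) * g + (z_var - cst t) * [:b:] + (x_var - cst s) * [:[:k:]:]
      + cst (evp s t u f)" using g by (simp add: f'_def add.assoc)
  then show ?thesis by blast
qed

lemma prime_x_minus: "prime_elem (x_var - cst s)"
proof -
  have "prime_elem [:- s, 1:]" by (rule prime_elem_linear_field_poly) simp
  then show ?thesis by (simp add: line_vars prime_elem_const_poly_iff)
qed

lemma x_minus_not_dvd_z_minus: "\<not> x_var - cst s dvd z_var - cst t"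
proof
  assume "x_var - cst s dvd z_var - cst t"
  then obtain q where "z_var - cst t = (x_var - cst s) * q" by (rule dvdE)
  \<comment> \<open>At a point with x = s and z = t + 1 the left side is 1 and the right side is
    0.\<close>
  then have "evp s (t + 1) 0 (z_var - cst t) = evp s (t + 1) 0 ((x_var - cst s) * q)" by simp
  then show False by simp
qed

section \<open>Chains of primes and the Krull dimension\<close>

context hypersurface
begin

text \<open>Three elements of \<open>A\<close> always satisfy such a relation: a dependence together
  with \<open>F\<close> is divided by the power of \<open>F\<close>, and the summand
  \<open>a0 * F\<close> disappears modulo \<open>F\<close>.\<close>

lemma relation:
  "\<exists>m1 m2 m3 a1 a2 a3.
     F dvd g1 ^ m1 * (g2 ^ m2 * (g3 ^ m3 * (1 + a3 * g3) + a2 * g2) + a1 * g1)"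
proof -
  from four_elements_relation[of F g1 g2 g3] obtain m0 m1 m2 m3 a0 a1 a2 a3 where
    "F ^ m0 * (g1 ^ m1 * (g2 ^ m2 * (g3 ^ m3 * (1 + a3 * g3) + a2 * g2) + a1 * g1) + a0 * F) = 0"
    by (elim exE) (rule that)
  then have "g1 ^ m1 * (g2 ^ m2 * (g3 ^ m3 * (1 + a3 * g3) + a2 * g2) + a1 * g1) + a0 * F = 0"
    using F_prime by (auto simp: prime_elem_def)
  then have "g1 ^ m1 * (g2 ^ m2 * (g3 ^ m3 * (1 + a3 * g3) + a2 * g2) + a1 * g1) = F * (- a0)"
    by (simp add: eq_neg_iff_add_eq_0 mult.commute)
  then show ?thesis by (metis dvd_triv_left)
qed

lemma prime_ideal_cls:
  assumes "primeideal P A"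
  shows "cls f \<in> P \<Longrightarrow> cls g \<in> P \<Longrightarrow> cls (f + g) \<in> P" "cls g \<in> P \<Longrightarrow> cls (f * g) \<in> P"
    "cls (f ^ m * g) \<in> P \<Longrightarrow> cls f \<notin> P \<Longrightarrow> cls g \<in> P" "cls 1 \<notin> P" "F dvd f \<Longrightarrow> cls f \<in> P"
proof -
  interpret P: primeideal P A by fact
  show "cls f \<in> P \<Longrightarrow> cls g \<in> P \<Longrightarrow> cls (f + g) \<in> P" by (simp add: cls_add)
  show "cls g \<in> P \<Longrightarrow> cls (f * g) \<in> P" by (simp add: cls_mult P.I_l_closed)
  show "cls 1 \<notin> P" using P.one_imp_carrier P.I_notcarr by (auto simp: cls_one)
  show "F dvd f \<Longrightarrow> cls f \<in> P" using P.zero_closed cls_eq_zero_iff[of f] by simp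
  show "cls g \<in> P" if "cls (f ^ m * g) \<in> P" "cls f \<notin> P"
    using that(1)
  proof (induction m)
    case (Suc m)
    then have "cls f \<otimes>\<^bsub>A\<^esub> cls (f ^ m * g) \<in> P" by (simp add: mult.assoc flip: cls_mult)
    then show ?case using Suc.IH P.I_prime that(2) by (metis cls_closed)
  qed simp
qed

lemma prime_chain_length:
  assumes P: "\<And>i. i \<le> n \<Longrightarrow> primeideal (P i) A" and chain: "\<And>i. i < n \<Longrightarrow> P i \<subset> P (Suc i)"
  shows "n \<le> 2"
proof (rule ccontr)
  assume n: "\<not> n \<le> 2"
  have "\<exists>g. cls g \<in> P (Suc i) \<and> cls g \<notin> P i" if i: "i < n" for i
  proof -
    obtain X where X: "X \<in> P (Suc i)" "X \<notin> P i" using chain[OF i] by blast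
    interpret primeideal "P (Suc i)" A by (rule P) (use i in simp)
    have "X \<in> carrier A" using X(1) by (rule a_Hcarr)
    with X show ?thesis by (auto simp: carrier_A)
  qed
  then obtain g where g: "\<And>i. i < n \<Longrightarrow> cls (g i) \<in> P (Suc i) \<and> cls (g i) \<notin> P i" by metis
  from relation[of "g 0" "g 1" "g 2"] obtain m1 m2 m3 a1 a2 a3 where
    rel: "F dvd g 0 ^ m1 * (g 1 ^ m2 * (g 2 ^ m3 * (1 + a3 * g 2) + a2 * g 1) + a1 * g 0)"
    by (elim exE) (rule that)
  define h2 where "h2 = g 2 ^ m3 * (1 + a3 * g 2) + a2 * g 1"
  define h1 where "h1 = g 1 ^ m2 * h2 + a1 * g 0"
  have pr: "primeideal (P 0) A" "primeideal (P 1) A" "primeideal (P 2) A" "primeideal (P 3) A"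
    using P n by auto
  have gs: "cls (g 0) \<notin> P 0" "cls (g 0) \<in> P 1" "cls (g 1) \<notin> P 1" "cls (g 1) \<in> P 2" "cls (g 2) \<notin> P 2" "cls (g 2) \<in> P 3"
    using g[of 0] g[of 1] g[of 2] n by (auto simp: numeral_2_eq_2 numeral_3_eq_3)
  have sub: "P 0 \<subseteq> P 1" "P 1 \<subseteq> P 2" "P 2 \<subseteq> P 3"
    using chain[of 0] chain[of 1] chain[of 2] n by (auto simp: numeral_2_eq_2 numeral_3_eq_3)
  have step: "cls p \<in> Q" if "primeideal Q A" "cls (p + b * q) \<in> Q" "cls q \<in> Q" for Q p b q
    using prime_ideal_cls(1)[OF that(1,2) prime_ideal_cls(2)[OF that(1,3), of "- b"]] by simp
  \<comment> \<open>Each round cancels a power of \<open>g i\<close> in \<open>P i\<close>, moves to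
    the next prime, which contains \<open>g i\<close>, and drops the multiple of \<open>g i\<close>
    there. The third round leaves 1.\<close>
  have "cls (g 0 ^ m1 * h1) \<in> P 0"
    using rel prime_ideal_cls(5)[OF pr(1)] by (simp add: h1_def h2_def)
  then have "cls h1 \<in> P 1" using prime_ideal_cls(3)[OF pr(1) _ gs(1)] sub(1) by blast
  then have "cls (g 1 ^ m2 * h2) \<in> P 1" unfolding h1_def by (rule step[OF pr(2) _ gs(2)])
  then have "cls h2 \<in> P 2" using prime_ideal_cls(3)[OF pr(2) _ gs(3)] sub(2) by blast
  then have "cls (g 2 ^ m3 * (1 + a3 * g 2)) \<in> P 2" unfolding h2_def by (rule step[OF pr(3) _ gs(4)])
  then have "cls (1 + a3 * g 2) \<in> P 3" using prime_ideal_cls(3)[OF pr(3) _ gs(5)] sub(3) by blast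
  then have "cls 1 \<in> P 3" by (rule step[OF pr(4) _ gs(6)])
  then show False using prime_ideal_cls(4)[OF pr(4)] by blast
qed

text \<open>Primes of \<open>A\<close> are written down as kernels of homomorphisms from the
  polynomial ring to a domain that kill \<open>F\<close>; membership is then a computation with
  \<open>h\<close>.\<close>

definition hom_kernel :: "(poly3 \<Rightarrow> 'd :: idom) \<Rightarrow> poly3 set set" where
  "hom_kernel h = cls ` {f. h f = 0}"

lemma hom_kernel:
  fixes h :: "poly3 \<Rightarrow> 'd :: idom"
  assumes add: "\<And>f g. h (f + g) = h f + h g" and mult: "\<And>f g. h (f * g) = h f * h g"
    and one: "h 1 = 1" and F: "h F = 0"
  shows "cls f \<in> hom_kernel h \<longleftrightarrow> h f = 0" and "primeideal (hom_kernel h) A"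
proof -
  have zero: "h 0 = 0" using mult[of 0 F] F by simp
  have uminus: "h (- f) = - h f" for f using add[of f "- f"] zero by (simp add: add_eq_0_iff)
  have iff: "cls f \<in> hom_kernel h \<longleftrightarrow> h f = 0" for f
  proof
    assume "cls f \<in> hom_kernel h"
    then obtain g where "cls f = cls g" "h g = 0" by (auto simp: hom_kernel_def)
    then obtain k where "f - g = F * k" by (auto simp: cls_eq_iff dvd_def)
    then have "f = F * k + g" by (simp add: algebra_simps)
    then show "h f = 0" using F \<open>h g = 0\<close> by (simp add: add mult)
  qed (auto simp: hom_kernel_def)
  then show "cls f \<in> hom_kernel h \<longleftrightarrow> h f = 0" .
  show "primeideal (hom_kernel h) A"
  proof (rule primeidealI)
    show "ideal (hom_kernel h) A"
    proof (rule idealI)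
      show "ring A" by (rule A.ring_axioms)
      show "subgroup (hom_kernel h) (add_monoid A)"
      proof (rule group.subgroupI[OF A.a_group])
        show "hom_kernel h \<subseteq> carrier (add_monoid A)" by (auto simp: hom_kernel_def)
        show "hom_kernel h \<noteq> {}" using zero by (auto simp: hom_kernel_def)
        show "inv\<^bsub>add_monoid A\<^esub> X \<in> hom_kernel h" if "X \<in> hom_kernel h" for X
        proof -
          from that obtain f where f: "X = cls f" "h f = 0" by (auto simp: hom_kernel_def)
          have "\<ominus>\<^bsub>A\<^esub> X \<in> hom_kernel h" using f uminus by (simp add: iff flip: cls_uminus)
          then show ?thesis by (simp add: a_inv_def)
        qed
        show "X \<otimes>\<^bsub>add_monoid A\<^esub> Y \<in> hom_kernel h" if "X \<in> hom_kernel h" "Y \<in> hom_kernel h" for X Y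
        proof -
          from that obtain f g where "X = cls f" "h f = 0" "Y = cls g" "h g = 0"
            unfolding hom_kernel_def by blast
          then show ?thesis by (simp add: iff add flip: cls_add)
        qed
      qed
      fix X Y assume "X \<in> hom_kernel h" "Y \<in> carrier A"
      then obtain f g where "X = cls f" "h f = 0" "Y = cls g"
        unfolding hom_kernel_def carrier_A by blast
      then show "Y \<otimes>\<^bsub>A\<^esub> X \<in> hom_kernel h" "X \<otimes>\<^bsub>A\<^esub> Y \<in> hom_kernel h"
        by (simp_all add: iff mult flip: cls_mult)
    qed
    show "cring A" by (rule A.cring_axioms)
    show "carrier A \<noteq> hom_kernel h"
    proof
      assume "carrier A = hom_kernel h"
      then have "cls 1 \<in> hom_kernel h" using cls_closed by blast
      then show False using one by (simp add: iff)
    qed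
    fix X Y assume XY: "X \<in> carrier A" "Y \<in> carrier A" "X \<otimes>\<^bsub>A\<^esub> Y \<in> hom_kernel h"
    obtain f g where fg: "X = cls f" "Y = cls g"
      using XY(1,2) unfolding carrier_A by blast
    have "cls (f * g) \<in> hom_kernel h" using XY(3) by (simp only: fg cls_mult)
    then have "h f = 0 \<or> h g = 0" by (simp add: iff mult)
    then show "X \<in> hom_kernel h \<or> Y \<in> hom_kernel h" by (simp add: fg iff)
  qed
qed

lemma evp_power: "evp s t u (f ^ n) = evp s t u f ^ n"
  by (induction n) simp_all

lemma krull_dim_A: "krull_dim A = 2"
proof (rule antisym)
  show "krull_dim A \<le> 2"
    unfolding krull_dim_def
  proof (rule Sup_least, elim CollectE exE conjE)
    fix x n P assume x: "x = enat n" and P: "\<forall>i\<le>n. primeideal (P i) A" "\<forall>i<n. P i \<subset> P (Suc i)"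
    have "n \<le> 2" by (rule prime_chain_length[of n P]) (use P in auto)
    then show "x \<le> 2" by (simp add: x numeral_eq_enat)
  qed
next
  \<comment> \<open>Restriction to the z-axis x = y = 0, with values in polynomials in z. Every term
    of \<open>F\<close> contains x or y, so the axis lies on the surface.\<close>
  define k where "k f = map_poly (\<lambda>c. poly c 0) (poly f 0)" for f :: poly3
  have k_add: "k (f + g) = k f + k g" and k_mult: "k (f * g) = k f * k g" for f g
    by (simp_all add: k_def map_poly_hom_add map_poly_hom_mult)
  have k_one: "k 1 = 1" by (simp add: k_def one_pCons map_poly_pCons)
  have k_vars: "k x_var = 0" "k y_var = 0" "k z_var = [:0, 1:]"
    by (simp_all add: k_def x_var_def y_var_def z_var_def map_poly_pCons)
  have k_power: "k (f ^ m) = k f ^ m" for f m by (induction m) (simp_all add: k_one k_mult)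
  have k_uminus: "k (- f) = - k f" for f using k_add[of f "- f"] by (simp add: k_def add_eq_0_iff)
  have k_F: "k F = 0"
    using exponent_bounds less_trans[OF exponent_bounds(2,3)] unfolding F_poly_def diff_conv_add_uminus k_add k_uminus k_mult k_power k_vars by (simp add: zero_power)
  have ev_F: "evp 0 0 0 F = 0"
    using exponent_bounds less_trans[OF exponent_bounds(2,3)] unfolding F_poly_def
    by (simp add: evp_power zero_power)
  have evp_k: "evp 0 0 0 f = poly (k f) 0" for f
  proof -
    have "poly (poly p 0) 0 = poly (map_poly (\<lambda>c. poly c 0) p) 0" for p :: "complex poly poly"
      by (induction p) (simp_all add: map_poly_pCons)
    then show ?thesis by (simp add: evp_def k_def)
  qed
  note K1 = hom_kernel[of k, OF k_add k_mult k_one k_F]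
  note K2 = hom_kernel[of "evp 0 0 0", OF evp_simps(3,5,2) ev_F]
  \<comment> \<open>The chain surface, z-axis, origin. The class of y lies in the second prime but
    not the first, that of z in the third but not the second.\<close>
  define P where "P i = (if i = 0 then {\<zero>\<^bsub>A\<^esub>} else if i = 1 then hom_kernel k else hom_kernel (evp 0 0 0))"
    for i :: nat
  have "primeideal {\<zero>\<^bsub>A\<^esub>} A" by (rule A.zeroprimeideal)
  then have prime: "primeideal (P i) A" for i using K1(2) K2(2) by (simp add: P_def)
  have "{\<zero>\<^bsub>A\<^esub>} \<subset> hom_kernel k"
  proof
    show "{\<zero>\<^bsub>A\<^esub>} \<subseteq> hom_kernel k"
      using K1(1)[of 0] by (simp add: cls_zero k_def)
    have "cls y_var \<noteq> \<zero>\<^bsub>A\<^esub>"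
    proof
      assume "cls y_var = \<zero>\<^bsub>A\<^esub>"
      then have "F dvd y_var" by (simp add: cls_eq_zero_iff)
      then have "degree F \<le> degree y_var" by (rule dvd_imp_degree_le) (simp add: y_var_def)
      then show False using exponent_bounds by (simp add: degree_F y_var_def)
    qed
    moreover have "cls y_var \<in> hom_kernel k" using K1(1) k_vars by simp
    ultimately show "{\<zero>\<^bsub>A\<^esub>} \<noteq> hom_kernel k" by blast
  qed
  moreover have "hom_kernel k \<subset> hom_kernel (evp 0 0 0)"
  proof
    show "hom_kernel k \<subseteq> hom_kernel (evp 0 0 0)"
      unfolding hom_kernel_def by (intro image_mono) (auto simp: evp_k)
    have "cls z_var \<in> hom_kernel (evp 0 0 0)" "cls z_var \<notin> hom_kernel k"
      using K1(1) K2(1) k_vars by simp_all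
    then show "hom_kernel k \<noteq> hom_kernel (evp 0 0 0)" by blast
  qed
  ultimately have "P i \<subset> P (Suc i)" if "i < 2" for i
    using that by (auto simp: P_def less_2_cases_iff)
  with prime have "enat 2 \<in> {enat n | n. \<exists>P. (\<forall>i\<le>n. primeideal (P i) A) \<and> (\<forall>i<n. P i \<subset> P (Suc i))}"
    by blast
  then have "enat 2 \<le> krull_dim A" unfolding krull_dim_def by (rule Sup_upper)
  then show "2 \<le> krull_dim A" by (simp add: numeral_eq_enat)
qed

end

section \<open>Maximal ideals and points of the surface\<close>

context hypersurface
begin

text \<open>The Nullstellensatz applied to the preimage \<open>J\<close> of the ideal gives x - s, y
  - u and z - t in \<open>J\<close>. The point lies on the surface because otherwise
  \<open>point_expansion\<close>, with \<open>F\<close> in \<open>J\<close>, would put a nonzero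
  constant into \<open>J\<close>.\<close>

lemma maximal_ideal_point:
  assumes "maximalideal \<nn> A"
  obtains s t u where "cls (x_var - cst s) \<in> \<nn>" "cls (z_var - cst t) \<in> \<nn>" "evp s t u F = 0"
proof -
  interpret maximalideal \<nn> A by fact
  have prime: "primeideal \<nn> A" by (rule A.maximalideal_prime[OF assms])
  define J where "J = {g. cls g \<in> \<nn>}"
  have J: "g \<in> J \<Longrightarrow> h \<in> J \<Longrightarrow> g + h \<in> J" "g \<in> J \<Longrightarrow> h * g \<in> J" "1 \<notin> J" for g h
    unfolding J_def mem_Collect_eq
    by (erule (1) prime_ideal_cls(1)[OF prime], erule prime_ideal_cls(2)[OF prime],
        rule prime_ideal_cls(4)[OF prime])
  have "\<exists>h. h * g - 1 \<in> J" if g: "g \<notin> J" for g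
  proof -
    \<comment> \<open>Adjoining \<open>g\<close> strictly enlarges the maximal ideal, hence gives
      everything; writing 1 in the sum yields the inverse of \<open>g\<close> modulo
      \<open>J\<close>.\<close>
    define I' where "I' = \<nn> <+>\<^bsub>A\<^esub> cgenideal A (cls g)"
    have cg: "ideal (cgenideal A (cls g)) A" by (rule A.cgenideal_ideal) simp
    have I': "ideal I' A" unfolding I'_def by (rule A.add_ideals[OF ideal_axioms cg])
    have mem: "X \<oplus>\<^bsub>A\<^esub> Y \<otimes>\<^bsub>A\<^esub> cls g \<in> I'" if "X \<in> \<nn>" "Y \<in> carrier A" for X Y
      using that unfolding I'_def set_add_def' cgenideal_def by blast
    have "X \<in> I'" if "X \<in> \<nn>" for X using mem[OF that A.zero_closed] a_Hcarr[OF that] by simp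
    then have "\<nn> \<subseteq> I'" by blast
    moreover have "cls g \<in> I'" using mem[OF zero_closed A.one_closed] by simp
    then have "I' \<noteq> \<nn>" using g by (auto simp: J_def)
    moreover have "I' \<subseteq> carrier A" using I' by (rule ideal.Icarr[THEN subsetI])
    ultimately have "I' = carrier A" using I_maximal[OF I'] by blast
    then have "\<one>\<^bsub>A\<^esub> \<in> I'" by simp
    then obtain X Y where XY: "X \<in> \<nn>" "Y \<in> carrier A" "\<one>\<^bsub>A\<^esub> = X \<oplus>\<^bsub>A\<^esub> Y \<otimes>\<^bsub>A\<^esub> cls g"
      unfolding I'_def set_add_def' cgenideal_def by blast
    then obtain f h where fh: "X = cls f" "Y = cls h"
      using a_Hcarr[OF XY(1)] unfolding carrier_A by blast
    have "cls 1 = cls (f + h * g)" using XY(3) by (simp only: fh cls_one cls_add cls_mult)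
    then have "F dvd 1 - (f + h * g)" by (simp only: cls_eq_iff)
    then have "1 - (f + h * g) \<in> J" using prime_ideal_cls(5)[OF prime] by (simp add: J_def)
    moreover have "f \<in> J" using XY(1) fh by (simp add: J_def)
    ultimately have "- 1 * ((1 - (f + h * g)) + f) \<in> J" by (intro J)
    then show ?thesis by (auto simp: algebra_simps)
  qed
  from weak_nullstellensatz[of J, OF J this] have point: "\<exists>c. f - cst c \<in> J" for f .
  obtain s t u where stu: "x_var - cst s \<in> J" "z_var - cst t \<in> J" "y_var - cst u \<in> J"
    using point[of x_var] point[of y_var] point[of z_var] by blast
  have "evp s t u F = 0"
  proof (rule ccontr)
    assume nz: "evp s t u F \<noteq> 0"
    obtain g h k where F: "F = (y_var - cst u) * g + (z_var - cst t) * h + (x_var - cst s) * k + cst (evp s t u F)"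
      using point_expansion[of F u t s] by blast
    have "F \<in> J" using prime_ideal_cls(5)[OF prime] by (simp add: J_def)
    moreover have "- g * (y_var - cst u) + - h * (z_var - cst t) + - k * (x_var - cst s) \<in> J"
      using stu by (intro J)
    ultimately have "F + (- g * (y_var - cst u) + - h * (z_var - cst t) + - k * (x_var - cst s)) \<in> J"
      by (rule J)
    also have "F + (- g * (y_var - cst u) + - h * (z_var - cst t) + - k * (x_var - cst s)) = cst (evp s t u F)"
      by (subst F) (simp add: algebra_simps)
    finally have "cst (evp s t u F) \<in> J" .
    then have "cst (inverse (evp s t u F)) * cst (evp s t u F) \<in> J" by (rule J)
    also have "cst (inverse (evp s t u F)) * cst (evp s t u F) = 1"
      using nz by (simp only: cst_simps(4)[symmetric]) (simp add: cst_simps)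
    finally show False using J(3) by blast
  qed
  with stu that show thesis by (simp add: J_def)
qed

lemma on_line_F: "on_line s t F \<noteq> 0"
proof
  assume "on_line s t F = 0"
  then have "coeff (on_line s t F) (degree F) = 0" by simp
  then show False using monic_F by (simp add: on_line_def coeff_map_poly)
qed

lemma x_minus_not_dvd_F: "\<not> x_var - cst s dvd F"
proof
  assume "x_var - cst s dvd F"
  then obtain q where "F = (x_var - cst s) * q" by (rule dvdE)
  then have "on_line s 0 F = 0" by (metis mult_zero_left on_line_simps(2,3))
  then show False using on_line_F by blast
qed

end

section \<open>Regular sequences on \<open>E\<close> and its depth\<close>

context factorization
begin

lemma phi_scaled: "(\<And>i. i < 4 \<Longrightarrow> w i = c * w' i) \<Longrightarrow> phi w i = c * phi w' i"
  using phi_cong[of w "\<lambda>i. c * w' i"] by (simp add: phi_linear)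

text \<open>From (x - s) v = \<open>phi w\<close>, applying \<open>psi\<close> gives (x - s)
  \<open>psi v\<close> = \<open>F w\<close>. The prime x - s does not divide \<open>F\<close>, so it
  divides \<open>w\<close> and cancels from the relation.\<close>

lemma x_minus_regular:
  assumes "X \<in> carrier E" "cls (x_var - cst s) \<odot>\<^bsub>E\<^esub> X = \<zero>\<^bsub>E\<^esub>"
  shows "X = \<zero>\<^bsub>E\<^esub>"
proof -
  let ?\<xi> = "x_var - cst s"
  obtain v where v: "X = pr v" using assms(1) by (auto simp: carrier_E)
  have "pr (\<lambda>i. ?\<xi> * v i) = \<zero>\<^bsub>E\<^esub>" using assms(2) by (simp only: v pr_smult)
  then obtain w where w: "\<And>i. i < 4 \<Longrightarrow> ?\<xi> * v i = phi w i" unfolding pr_eq_zero_iff by blast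
  have "\<exists>g. w i = ?\<xi> * g" if i: "i < 4" for i
  proof -
    have "?\<xi> * psi v i = psi (\<lambda>i. ?\<xi> * v i) i" by (simp only: psi_linear)
    also have "\<dots> = psi (phi w) i" by (subst psi_cong[OF w]) auto
    also have "\<dots> = F * w i" using i by (rule psi_phi)
    finally have "?\<xi> dvd F * w i" by (metis dvd_triv_left)
    then have "?\<xi> dvd w i"
      using prime_x_minus x_minus_not_dvd_F prime_elem_dvd_mult_iff by blast
    then show ?thesis by (auto simp: dvd_def)
  qed
  then obtain w' where w': "\<And>i. i < 4 \<Longrightarrow> w i = ?\<xi> * w' i" by metis
  have nz: "?\<xi> \<noteq> 0" using prime_x_minus by (metis prime_elem_not_zeroI)
  have "v i = phi w' i" if "i < 4" for i
  proof -
    have "?\<xi> * v i = ?\<xi> * phi w' i" using w[OF that] phi_scaled[OF w'] by simp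
    then show ?thesis using nz by (simp only: mult_cancel_left) simp
  qed
  then show ?thesis unfolding v pr_eq_zero_iff by blast
qed

text \<open>Applying \<open>psi\<close> and restricting to the line kills everything but
  \<open>F w\<close>, and \<open>F\<close> is nonzero there, so w = (z - t) g + (x - s) h. Replacing
  v by v - \<open>phi g\<close> makes (z - t) times it a multiple of the prime x - s, which does not
  divide z - t.\<close>

lemma z_minus_regular:
  assumes "X \<in> carrier E" "Y \<in> carrier E"
    and eq: "cls (z_var - cst t) \<odot>\<^bsub>E\<^esub> X = cls (x_var - cst s) \<odot>\<^bsub>E\<^esub> Y"
  shows "\<exists>Z\<in>carrier E. X = cls (x_var - cst s) \<odot>\<^bsub>E\<^esub> Z"
proof -
  let ?\<xi> = "x_var - cst s" and ?\<zeta> = "z_var - cst t"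
  obtain v y where v: "X = pr v" and y: "Y = pr y" using assms(1,2) unfolding carrier_E by blast
  have "pr (\<lambda>i. ?\<zeta> * v i) = pr (\<lambda>i. ?\<xi> * y i)" using eq by (simp only: v y pr_smult)
  then obtain w where w: "\<And>i. i < 4 \<Longrightarrow> ?\<zeta> * v i - ?\<xi> * y i = phi w i" unfolding pr_eq_iff by blast
  have "\<exists>g h. w i = ?\<zeta> * g + ?\<xi> * h" if i: "i < 4" for i
  proof -
    have "?\<zeta> * psi v i - ?\<xi> * psi y i = psi (\<lambda>i. ?\<zeta> * v i - ?\<xi> * y i) i" by (simp only: psi_linear)
    also have "\<dots> = psi (phi w) i" by (subst psi_cong[OF w]) auto
    also have "\<dots> = F * w i" using i by (rule psi_phi)
    finally have "on_line s t (F * w i) = on_line s t (?\<zeta> * psi v i - ?\<xi> * psi y i)" by simp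
    also have "\<dots> = 0"
      unfolding on_line_diff[of s t "?\<zeta> * psi v i"] on_line_simps(2-4) by simp
    finally have "on_line s t F * on_line s t (w i) = 0" by simp
    then have "on_line s t (w i) = 0" using on_line_F by simp
    then show ?thesis by (rule on_line_eq_0D)
  qed
  then obtain g h where gh: "\<And>i. i < 4 \<Longrightarrow> w i = ?\<zeta> * g i + ?\<xi> * h i" by metis
  have "\<exists>k. v i - phi g i = ?\<xi> * k" if i: "i < 4" for i
  proof -
    have "phi w i = phi (\<lambda>i. ?\<zeta> * g i + ?\<xi> * h i) i" by (subst phi_cong[OF gh]) auto
    also have "\<dots> = ?\<zeta> * phi g i + ?\<xi> * phi h i" by (simp only: phi_linear)
    finally have "?\<zeta> * v i - ?\<xi> * y i = ?\<zeta> * phi g i + ?\<xi> * phi h i" using w[OF i] by simp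
    moreover have "b - c = d + f \<Longrightarrow> b - d = c + f" for b c d f :: poly3 by (simp add: algebra_simps)
    ultimately have "?\<zeta> * (v i - phi g i) = ?\<xi> * (y i + phi h i)"
      unfolding right_diff_distrib distrib_left by blast
    then have "?\<xi> dvd ?\<zeta> * (v i - phi g i)" by simp
    then have "?\<xi> dvd v i - phi g i"
      using prime_x_minus x_minus_not_dvd_z_minus prime_elem_dvd_mult_iff by blast
    then show ?thesis by (auto simp: dvd_def)
  qed
  then obtain k where k: "\<And>i. i < 4 \<Longrightarrow> v i - phi g i = ?\<xi> * k i" by metis
  have "pr v = pr (\<lambda>i. ?\<xi> * k i)"
    unfolding pr_eq_iff by (intro exI[of _ g] allI impI) (simp add: k[symmetric])
  then show ?thesis unfolding v pr_smult[symmetric] by (intro bexI[of _ "pr k"]) auto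
qed

text \<open>A nonzero row of \<open>\<Psi>(p)\<close> kills \<open>\<Phi>(p)\<close>; if \<open>\<Psi>(p) = 0\<close>, then all \<open>p\<^sub>i, q\<^sub>i\<close> vanish at
  \<open>p\<close> and \<open>\<Phi>(p) = 0\<close> as well.\<close>

lemma left_kernel:
  assumes F0: "evp s t u F = 0"
  obtains lam where "\<exists>i<4. lam i \<noteq> 0" "\<And>w. (\<Sum>i<4. lam i * evp s t u (phi w i)) = 0"
proof (cases "\<exists>j<4. \<exists>i<4. evp s t u (psi (unit i) j) \<noteq> 0")
  case True
  then obtain i j where ij: "i < 4" "j < 4" "evp s t u (psi (unit i) j) \<noteq> 0" by blast
  show thesis
  proof (rule that[of "\<lambda>i. evp s t u (psi (unit i) j)"])
    show "\<exists>i<4. evp s t u (psi (unit i) j) \<noteq> 0" using ij by blast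
    fix w
    have row: "psi w' j = (\<Sum>i<4. psi (unit i) j * w' i)" for w'
      by (simp add: sum_less_4 cofactor_map_def unit_def)
    have "(\<Sum>i<4. evp s t u (psi (unit i) j) * evp s t u (phi w i))
        = evp s t u (\<Sum>i<4. psi (unit i) j * phi w i)" by (simp add: evp_sum)
    also have "\<dots> = evp s t u (F * w j)" using ij(2) by (simp only: row[symmetric] psi_phi)
    also have "\<dots> = 0" using F0 by simp
    finally show "(\<Sum>i<4. evp s t u (psi (unit i) j) * evp s t u (phi w i)) = 0" .
  qed
next
  case False
  then have *: "evp s t u (psi (unit i) j) = 0" if "i < 4" "j < 4" for i j using that by blast
  have entries: "evp s t u p1 = 0" "evp s t u q1 = 0" "evp s t u p2 = 0" "evp s t u q2 = 0"
    "evp s t u p3 = 0" "evp s t u q3 = 0"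
    using *[of 1 1] *[of 0 0] *[of 0 1] *[of 1 0] *[of 0 2] *[of 2 0]
    by (simp_all add: cofactor_map_def unit_def)
  show thesis
  proof (rule that[of "\<lambda>i. 1"])
    show "(\<Sum>i<4. 1 * evp s t u (phi w i)) = 0" for w
      by (intro sum.neutral) (simp add: factor_map_def entries)
  qed (auto intro: exI[of _ 0])
qed

lemma regular_sequence_at_point:
  assumes F0: "evp s t u F = 0"
  shows "regular_sequence A E [cls (x_var - cst s), cls (z_var - cst t)]"
    (is "regular_sequence A E [?f, ?g]")
  unfolding regular_sequence_def
proof (intro conjI allI ballI impI)
  show "set [?f, ?g] \<subseteq> carrier A" by simp
  fix i X assume i: "i < length [?f, ?g]" and X: "X \<in> carrier E"
    and mem: "([?f, ?g] ! i) \<odot>\<^bsub>E\<^esub> X \<in> seq_times_module E (take i [?f, ?g])"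
  have nil: "seq_times_module E [] = {\<zero>\<^bsub>E\<^esub>}" by (rule seq_times_Nil[OF E.module_axioms])
  have single: "seq_times_module E [?f] = {?f \<odot>\<^bsub>E\<^esub> m | m. m \<in> carrier E}"
    by (rule seq_times_single[OF E.module_axioms]) simp
  consider "i = 0" | "i = 1" using i by fastforce
  then show "X \<in> seq_times_module E (take i [?f, ?g])"
  proof cases
    case 1
    then have "?f \<odot>\<^bsub>E\<^esub> X = \<zero>\<^bsub>E\<^esub>" using mem by (simp add: nil)
    then show ?thesis using x_minus_regular[OF X] 1 by (simp add: nil)
  next
    case 2
    then obtain Y where "Y \<in> carrier E" "?g \<odot>\<^bsub>E\<^esub> X = ?f \<odot>\<^bsub>E\<^esub> Y"
      using mem by (auto simp: single)
    then obtain Z where "Z \<in> carrier E" "X = ?f \<odot>\<^bsub>E\<^esub> Z" using z_minus_regular[OF X] by blast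
    then show ?thesis using 2 by (auto simp: single)
  qed
next
  \<comment> \<open>Properness: the submodule cut out by \<open>lam\<close> at the point contains (x
    - s)\<open>E\<close> and (z - t)\<open>E\<close>, yet misses a unit vector on which
    \<open>lam\<close> is nonzero.\<close>
  obtain lam where lam: "\<exists>i<4. lam i \<noteq> 0" and kill: "\<And>w. (\<Sum>i<4. lam i * evp s t u (phi w i)) = 0"
    using left_kernel[OF F0] by blast
  let ?W = "ker_functional lam (evp s t u)"
  obtain i where i: "i < 4" "lam i \<noteq> 0" using lam by blast
  have sub: "seq_times_module E [?f, ?g] \<subseteq> ?W"
  proof (rule seq_times_subset[OF ker_functional_submodule])
    fix h X assume h: "h \<in> set [?f, ?g]" and "X \<in> carrier E"
    then obtain v where v: "X = pr v" by (auto simp: carrier_E)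
    have "h = ?f \<or> h = ?g" using h by simp
    then show "h \<odot>\<^bsub>E\<^esub> X \<in> ?W"
      unfolding v by (elim disjE) (simp_all only: pr_smult ker_functional_mem_iff[OF kill], simp_all)
  qed
  have "pr (unit i) \<notin> ?W"
    using i by (simp only: ker_functional_mem_iff[OF kill] functional_unit) simp
  then have "pr (unit i) \<notin> seq_times_module E [?f, ?g]" using sub by blast
  then show "seq_times_module E [?f, ?g] \<noteq> carrier E" using pr_closed by blast
qed

lemma cancel_regular:
  assumes reg: "\<And>X. X \<in> carrier E \<Longrightarrow> cls g \<odot>\<^bsub>E\<^esub> X \<in> W \<Longrightarrow> X \<in> W"
    and X: "X \<in> carrier E" and "cls (g ^ m * h) \<odot>\<^bsub>E\<^esub> X \<in> W"
  shows "cls h \<odot>\<^bsub>E\<^esub> X \<in> W"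
  using assms(3)
proof (induction m)
  case (Suc m)
  have "cls (g ^ Suc m * h) \<odot>\<^bsub>E\<^esub> X = cls g \<odot>\<^bsub>E\<^esub> (cls (g ^ m * h) \<odot>\<^bsub>E\<^esub> X)"
    using X by (simp add: mult.assoc cls_mult[of g] E.smult_assoc1)
  then have "cls g \<odot>\<^bsub>E\<^esub> (cls (g ^ m * h) \<odot>\<^bsub>E\<^esub> X) \<in> W" using Suc.prems by simp
  then have "cls (g ^ m * h) \<odot>\<^bsub>E\<^esub> X \<in> W" using reg X by simp
  then show ?case by (rule Suc.IH)
qed simp

text \<open>The relation annihilates every X. Regularity cancels the power of \<open>g i\<close>
  modulo \<open>T i\<close>, and the multiple of \<open>g i\<close> lies in
  \<open>T (i + 1)\<close>, so after three rounds X itself lies in \<open>T 3\<close>, against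
  properness.\<close>

lemma regular_sequence_length:
  assumes "regular_sequence A E fs"
  shows "length fs \<le> 2"
proof (rule ccontr)
  assume n: "\<not> length fs \<le> 2"
  have fs: "set fs \<subseteq> carrier A" and not_all: "seq_times_module E fs \<noteq> carrier E"
    and reg: "\<And>i X. i < length fs \<Longrightarrow> X \<in> carrier E \<Longrightarrow>
      (fs ! i) \<odot>\<^bsub>E\<^esub> X \<in> seq_times_module E (take i fs) \<Longrightarrow> X \<in> seq_times_module E (take i fs)"
    using assms unfolding regular_sequence_def by blast+
  define T where "T i = seq_times_module E (take i fs)" for i
  have set_take: "set (take i fs) \<subseteq> carrier A" for i using fs set_take_subset[of i fs] by blast
  have T: "submodule A (T i) E" for i
    unfolding T_def by (rule seq_times_submodule[OF E.module_axioms set_take])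
  have T_mem: "fs ! i \<odot>\<^bsub>E\<^esub> X \<in> T j" if ij: "i < j" "i < length fs" and X: "X \<in> carrier E" for i j X
  proof -
    have "fs ! i \<in> set (take j fs)" using ij by (auto simp: in_set_conv_nth)
    then show ?thesis unfolding T_def by (rule seq_times_mem[OF E.module_axioms set_take _ X])
  qed
  have T_mono: "T i \<subseteq> T j" if "i \<le> j" for i j
    unfolding T_def
  proof (rule seq_times_subset)
    show "submodule A (seq_times_module E (take j fs)) E" using T[of j] by (simp only: T_def)
    fix f X assume "f \<in> set (take i fs)" "X \<in> carrier E"
    then show "f \<odot>\<^bsub>E\<^esub> X \<in> seq_times_module E (take j fs)"
      using set_take_subset_set_take[OF that, of fs]
      by (intro seq_times_mem[OF E.module_axioms set_take]) auto
  qed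
  have "\<exists>g. fs ! i = cls g" if i: "i < length fs" for i
    using subsetD[OF fs nth_mem[OF i]] unfolding carrier_A by blast
  then obtain g where g: "\<And>i. i < length fs \<Longrightarrow> fs ! i = cls (g i)" by metis
  from relation[of "g 0" "g 1" "g 2"] obtain m1 m2 m3 a1 a2 a3 where
    rel: "F dvd g 0 ^ m1 * (g 1 ^ m2 * (g 2 ^ m3 * (1 + a3 * g 2) + a2 * g 1) + a1 * g 0)"
    by (elim exE) (rule that)
  define h2 where "h2 = g 2 ^ m3 * (1 + a3 * g 2) + a2 * g 1"
  define h1 where "h1 = g 1 ^ m2 * h2 + a1 * g 0"
  have cancel: "cls h \<odot>\<^bsub>E\<^esub> X \<in> T i"
    if i: "i < length fs" and X: "X \<in> carrier E" and "cls (g i ^ m * h) \<odot>\<^bsub>E\<^esub> X \<in> T i" for i X m h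
    by (rule cancel_regular[OF _ that(2,3)]) (use reg[OF i] g[OF i] in \<open>simp add: T_def\<close>)
  have drop: "cls p \<odot>\<^bsub>E\<^esub> X \<in> T j"
    if ij: "i < j" "i < length fs" and X: "X \<in> carrier E" and mem: "cls (p + b * g i) \<odot>\<^bsub>E\<^esub> X \<in> T j"
    for i j X p b
  proof -
    interpret W: submodule A "T j" E by (rule T)
    have "cls (- b) \<odot>\<^bsub>E\<^esub> (cls (g i) \<odot>\<^bsub>E\<^esub> X) \<in> T j"
      by (rule W.smult_closed[OF cls_closed]) (use T_mem[OF ij X] g[OF ij(2)] in simp)
    then have "cls (p + b * g i) \<odot>\<^bsub>E\<^esub> X \<oplus>\<^bsub>E\<^esub> cls (- b) \<odot>\<^bsub>E\<^esub> (cls (g i) \<odot>\<^bsub>E\<^esub> X) \<in> T j"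
      by (rule W.m_closed[OF mem])
    also have "cls (p + b * g i) \<odot>\<^bsub>E\<^esub> X \<oplus>\<^bsub>E\<^esub> cls (- b) \<odot>\<^bsub>E\<^esub> (cls (g i) \<odot>\<^bsub>E\<^esub> X)
        = cls ((p + b * g i) + (- b) * g i) \<odot>\<^bsub>E\<^esub> X"
      using X by (simp only: E.smult_assoc1[symmetric] E.smult_l_distr[symmetric] cls_closed
          cls_mult[symmetric] cls_add[symmetric])
    finally show ?thesis by simp
  qed
  have "X \<in> seq_times_module E fs" if X: "X \<in> carrier E" for X
  proof -
    have len: "0 < length fs" "1 < length fs" "2 < length fs" using n by auto
    have "cls (g 0 ^ m1 * h1) = \<zero>\<^bsub>A\<^esub>" using rel by (simp add: h1_def h2_def cls_eq_zero_iff)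
    then have "cls (g 0 ^ m1 * h1) \<odot>\<^bsub>E\<^esub> X = \<zero>\<^bsub>E\<^esub>" using X by simp
    then have "cls (g 0 ^ m1 * h1) \<odot>\<^bsub>E\<^esub> X \<in> T 0" using submodule.zero_closed[OF T[of 0]] by simp
    then have "cls h1 \<odot>\<^bsub>E\<^esub> X \<in> T 1" using cancel[OF len(1) X] T_mono[of 0 1] by blast
    then have "cls (g 1 ^ m2 * h2) \<odot>\<^bsub>E\<^esub> X \<in> T 1"
      unfolding h1_def by (rule drop[OF _ len(1) X, rotated]) simp
    then have "cls h2 \<odot>\<^bsub>E\<^esub> X \<in> T 2" using cancel[OF len(2) X] T_mono[of 1 2] by auto
    then have "cls (g 2 ^ m3 * (1 + a3 * g 2)) \<odot>\<^bsub>E\<^esub> X \<in> T 2"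
      unfolding h2_def by (rule drop[OF _ len(2) X, rotated]) simp
    then have "cls (1 + a3 * g 2) \<odot>\<^bsub>E\<^esub> X \<in> T 3" using cancel[OF len(3) X] T_mono[of 2 3] by auto
    then have "cls 1 \<odot>\<^bsub>E\<^esub> X \<in> T 3" by (rule drop[OF _ len(3) X, rotated]) simp
    then have "X \<in> T 3" using X by (simp add: cls_one)
    \<comment> \<open>The sequence may be longer than three; its first three members already exhaust
      \<open>E\<close>.\<close>
    also have "T 3 \<subseteq> T (length fs)" using n by (intro T_mono) simp
    finally show ?thesis by (simp add: T_def)
  qed
  then have "carrier E \<subseteq> seq_times_module E fs" by blast
  moreover have "seq_times_module E fs \<subseteq> carrier E"
    by (rule submodule.subset[OF seq_times_submodule[OF E.module_axioms fs]])
  ultimately show False using not_all by blast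
qed

lemma depth_E:
  assumes "maximalideal \<nn> A"
  shows "depth A \<nn> E = 2"
proof (rule antisym)
  show "depth A \<nn> E \<le> 2"
    unfolding depth_def
  proof (rule Sup_least, elim CollectE exE conjE)
    fix x fs assume "x = enat (length fs)" "regular_sequence A E fs"
    then show "x \<le> 2" using regular_sequence_length[of fs] by (simp add: numeral_eq_enat)
  qed
  obtain s t u where stu: "cls (x_var - cst s) \<in> \<nn>" "cls (z_var - cst t) \<in> \<nn>" "evp s t u F = 0"
    using maximal_ideal_point[OF assms] by blast
  have "enat (length [cls (x_var - cst s), cls (z_var - cst t)]) \<le> depth A \<nn> E"
    unfolding depth_def
    by (rule Sup_upper, rule CollectI, intro exI conjI)
       (use stu regular_sequence_at_point in auto)
  then show "2 \<le> depth A \<nn> E" by (simp add: numeral_eq_enat eval_nat_numeral)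
qed

lemma maximal_cohen_macaulay_E: "maximal_cohen_macaulay A E"
  unfolding maximal_cohen_macaulay_def
  using E.module_axioms finitely_generated_E depth_E krull_dim_A by simp

end

theorem proposition6p2:
  fixes n q :: int and a :: "nat \<Rightarrow> int" and e :: nat and \<theta> :: param
  assumes "coprime n q" and "1 < q" and "q < n"
    and "4 \<le> e"
    and "\<forall>i\<in>{2..e - 1}. 2 \<le> a i"
    and "of_int n / of_int (n - q) = neg_cfrac (map a [2..<e])"
    and "\<theta> \<in> \<Theta>_min a e"
  shows "maximal_cohen_macaulay (A_ring a e) (E_mod a e \<theta>) \<and>
         has_rank (A_ring a e) (E_mod a e \<theta>) 2 \<and>
         minimally_generated_by (A_ring a e) (E_mod a e \<theta>) 4"
proof -
  interpret factorization a e \<theta>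
    using assms by unfold_locales
  show ?thesis
    using maximal_cohen_macaulay_E has_rank_E minimally_generated_E by blast
qed

end
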